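(* Let $Q\subset\mathbb{R}^2$ be a closed, centrally symmetric, convex plane figure (the unit ball of a planar norm), and let $(H(\mathbb{R}), d_Q, \lambda)$ be the Heisenberg group in exponential coordinates with the Carnot–Carathéodory metric $d_Q$ arising from $\|\cdot\|_Q$ and with 3-dimensional Lebesgue measure $\lambda$. Let $S\subset H(\mathbb{R})\cong\mathbb{R}^3$ be a $C^1$ smooth regular surface given by $F(x,y,z)=0$, with unit normal vector $\vec n=\nabla F/\|\nabla F\|$. Then the Minkowski content of $S$ is $$\mathrm{Sa}_Q(S)=\iint_S\left\|\begin{bmatrix}1&0&-y/2\\0&1&x/2\end{bmatrix}\vec n\,\right\|_{Q^*}\,d\sigma,$$ where $\sigma$ is the Lebesgue (Euclidean) surface area measure on $S$.
   Context: For $Q\subset\mathbb{R}^2$ a closed, centrally symmetric, convex plane figure (compact, nonempty interior), $\|v\|_Q=\inf\{a>0: v\in aQ\}$; the dual norm is $\|y\|_{Q^*}=\max_{x\in Q}\langle x,y\rangle$, with unit ball $Q^*=\{y:\langle x,y\rangle\le 1\ \forall x\in Q\}$. $\|\cdot\|$ is the Euclidean norm. Heisenberg group: $H(\mathbb{R})=\mathbb{R}^3$ with $(x_1,y_1,z_1)*(x_2,y_2,z_2)=(x_1+x_2,\,y_1+y_2,\,z_1+z_2+\frac12(x_1y_2-x_2y_1))$ and left-invariant frame $X=\partial_x-\frac y2\partial_z$, $Y=\partial_y+\frac x2\partial_z$, $Z=\partial_z$. The horizontal plane at $p$ is $\mathcal H_p=\mathrm{span}(X_p,Y_p)$. A curve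 (absolutely continuous) is admissible if its velocity lies in $\mathcal H$ (almost everywhere). The CC-metric is $d_Q(\alpha,\beta)=\inf\{T:\exists\,\gamma:[0,T]\to\mathbb{R}^3$ admissible, $\gamma(0)=\alpha$, $\gamma(T)=\beta$, $\|(\gamma_1',\gamma_2')\|_Q\le 1\}$. A surface is regular if the set of its points $p$ where $\mathcal H_p$ is tangent to it (the characteristic set) has surface measure zero. Minkowski content: for $S$ a regular surface bounding a compact region $E$, $\mathrm{Sa}_Q(S)=\lim_{\varepsilon\to0}\frac{\lambda(\mathcal N_\varepsilon(E))-\lambda(E)}{\varepsilon}=\lim_{\varepsilon\to0}\frac{\lambda(\mathcal N_\varepsilon(S))}{2\varepsilon}$, where $\mathcal N_\varepsilon(A)$ is the $\varepsilon$-neighborhood of $A$ in $d_Q$ (for a surface not bounding a region, the second expression is used).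
   Formalization: The surface S is assumed compact (boundary allowed); for unbounded S the formula can fail, e.g. x²+y²=e^{−z²} has a finite integral, but every ε-neighborhood has infinite volume. *)

theory Defs
  imports "HOL-Analysis.Analysis"
begin

section \<open>Planar norms\<close>

definition planar_unit_ball :: "(real^2) set \<Rightarrow> bool" where
  "planar_unit_ball Q \<longleftrightarrow>
     compact Q \<and> convex Q \<and> interior Q \<noteq> {} \<and> (\<forall>v\<in>Q. - v \<in> Q)"

definition norm_of :: "(real^2) set \<Rightarrow> real^2 \<Rightarrow> real" where
  "norm_of Q v = Inf {a. a > 0 \<and> v \<in> (\<lambda>x. a *\<^sub>R x) ` Q}"

text \<open>For nonempty compact \<open>Q\<close> the supremum is a maximum.\<close>

definition dual_norm_of :: "(real^2) set \<Rightarrow> real^2 \<Rightarrow> real" where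
  "dual_norm_of Q y = (SUP x\<in>Q. x \<bullet> y)"

section \<open>The Heisenberg group and its Carnot--Caratheodory metrics\<close>

definition heis_mult :: "real^3 \<Rightarrow> real^3 \<Rightarrow> real^3" where
  "heis_mult p q =
     vector [p$1 + q$1, p$2 + q$2, p$3 + q$3 + (p$1 * q$2 - q$1 * p$2) / 2]"

definition heis_X :: "real^3 \<Rightarrow> real^3" where
  "heis_X p = vector [1, 0, - (p$2) / 2]"

definition heis_Y :: "real^3 \<Rightarrow> real^3" where
  "heis_Y p = vector [0, 1, p$1 / 2]"

text \<open>The frame is left-invariant: it consists of the velocities at \<open>p\<close> of the left
  translates by \<open>p\<close> of the first two coordinate axes.\<close>

lemma heis_X_left_invariant:
  "((\<lambda>t. heis_mult p (vector [t, 0, 0])) has_vector_derivative heis_X p) (at 0)"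
proof -
  have "(\<lambda>t. heis_mult p (vector [t, 0, 0])) = (\<lambda>t. p + t *\<^sub>R heis_X p)"
    by (auto simp: heis_mult_def heis_X_def vec_eq_iff forall_3 vector_3 field_simps)
  then show ?thesis
    by (auto intro!: derivative_eq_intros)
qed

lemma heis_Y_left_invariant:
  "((\<lambda>t. heis_mult p (vector [0, t, 0])) has_vector_derivative heis_Y p) (at 0)"
proof -
  have "(\<lambda>t. heis_mult p (vector [0, t, 0])) = (\<lambda>t. p + t *\<^sub>R heis_Y p)"
    by (auto simp: heis_mult_def heis_Y_def vec_eq_iff forall_3 vector_3 field_simps)
  then show ?thesis
    by (auto intro!: derivative_eq_intros)
qed

definition horizontal_plane :: "real^3 \<Rightarrow> (real^3) set" where
  "horizontal_plane p = span {heis_X p, heis_Y p}"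

definition absolutely_continuous_curve :: "real \<Rightarrow> (real \<Rightarrow> real^3) \<Rightarrow> bool" where
  "absolutely_continuous_curve T \<gamma> \<longleftrightarrow>
     (\<forall>\<epsilon>>0. \<exists>\<delta>>0. \<forall>(n::nat) a b.
        (\<forall>i<n. 0 \<le> a i \<and> a i \<le> b i \<and> b i \<le> T) \<and>
        disjoint_family_on (\<lambda>i. {a i<..<b i}) {..<n} \<and>
        (\<Sum>i<n. b i - a i) < \<delta> \<longrightarrow>
        (\<Sum>i<n. norm (\<gamma> (b i) - \<gamma> (a i))) < \<epsilon>)"

text \<open>Admissible curves \<open>\<gamma> : [0,T] \<rightarrow> \<real>\<^sup>3\<close> whose planar projection has \<open>Q\<close>-speed at most 1.\<close>

definition admissible_curve :: "(real^2) set \<Rightarrow> real \<Rightarrow> (real \<Rightarrow> real^3) \<Rightarrow> bool" where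
  "admissible_curve Q T \<gamma> \<longleftrightarrow>
     absolutely_continuous_curve T \<gamma> \<and>
     (AE t in lebesgue. t \<in> {0..T} \<longrightarrow>
        (\<exists>v. (\<gamma> has_vector_derivative v) (at t within {0..T}) \<and>
             v \<in> horizontal_plane (\<gamma> t) \<and>
             norm_of Q (vector [v$1, v$2]) \<le> 1))"

definition cc_dist :: "(real^2) set \<Rightarrow> real^3 \<Rightarrow> real^3 \<Rightarrow> real" where
  "cc_dist Q p q =
     Inf {T. T \<ge> 0 \<and> (\<exists>\<gamma>. admissible_curve Q T \<gamma> \<and> \<gamma> 0 = p \<and> \<gamma> T = q)}"

definition cc_nbhd :: "(real^2) set \<Rightarrow> real \<Rightarrow> (real^3) set \<Rightarrow> (real^3) set" where
  "cc_nbhd Q \<epsilon> A = {p. \<exists>q\<in>A. cc_dist Q q p < \<epsilon>}"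

section \<open>Surfaces\<close>

definition C1_level_surface ::
    "(real^3) set \<Rightarrow> (real^3 \<Rightarrow> real) \<Rightarrow> (real^3 \<Rightarrow> real^3) \<Rightarrow> (real^3) set \<Rightarrow> bool" where
  "C1_level_surface U F gradF M \<longleftrightarrow>
     open U \<and>
     (\<forall>p\<in>U. GDERIV F p :> gradF p) \<and> continuous_on U gradF \<and>
     M = {p\<in>U. F p = 0} \<and> (\<forall>p\<in>M. gradF p \<noteq> 0)"

text \<open>A compact surface in the level set \<open>M\<close>, possibly with boundary: a compact subset that
  is the closure of its interior relative to \<open>M\<close>. If \<open>M\<close> is compact, \<open>S = M\<close> is allowed.\<close>

definition compact_subsurface :: "(real^3) set \<Rightarrow> (real^3) set \<Rightarrow> bool" where
  "compact_subsurface M S \<longleftrightarrow>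
     S \<subseteq> M \<and> compact S \<and> S = closure (top_of_set M interior_of S)"

text \<open>An injective \<open>C\<^sup>1\<close> immersion \<open>\<phi> : V \<rightarrow> M\<close> with partial derivatives \<open>\<phi>u\<close>, \<open>\<phi>v\<close>.\<close>

definition C1_patch ::
    "(real^3) set \<Rightarrow> (real^2) set \<Rightarrow> (real^2 \<Rightarrow> real^3) \<Rightarrow>
     (real^2 \<Rightarrow> real^3) \<Rightarrow> (real^2 \<Rightarrow> real^3) \<Rightarrow> bool" where
  "C1_patch M V \<phi> \<phi>u \<phi>v \<longleftrightarrow>
     open V \<and> inj_on \<phi> V \<and> \<phi> ` V \<subseteq> M \<and>
     continuous_on V \<phi>u \<and> continuous_on V \<phi>v \<and>
     (\<forall>w\<in>V. (\<phi> has_derivative (\<lambda>h. h$1 *\<^sub>R \<phi>u w + h$2 *\<^sub>R \<phi>v w)) (at w) \<and>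
            cross3 (\<phi>u w) (\<phi>v w) \<noteq> 0)"

definition is_surface_measure :: "(real^3) set \<Rightarrow> (real^3) measure \<Rightarrow> bool" where
  "is_surface_measure M \<sigma> \<longleftrightarrow>
     sets \<sigma> = sets borel \<and> emeasure \<sigma> (- M) = 0 \<and>
     (\<forall>V \<phi> \<phi>u \<phi>v B. C1_patch M V \<phi> \<phi>u \<phi>v \<and> B \<in> sets borel \<and> B \<subseteq> V \<longrightarrow>
        emeasure \<sigma> (\<phi> ` B) = (\<integral>\<^sup>+ w\<in>B. ennreal (norm (cross3 (\<phi>u w) (\<phi>v w))) \<partial>lborel))"

text \<open>For \<open>M\<close> as in \<^const>\<open>C1_level_surface\<close> there is exactly one such Borel measure: \<open>M\<close> is
  covered by countably many graph patches, on which the area elements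
  \<open>|\<phi>u \<times> \<phi>v| du dv\<close> agree by the change of variables formula.\<close>

definition surface_measure :: "(real^3) set \<Rightarrow> (real^3) measure" where
  "surface_measure M = (THE \<sigma>. is_surface_measure M \<sigma>)"

text \<open>\<open>gradF\<close> is the gradient of a defining function, so \<open>{v. gradF p \<bullet> v = 0}\<close> is the tangent
  plane at \<open>p\<close>.\<close>

definition characteristic_set :: "(real^3 \<Rightarrow> real^3) \<Rightarrow> (real^3) set \<Rightarrow> (real^3) set" where
  "characteristic_set gradF S = {p\<in>S. horizontal_plane p = {v. gradF p \<bullet> v = 0}}"

definition regular_surface ::
    "(real^3 \<Rightarrow> real^3) \<Rightarrow> (real^3) set \<Rightarrow> (real^3) set \<Rightarrow> bool" where
  "regular_surface gradF M S \<longleftrightarrow>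
     emeasure (surface_measure M) (characteristic_set gradF S) = 0"

section \<open>Minkowski content\<close>

text \<open>Requiring \<open>E\<close> to be the closure of its interior excludes degenerate sets such as
  \<open>E = S\<close>, whose frontier is \<open>S\<close> as well.\<close>

definition bounds_region :: "(real^3) set \<Rightarrow> (real^3) set \<Rightarrow> bool" where
  "bounds_region S E \<longleftrightarrow> compact E \<and> E = closure (interior E) \<and> frontier E = S"

text \<open>The content of \<open>S\<close> exists and equals \<open>c\<close>. If \<open>S\<close> bounds a region, the one-sided and the
  two-sided limit both have to be \<open>c\<close>; otherwise only the two-sided one is involved.\<close>

definition has_minkowski_content :: "(real^2) set \<Rightarrow> (real^3) set \<Rightarrow> real \<Rightarrow> bool" where
  "has_minkowski_content Q S c \<longleftrightarrow>
     ((\<lambda>\<epsilon>. measure lebesgue (cc_nbhd Q \<epsilon> S) / (2 * \<epsilon>)) \<longlongrightarrow> c) (at_right 0) \<and>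
     (\<forall>E. bounds_region S E \<longrightarrow>
        ((\<lambda>\<epsilon>. (measure lebesgue (cc_nbhd Q \<epsilon> E) - measure lebesgue E) / \<epsilon>) \<longlongrightarrow> c)
          (at_right 0))"

definition horizontal_matrix :: "real^3 \<Rightarrow> real^3^2" where
  "horizontal_matrix p = vector [vector [1, 0, - (p$2) / 2], vector [0, 1, p$1 / 2]]"

end

theory Submission
  imports Defs
begin

text \<open>
  Let \<open>n\<close> be the unit normal of \<open>S\<close> and \<open>k p\<close> the dual norm of its horizontal part at \<open>p\<close>; this is
  \<^term>\<open>dual_norm_of\<close> applied to \<open>horizontal_matrix p *v n\<close>, so the claim is that the content of \<open>S\<close> is the
  integral of \<open>k\<close>. The reason is that, to first order, the \<open>\<epsilon>\<close>-neighbourhood of the surface \<open>F = 0\<close> is the set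
  where \<open>|F| < \<epsilon> |grad F| k\<close>. Along an admissible curve \<open>F\<close> changes at most at the rate \<open>|grad F| k\<close>, which
  bounds \<open>F\<close> on the neighbourhood from above (\<open>admissible_curve_increment_le\<close>). Conversely, if \<open>v\<close> in \<open>Q\<close> almost
  attains the dual norm, \<open>F\<close> changes almost at this rate along the horizontal segments with direction \<open>v\<close>,
  so these segments already fill such a set (\<open>cc_nbhd_measure_lower\<close>).

  Both bounds become volumes in suitable coordinates. The horizontal segments with direction \<open>v\<close>, like the
  integral curves of every left-invariant field \<open>w = X + b Y + c Z\<close>, are straight lines, and they are
  the fibres of an explicit map \<open>line_proj\<close> to the plane. Where \<open>w F \<noteq> 0\<close>, the pair \<open>(F, line_proj)\<close> is a local chart
  in which the sets above are boxes of height proportional to \<open>\<epsilon>\<close> over the projection of the surface. The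
  Jacobian determinant of the chart is \<open>w F\<close>, and the surface measure is \<open>|grad F| / |w F|\<close> times the area of
  the projection. The factor \<open>w F\<close> cancels, and what remains is \<open>k\<close> times the surface measure, up to a factor
  that tends to 1 when the piece of surface shrinks to a point (\<open>local_content_upper\<close>, \<open>local_content_lower\<close>).

  Passing from small pieces to \<open>S\<close> is a covering argument: \<open>S\<close> is cut along spheres of surface measure 0
  (\<open>content_estimate_globalise\<close>). To treat one-sided and two-sided contents together, all
  estimates concern the part of the neighbourhood in a set \<open>W\<close> that lies on one side of the surface near each of
  its points (\<open>one_sided_content\<close>). The two sides of \<open>F = 0\<close> add up to the two-sided content; if \<open>S\<close> bounds
  \<open>E\<close>, the complement of \<open>E\<close> is such a set \<open>W\<close>, because every curve that leaves \<open>E\<close> crosses \<open>S\<close>.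

  Two facts make the two sides of the claim meaningful. Neighbourhoods are open, hence measurable, because small
  horizontal parallelograms produce vertical displacements (\<open>open_reachable\<close>). The surface measure exists and is
  unique, because the area elements of overlapping patches agree by the change of variables formula
  (\<open>is_surface_measure_ex1\<close>).
\<close>

section \<open>Planar norms and horizontal velocities\<close>

text \<open>By symmetry \<open>Q\<close> contains a ball around \<open>- x\<close> if it contains one around \<open>x\<close>, and by convexity the midpoints
  of the two balls.\<close>

lemma planar_unit_ball_contains_cball:
  assumes "planar_unit_ball Q"
  obtains r where "r > 0" "cball 0 r \<subseteq> Q"
proof -
  have cQ: "convex Q" and sym: "\<And>v. v \<in> Q \<Longrightarrow> - v \<in> Q" and "interior Q \<noteq> {}"
    using assms by (auto simp: planar_unit_ball_def)
  then obtain x e where e: "e > 0" "cball x e \<subseteq> Q"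
    by (meson all_not_in_conv mem_interior_cball)
  have "y \<in> Q" if "y \<in> cball 0 e" for y
  proof -
    have "x + y \<in> Q" "x - y \<in> Q"
      using that e by (auto simp: dist_norm subset_iff)
    then have "(1/2) *\<^sub>R (x + y) + (1/2) *\<^sub>R (- (x - y)) \<in> Q"
      by (intro convexD[OF cQ] sym) auto
    then show ?thesis
      by (simp add: algebra_simps flip: scaleR_add_left)
  qed
  with e that show ?thesis by blast
qed

lemma planar_unit_ball_bounded:
  assumes "planar_unit_ball Q"
  obtains C where "C > 0" "\<And>v. v \<in> Q \<Longrightarrow> norm v \<le> C"
  using assms compact_imp_bounded[of Q] by (auto simp: planar_unit_ball_def bounded_pos)

text \<open>If the infimum is at most 1, then \<open>v / a\<close> lies in \<open>Q\<close> for every \<open>a > 1\<close>, since \<open>Q\<close> is star-shaped around 0;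
  its limit \<open>v\<close> for \<open>a \<rightarrow> 1\<close> lies in \<open>Q\<close>, since \<open>Q\<close> is closed.\<close>

lemma norm_of_le_1_iff:
  assumes "planar_unit_ball Q"
  shows "norm_of Q v \<le> 1 \<longleftrightarrow> v \<in> Q"
proof
  have cQ: "convex Q" and clQ: "closed Q"
    using assms by (auto simp: planar_unit_ball_def compact_imp_closed)
  obtain r where r: "r > 0" "cball 0 r \<subseteq> Q"
    using planar_unit_ball_contains_cball[OF assms] .
  then have zQ: "0 \<in> Q" by auto
  let ?A = "{a. a > 0 \<and> v \<in> (\<lambda>x. a *\<^sub>R x) ` Q}"
  show "v \<in> Q \<Longrightarrow> norm_of Q v \<le> 1"
    unfolding norm_of_def by (rule cInf_lower) (auto intro: bdd_belowI[of _ 0])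
  assume le: "norm_of Q v \<le> 1"
  have ne: "?A \<noteq> {}"
  proof (cases "v = 0")
    case True
    then show ?thesis using zQ by (auto intro!: exI[of _ 1])
  next
    case False
    then have "(r / norm v) *\<^sub>R v \<in> Q" using r by auto
    then have "norm v / r \<in> ?A"
      using False r by (auto intro!: image_eqI[of _ _ "(r / norm v) *\<^sub>R v"])
    then show ?thesis by blast
  qed
  have "(1 / (1 + 1 / real (Suc n))) *\<^sub>R v \<in> Q" for n
  proof -
    have "norm_of Q v < 1 + 1 / real (Suc n)"
      by (rule order_le_less_trans[OF le]) simp
    then obtain a where a: "a \<in> ?A" "a < 1 + 1 / real (Suc n)"
      unfolding norm_of_def using cInf_lessD[OF ne] by blast
    define c where "c = 1 + 1 / real (Suc n)"
    obtain x where x: "x \<in> Q" "v = a *\<^sub>R x" "a > 0" using a by auto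
    have c: "a < c" "c > 0" using a x by (auto simp: c_def)
    have "(a / c) *\<^sub>R x + (1 - a / c) *\<^sub>R 0 \<in> Q"
      using x c zQ by (intro convexD[OF cQ]) auto
    then show ?thesis unfolding c_def[symmetric] using x by simp
  qed
  moreover have "(\<lambda>n. (1 / (1 + 1 / real (Suc n))) *\<^sub>R v) \<longlonglongrightarrow> (1 / (1 + 0)) *\<^sub>R v"
    by (intro tendsto_intros LIMSEQ_Suc[OF lim_1_over_n]) auto
  ultimately show "v \<in> Q"
    using closed_sequentially[OF clQ] by fastforce
qed

lemma planar_unit_ball_0: "planar_unit_ball Q \<Longrightarrow> 0 \<in> Q"
  by (metis centre_in_cball less_imp_le planar_unit_ball_contains_cball subsetD)

lemma inner_le_dual_norm_of:
  assumes "planar_unit_ball Q" "x \<in> Q"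
  shows "x \<bullet> y \<le> dual_norm_of Q y"
proof -
  have "compact ((\<lambda>x. x \<bullet> y) ` Q)"
    using assms by (auto simp: planar_unit_ball_def intro!: compact_continuous_image continuous_intros)
  then show ?thesis
    unfolding dual_norm_of_def
    using assms by (auto intro!: cSUP_upper bounded_imp_bdd_above compact_imp_bounded)
qed

lemma dual_norm_of_attained:
  assumes "planar_unit_ball Q"
  obtains x where "x \<in> Q" "x \<bullet> y = dual_norm_of Q y"
proof -
  have "compact Q" "Q \<noteq> {}"
    using assms planar_unit_ball_0 by (auto simp: planar_unit_ball_def)
  moreover have "continuous_on Q (\<lambda>x. x \<bullet> y)" by (intro continuous_intros)
  ultimately obtain x where x: "x \<in> Q" "\<forall>z\<in>Q. z \<bullet> y \<le> x \<bullet> y"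
    using continuous_attains_sup[of Q "\<lambda>x. x \<bullet> y"] by blast
  then have "dual_norm_of Q y \<le> x \<bullet> y"
    unfolding dual_norm_of_def using \<open>Q \<noteq> {}\<close> by (auto intro!: cSUP_least)
  with inner_le_dual_norm_of[OF assms x(1), of y] x(1) show ?thesis by (intro that) auto
qed

lemma dual_norm_of_nonneg: "planar_unit_ball Q \<Longrightarrow> 0 \<le> dual_norm_of Q y"
  using inner_le_dual_norm_of[OF _ planar_unit_ball_0, of Q y] by simp

lemma dual_norm_of_uminus:
  assumes "planar_unit_ball Q"
  shows "dual_norm_of Q (- y) = dual_norm_of Q y"
proof -
  have "dual_norm_of Q (- y) \<le> dual_norm_of Q y" for y
  proof -
    obtain x where x: "x \<in> Q" "x \<bullet> (- y) = dual_norm_of Q (- y)"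
      using dual_norm_of_attained[OF assms] .
    then have "- x \<in> Q" using assms by (auto simp: planar_unit_ball_def)
    with x inner_le_dual_norm_of[OF assms, of "- x" y] show ?thesis by simp
  qed
  from this[of y] this[of "- y"] show ?thesis by simp
qed

lemma continuous_on_dual_norm_of:
  assumes "planar_unit_ball Q"
  shows "continuous_on A (dual_norm_of Q)"
proof -
  obtain C where C: "C > 0" "\<And>v. v \<in> Q \<Longrightarrow> norm v \<le> C"
    using planar_unit_ball_bounded[OF assms] by blast
  have *: "dual_norm_of Q y - dual_norm_of Q z \<le> C * norm (y - z)" for y z
  proof -
    obtain x where x: "x \<in> Q" "x \<bullet> y = dual_norm_of Q y"
      using dual_norm_of_attained[OF assms] .
    have "dual_norm_of Q y - dual_norm_of Q z \<le> x \<bullet> y - x \<bullet> z"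
      using x inner_le_dual_norm_of[OF assms x(1), of z] by simp
    also have "\<dots> = x \<bullet> (y - z)" by (simp add: inner_diff_right)
    also have "\<dots> \<le> norm x * norm (y - z)" by (rule norm_cauchy_schwarz)
    also have "\<dots> \<le> C * norm (y - z)" using C x by (intro mult_right_mono) auto
    finally show ?thesis .
  qed
  have "C-lipschitz_on A (dual_norm_of Q)"
    using *  C
    by (intro lipschitz_onI) (auto simp: dist_norm abs_le_iff intro: order_trans[OF *] simp: norm_minus_commute)
  then show ?thesis by (rule lipschitz_on_continuous_on)
qed

definition horizontal_lift :: "real^3 \<Rightarrow> real^2 \<Rightarrow> real^3" where
  "horizontal_lift p v = v$1 *\<^sub>R heis_X p + v$2 *\<^sub>R heis_Y p"

lemma horizontal_lift_nth [simp]: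
  "horizontal_lift p v $ 1 = v$1"
  "horizontal_lift p v $ 2 = v$2"
  "horizontal_lift p v $ 3 = (p$1 * v$2 - p$2 * v$1) / 2"
  by (simp_all add: horizontal_lift_def heis_X_def heis_Y_def field_simps)

lemma inner_horizontal_lift: "n \<bullet> horizontal_lift p v = v \<bullet> (horizontal_matrix p *v n)"
  by (simp add: inner_vec_def sum_3 sum_2 matrix_vector_mult_def horizontal_matrix_def field_simps)

lemma mem_horizontal_plane_iff:
  "v \<in> horizontal_plane p \<longleftrightarrow> v = horizontal_lift p (vector [v$1, v$2])"
proof
  assume "v \<in> horizontal_plane p"
  then obtain a b where "v = a *\<^sub>R heis_X p + b *\<^sub>R heis_Y p"
    by (auto simp: horizontal_plane_def span_insert span_singleton) (metis add.commute diff_add_cancel)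
  then show "v = horizontal_lift p (vector [v$1, v$2])"
    by (simp add: vec_eq_iff forall_3 heis_X_def heis_Y_def field_simps)
next
  assume "v = horizontal_lift p (vector [v$1, v$2])"
  also have "\<dots> \<in> horizontal_plane p"
    unfolding horizontal_lift_def horizontal_plane_def
    by (intro span_add span_scale span_base) auto
  finally show "v \<in> horizontal_plane p" .
qed

text \<open>If \<open>G\<close> is the gradient of \<open>F\<close>, then \<open>norm (G p) * horizontal_density Q G p\<close> is the largest derivative of
  \<open>F\<close> at \<open>p\<close> in a horizontal direction of \<open>Q\<close>-norm at most 1.\<close>

definition horizontal_density :: "(real^2) set \<Rightarrow> (real^3 \<Rightarrow> real^3) \<Rightarrow> real^3 \<Rightarrow> real" where
  "horizontal_density Q G p = dual_norm_of Q (horizontal_matrix p *v (G p /\<^sub>R norm (G p)))"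

lemma inner_horizontal_lift_le:
  assumes "planar_unit_ball Q" "v \<in> Q"
  shows "G p \<bullet> horizontal_lift p v \<le> norm (G p) * horizontal_density Q G p"
proof (cases "G p = 0")
  case False
  have "(G p /\<^sub>R norm (G p)) \<bullet> horizontal_lift p v \<le> horizontal_density Q G p"
    unfolding inner_horizontal_lift horizontal_density_def
    by (rule inner_le_dual_norm_of[OF assms])
  then show ?thesis using False by (simp add: field_simps)
qed auto

lemma horizontal_density_nonneg: "planar_unit_ball Q \<Longrightarrow> 0 \<le> horizontal_density Q G p"
  by (simp add: horizontal_density_def dual_norm_of_nonneg)

lemma horizontal_density_uminus:
  "planar_unit_ball Q \<Longrightarrow> horizontal_density Q (\<lambda>p. - G p) p = horizontal_density Q G p"
  using dual_norm_of_uminus[of Q "horizontal_matrix p *v (G p /\<^sub>R norm (G p))"]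
  by (simp add: horizontal_density_def matrix_vector_mult_scaleR linear_neg[OF matrix_vector_mul_linear])

lemma continuous_on_vector_2:
  fixes f g :: "'a::topological_space \<Rightarrow> real"
  assumes "continuous_on A f" "continuous_on A g"
  shows "continuous_on A (\<lambda>x. vector [f x, g x] :: real^2)"
proof -
  have eq: "(\<lambda>x. vector [f x, g x] :: real^2) = (\<lambda>x. \<chi> i. if i = 1 then f x else g x)"
    by (auto simp: vec_eq_iff forall_2)
  show ?thesis
    unfolding eq
  proof (rule continuous_on_vec_lambda)
    show "continuous_on A (\<lambda>x. if i = 1 then f x else g x)" for i :: 2
      using assms by (cases "i = 1") simp_all
  qed
qed

lemma continuous_on_horizontal_density:
  assumes Q: "planar_unit_ball Q" and G: "continuous_on A G" and "\<And>p. p \<in> A \<Longrightarrow> G p \<noteq> 0"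
  shows "continuous_on A (horizontal_density Q G)"
proof -
  have eq: "horizontal_matrix p *v n = vector [n$1 - p$2 / 2 * n$3, n$2 + p$1 / 2 * n$3]" for p and n :: "real^3"
    by (simp add: vec_eq_iff forall_2 sum_3 matrix_vector_mult_def horizontal_matrix_def field_simps)
  have "continuous_on A (\<lambda>p. horizontal_matrix p *v (G p /\<^sub>R norm (G p)))"
    unfolding eq using assms by (intro continuous_on_vector_2 continuous_intros G) auto
  then show ?thesis
    unfolding horizontal_density_def
    by (rule continuous_on_compose2[OF continuous_on_dual_norm_of[OF Q, of UNIV]]) auto
qed

section \<open>Increments of absolutely continuous functions\<close>

text \<open>The bookkeeping part of the definition of absolute continuity, separated so that systems of intervals can be
  shifted and cut.\<close>

definition interval_system :: "nat \<Rightarrow> (nat \<Rightarrow> real) \<Rightarrow> (nat \<Rightarrow> real) \<Rightarrow> real \<Rightarrow> real \<Rightarrow> bool" where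
  "interval_system n a b T \<delta> \<longleftrightarrow>
     (\<forall>i<n. 0 \<le> a i \<and> a i \<le> b i \<and> b i \<le> T) \<and>
     disjoint_family_on (\<lambda>i. {a i<..<b i}) {..<n} \<and> (\<Sum>i<n. b i - a i) < \<delta>"

definition ac_on :: "real \<Rightarrow> (real \<Rightarrow> 'a::real_normed_vector) \<Rightarrow> bool" where
  "ac_on T f \<longleftrightarrow> (\<forall>\<epsilon>>0. \<exists>\<delta>>0. \<forall>n a b. interval_system n a b T \<delta> \<longrightarrow>
     (\<Sum>i<n. norm (f (b i) - f (a i))) < \<epsilon>)"

lemma absolutely_continuous_curve_iff: "absolutely_continuous_curve T \<gamma> \<longleftrightarrow> ac_on T \<gamma>"
  by (simp add: absolutely_continuous_curve_def ac_on_def interval_system_def)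

lemma ac_onE:
  assumes "ac_on T f" "\<epsilon> > 0"
  obtains \<delta> where "\<delta> > 0"
    "\<forall>n a b. interval_system n a b T \<delta> \<longrightarrow> (\<Sum>i<n. norm (f (b i) - f (a i))) < \<epsilon>"
  using assms unfolding ac_on_def by blast

lemma ac_on_mono: "ac_on T f \<Longrightarrow> S \<le> T \<Longrightarrow> ac_on S f"
  unfolding ac_on_def interval_system_def by (meson order_trans)

text \<open>Absolute continuity controls the increments over the exceptional null set, differentiability
  those elsewhere. Cousin's lemma provides a partition all of whose intervals are of one of the
  two kinds.\<close>

lemma ac_on_increment_le:
  fixes f :: "real \<Rightarrow> real"
  assumes ac: "ac_on T f" and T: "0 \<le> T" and c: "0 \<le> c"
    and AE: "AE t in lebesgue. t \<in> {0..T} \<longrightarrow>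
               (\<exists>d\<le>c. (f has_vector_derivative d) (at t within {0..T}))"
  shows "f T - f 0 \<le> c * T"
proof -
  have main: "f T - f 0 \<le> c * T + e * (T + 1)" if e: "e > 0" for e
  proof -
    obtain \<delta> where \<delta>: "\<delta> > 0" and ac\<delta>:
      "\<forall>n a b. interval_system n a b T \<delta> \<longrightarrow> (\<Sum>i<n. norm (f (b i) - f (a i))) < e"
      by (rule ac_onE[OF ac e])
    obtain N where N: "N \<in> null_sets lebesgue"
      and good: "\<And>t. t \<notin> N \<Longrightarrow> t \<in> {0..T} \<Longrightarrow> \<exists>d\<le>c. (f has_vector_derivative d) (at t within {0..T})"
      using AE unfolding eventually_ae_filter by auto blast
    \<comment> \<open>Intervals with a tag in \<open>N\<close> are to lie in \<open>B\<close>, so that their total length is below \<open>\<delta>\<close>.\<close>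
    obtain B where B: "open B" "N \<subseteq> B" "B - N \<in> lmeasurable" "emeasure lebesgue (B - N) < ennreal \<delta>"
      using sets_lebesgue_outer_open[of N \<delta>] N \<delta> by (auto simp: null_sets_def)
    have emB: "emeasure lebesgue B < ennreal \<delta>"
      using B N emeasure_Diff_null_set[of N lebesgue B] by (simp add: borel_open)
    have Bl: "B \<in> lmeasurable"
      using emB B by (auto simp: fmeasurable_def intro: order.strict_trans)
    have mB: "measure lebesgue B < \<delta>"
      using emB \<delta> Bl by (simp add: emeasure_eq_measure2 ennreal_less_iff)
    have "\<exists>\<eta>>0. \<forall>u v. u \<in> {0..T} \<and> v \<in> {0..T} \<and> u \<le> t \<and> t \<le> v \<and> u \<in> ball t \<eta> \<and> v \<in> ball t \<eta> \<longrightarrow>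
            f v - f u \<le> (c + e) * (v - u)" if t: "t \<notin> N" "t \<in> {0..T}" for t
    proof -
      obtain d where d: "d \<le> c" "(f has_vector_derivative d) (at t within {0..T})"
        using good t by blast
      then obtain \<eta> where \<eta>: "\<eta> > 0" and
        der: "\<And>y. y \<in> {0..T} \<Longrightarrow> norm (y - t) < \<eta> \<Longrightarrow> norm (f y - f t - (y - t) *\<^sub>R d) \<le> e * norm (y - t)"
        using e unfolding has_vector_derivative_def has_derivative_within_alt by blast
      show ?thesis
      proof (intro exI[of _ \<eta>] conjI allI impI \<eta>)
        fix u v assume *: "u \<in> {0..T} \<and> v \<in> {0..T} \<and> u \<le> t \<and> t \<le> v \<and> u \<in> ball t \<eta> \<and> v \<in> ball t \<eta>"
        have "f v - f t \<le> (v - t) * d + e * (v - t)"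
          using der[of v] * by (auto simp: dist_norm)
        moreover have "f t - f u \<le> (t - u) * d + e * (t - u)"
          using der[of u] * by (auto simp: dist_norm algebra_simps)
        ultimately have "f v - f u \<le> (v - u) * d + e * (v - u)" by (simp add: algebra_simps)
        also have "\<dots> \<le> (v - u) * c + e * (v - u)" using d * by (intro add_right_mono mult_left_mono) auto
        finally show "f v - f u \<le> (c + e) * (v - u)" by (simp add: algebra_simps)
      qed
    qed
    then obtain \<eta> where \<eta>: "\<And>t. t \<notin> N \<Longrightarrow> t \<in> {0..T} \<Longrightarrow> \<eta> t > 0" and
      \<eta>2: "\<And>t u v. t \<notin> N \<Longrightarrow> t \<in> {0..T} \<Longrightarrow> u \<in> {0..T} \<Longrightarrow> v \<in> {0..T} \<Longrightarrow> u \<le> t \<Longrightarrow> t \<le> v \<Longrightarrow> u \<in> ball t (\<eta> t)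
         \<Longrightarrow> v \<in> ball t (\<eta> t) \<Longrightarrow> f v - f u \<le> (c + e) * (v - u)"
      by metis
    define g where "g t = (if t \<in> N then B else if t \<in> {0..T} then ball t (\<eta> t) else ball t 1)" for t
    have "gauge g"
      using B \<eta> by (auto simp: gauge_def g_def)
    then obtain p where p: "p tagged_division_of {0..T}" and fine: "g fine p"
      by (rule fine_division_exists_real)
    have finp: "finite p" using p by blast
    have intv: "\<exists>u v. k = {u..v} \<and> 0 \<le> u \<and> u \<le> x \<and> x \<le> v \<and> v \<le> T" if xk: "(x, k) \<in> p" for x k
    proof -
      obtain u v where k: "k = {u..v}" using tagged_division_ofD(4)[OF p xk] by (auto simp: box_real)
      moreover have "x \<in> k" "k \<subseteq> {0..T}" using tagged_division_ofD(2,3)[OF p xk] by auto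
      ultimately show ?thesis by (auto intro!: exI[of _ u] exI[of _ v])
    qed
    define l where "l = (\<lambda>(x::real, k::real set). Sup k - Inf k)"
    define \<Delta> where "\<Delta> = (\<lambda>(x::real, k::real set). f (Sup k) - f (Inf k))"
    define P where "P = {z \<in> p. fst z \<notin> N}"
    define R where "R = {z \<in> p. fst z \<in> N}"
    have tot: "sum \<Delta> p = f T - f 0"
      using additive_tagged_division_1[OF T p, of f] by (simp add: \<Delta>_def)
    have totl: "sum l p = T"
      using additive_tagged_division_1[OF T p, of "\<lambda>x. x"] by (simp add: l_def)
    have finPR: "finite P" "finite R" using finp by (auto simp: P_def R_def)
    have split: "sum h p = sum h P + sum h R" for h :: "_ \<Rightarrow> real"
      unfolding P_def R_def using finp
      by (subst sum.union_disjoint[symmetric]) (auto intro!: arg_cong[where f="sum h"])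
    have good_le: "\<Delta> z \<le> (c + e) * l z" if "z \<in> P" for z
    proof -
      obtain x k where z: "z = (x, k)" "(x, k) \<in> p" "x \<notin> N" using \<open>z \<in> P\<close> by (cases z) (auto simp: P_def)
      obtain u v where k: "k = {u..v}" "0 \<le> u" "u \<le> x" "x \<le> v" "v \<le> T" using intv[OF z(2)] by blast
      have "k \<subseteq> g x" using fine z by (auto simp: fine_def)
      then have "u \<in> ball x (\<eta> x)" "v \<in> ball x (\<eta> x)" using k z by (auto simp: g_def subset_iff)
      then show ?thesis using \<eta>2[of x u v] k z by (auto simp: \<Delta>_def l_def)
    qed
    have l_nonneg: "l z \<ge> 0" if "z \<in> p" for z
      using intv[of "fst z" "snd z"] that by (cases z) (auto simp: l_def)
    obtain h and n :: nat where h: "bij_betw h {..<n} R"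
      using ex_bij_betw_nat_finite[OF finPR(2)] by (auto simp: atLeast0LessThan)
    define a where "a i = Inf (snd (h i))" for i
    define b where "b i = Sup (snd (h i))" for i
    have hR: "\<exists>x. h i = (x, {a i..b i}) \<and> (x, {a i..b i}) \<in> p \<and> x \<in> N \<and> 0 \<le> a i \<and> a i \<le> x \<and> x \<le> b i \<and> b i \<le> T" 
      if "i < n" for i
    proof -
      have "h i \<in> R" using h that by (auto simp: bij_betw_def)
      then obtain x k where xk: "h i = (x, k)" "(x, k) \<in> p" "x \<in> N" by (cases "h i") (auto simp: R_def)
      obtain u v where k: "k = {u..v}" "0 \<le> u" "u \<le> x" "x \<le> v" "v \<le> T" using intv[OF xk(2)] by blast
      then have "a i = u" "b i = v" by (auto simp: a_def b_def xk)
      with xk k show ?thesis by auto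
    qed
    have disj: "disjoint_family_on (\<lambda>i. {a i<..<b i}) {..<n}"
    proof (unfold disjoint_family_on_def, intro ballI impI)
      fix i j assume ij: "i \<in> {..<n}" "j \<in> {..<n}" "i \<noteq> j"
      obtain x y where x: "h i = (x, {a i..b i})" "(x, {a i..b i}) \<in> p"
         and y: "h j = (y, {a j..b j})" "(y, {a j..b j}) \<in> p"
        using hR ij by (meson lessThan_iff)
      have "h i \<noteq> h j" using h ij by (auto simp: bij_betw_def inj_on_def)
      then show "{a i<..<b i} \<inter> {a j<..<b j} = {}"
        using tagged_division_ofD(5)[OF p x(2) y(2)] x y by simp
    qed
    have subB: "{a i<..<b i} \<subseteq> B" if "i < n" for i
    proof -
      from hR[OF that] obtain x where x: "(x, {a i..b i}) \<in> p" "x \<in> N" by blast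
      then have "{a i..b i} \<subseteq> g x" using fine unfolding fine_def by blast
      then have "{a i..b i} \<subseteq> B" using x by (simp add: g_def)
      then show ?thesis by force
    qed
    have "(\<Sum>i<n. b i - a i) = (\<Sum>i<n. measure lebesgue {a i<..<b i})"
      using hR by (intro sum.cong) force+
    also have "\<dots> = measure lebesgue (\<Union>i<n. {a i<..<b i})"
    proof (rule measure_finite_Union[symmetric])
      show "emeasure lebesgue {a i<..<b i} \<noteq> \<infinity>" for i
        by (cases "a i \<le> b i") auto
    qed (use disj in auto)
    also have "\<dots> \<le> measure lebesgue B"
      using subB Bl by (intro measure_mono_fmeasurable) auto
    also have "\<dots> < \<delta>" by (rule mB)
    finally have "interval_system n a b T \<delta>"
      unfolding interval_system_def using hR disj by (force intro: order_trans)
    then have "(\<Sum>i<n. norm (f (b i) - f (a i))) < e" using ac\<delta> by blast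
    moreover have "sum \<Delta> R = (\<Sum>i<n. f (b i) - f (a i))"
      unfolding sum.reindex_bij_betw[OF h, symmetric]
      by (intro sum.cong refl) (auto simp: \<Delta>_def a_def b_def split: prod.splits)
    moreover have "(\<Sum>i<n. f (b i) - f (a i)) \<le> (\<Sum>i<n. norm (f (b i) - f (a i)))"
      by (intro sum_mono) auto
    ultimately have R_le: "sum \<Delta> R \<le> e" by linarith
    have lP: "sum \<Delta> P \<le> (c + e) * sum l P"
      unfolding sum_distrib_left by (intro sum_mono good_le)
    have "sum l R \<ge> 0" using l_nonneg by (auto simp: R_def intro: sum_nonneg)
    then have "sum l P \<le> T" using totl split[of l] by simp
    then have "sum \<Delta> P \<le> (c + e) * T"
      using lP c e by (meson add_nonneg_pos less_imp_le mult_left_mono order_trans add_nonneg_nonneg)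
    then show ?thesis using R_le tot split[of \<Delta>] by (simp add: algebra_simps)
  qed
  show ?thesis
  proof (rule field_le_epsilon)
    fix e :: real assume "e > 0"
    then show "f T - f 0 \<le> c * T + e" using main[of "e / (T + 1)"] T by simp
  qed
qed

lemma ac_on_compose_lipschitz:
  assumes ac: "ac_on T f" and L: "0 \<le> L"
    and lip: "\<And>s t. s \<in> {0..T} \<Longrightarrow> t \<in> {0..T} \<Longrightarrow> norm (g (f s) - g (f t)) \<le> L * norm (f s - f t)"
  shows "ac_on T (\<lambda>t. g (f t))"
  unfolding ac_on_def
proof (intro allI impI)
  fix e :: real assume "e > 0"
  then have "e / (L + 1) > 0" using L by simp
  from ac this obtain \<delta> where \<delta>: "\<delta> > 0" and ac\<delta>:
    "\<forall>n a b. interval_system n a b T \<delta> \<longrightarrow> (\<Sum>i<n. norm (f (b i) - f (a i))) < e / (L + 1)"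
    by (rule ac_onE)
  show "\<exists>\<delta>>0. \<forall>n a b. interval_system n a b T \<delta> \<longrightarrow> (\<Sum>i<n. norm (g (f (b i)) - g (f (a i)))) < e"
  proof (intro exI[of _ \<delta>] conjI allI impI \<delta>)
    fix n a b assume *: "interval_system n a b T \<delta>"
    have "(\<Sum>i<n. norm (g (f (b i)) - g (f (a i)))) \<le> (\<Sum>i<n. L * norm (f (b i) - f (a i)))"
      using * unfolding interval_system_def by (intro sum_mono lip) (auto intro: order_trans)
    also have "\<dots> = L * (\<Sum>i<n. norm (f (b i) - f (a i)))" by (simp add: sum_distrib_left)
    also have "\<dots> \<le> L * (e / (L + 1))"
      using ac\<delta>[rule_format, OF *] L by (intro mult_left_mono) auto
    also have "\<dots> < e" using L \<open>e > 0\<close> by (simp add: field_simps)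
    finally show "(\<Sum>i<n. norm (g (f (b i)) - g (f (a i)))) < e" .
  qed
qed

lemma ac_on_const: "ac_on T (\<lambda>t. c)"
  by (auto simp: ac_on_def intro!: exI[of _ 1])

text \<open>The scalar bound is applied to the component in the direction of the increment.\<close>

lemma ac_on_norm_increment_le:
  fixes f :: "real \<Rightarrow> 'a::real_inner"
  assumes ac: "ac_on T f" and T: "0 \<le> T" and c: "0 \<le> c"
    and AE: "AE t in lebesgue. t \<in> {0..T} \<longrightarrow>
               (\<exists>d. norm d \<le> c \<and> (f has_vector_derivative d) (at t within {0..T}))"
  shows "norm (f T - f 0) \<le> c * T"
proof (cases "f T = f 0")
  case False
  define u where "u = (f T - f 0) /\<^sub>R norm (f T - f 0)"
  have u: "norm u = 1" using False by (simp add: u_def)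
  have "u \<bullet> f T - u \<bullet> f 0 \<le> c * T"
  proof (rule ac_on_increment_le[OF _ T c])
    show "ac_on T (\<lambda>t. u \<bullet> f t)"
    proof (rule ac_on_compose_lipschitz[OF ac, of 1])
      show "norm (u \<bullet> f s - u \<bullet> f t) \<le> 1 * norm (f s - f t)" for s t
        using Cauchy_Schwarz_ineq2[of u "f s - f t"] u by (simp add: inner_diff_right)
    qed simp
    show "AE t in lebesgue. t \<in> {0..T} \<longrightarrow>
            (\<exists>d\<le>c. ((\<lambda>t. u \<bullet> f t) has_vector_derivative d) (at t within {0..T}))"
      using AE
    proof eventually_elim
      case (elim t)
      show ?case
      proof
        assume "t \<in> {0..T}"
        then obtain d where d: "norm d \<le> c" "(f has_vector_derivative d) (at t within {0..T})"
          using elim by blast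
        have "u \<bullet> d \<le> c" using norm_cauchy_schwarz[of u d] u d by simp
        moreover have "((\<lambda>t. u \<bullet> f t) has_vector_derivative (u \<bullet> d)) (at t within {0..T})"
          by (rule bounded_linear.has_vector_derivative[OF bounded_linear_inner_right d(2)])
        ultimately show "\<exists>d\<le>c. ((\<lambda>t. u \<bullet> f t) has_vector_derivative d) (at t within {0..T})" by blast
      qed
    qed
  qed
  moreover have "u \<bullet> f T - u \<bullet> f 0 = norm (f T - f 0)"
    unfolding inner_diff_right[symmetric] u_def
    using False by (simp add: dot_square_norm power2_eq_square)
  ultimately show ?thesis by simp
qed (use T c in simp)

section \<open>Reachability along admissible curves\<close>

lemma admissible_curve_iff:
  assumes "planar_unit_ball Q"
  shows "admissible_curve Q T \<gamma> \<longleftrightarrow> ac_on T \<gamma> \<and>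
    (AE t in lebesgue. t \<in> {0..T} \<longrightarrow>
      (\<exists>v\<in>Q. (\<gamma> has_vector_derivative horizontal_lift (\<gamma> t) v) (at t within {0..T})))"
proof -
  have "(\<exists>v. (\<gamma> has_vector_derivative v) (at t within {0..T}) \<and> v \<in> horizontal_plane (\<gamma> t) \<and>
             norm_of Q (vector [v$1, v$2]) \<le> 1) \<longleftrightarrow>
        (\<exists>v\<in>Q. (\<gamma> has_vector_derivative horizontal_lift (\<gamma> t) v) (at t within {0..T}))" for t
  proof
    assume "\<exists>v. (\<gamma> has_vector_derivative v) (at t within {0..T}) \<and> v \<in> horizontal_plane (\<gamma> t) \<and>
             norm_of Q (vector [v$1, v$2]) \<le> 1"
    then show "\<exists>v\<in>Q. (\<gamma> has_vector_derivative horizontal_lift (\<gamma> t) v) (at t within {0..T})"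
      using mem_horizontal_plane_iff norm_of_le_1_iff[OF assms] by metis
  next
    assume "\<exists>v\<in>Q. (\<gamma> has_vector_derivative horizontal_lift (\<gamma> t) v) (at t within {0..T})"
    then obtain v where v: "v \<in> Q" "(\<gamma> has_vector_derivative horizontal_lift (\<gamma> t) v) (at t within {0..T})"
      by blast
    have "vector [horizontal_lift (\<gamma> t) v $ 1, horizontal_lift (\<gamma> t) v $ 2] = v"
      by (simp add: vec_eq_iff forall_2)
    then show "\<exists>v. (\<gamma> has_vector_derivative v) (at t within {0..T}) \<and> v \<in> horizontal_plane (\<gamma> t) \<and>
             norm_of Q (vector [v$1, v$2]) \<le> 1"
      using v mem_horizontal_plane_iff norm_of_le_1_iff[OF assms] by metis
  qed
  then show ?thesis
    by (simp add: admissible_curve_def absolutely_continuous_curve_iff)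
qed

definition reaches :: "(real^2) set \<Rightarrow> real \<Rightarrow> real^3 \<Rightarrow> real^3 \<Rightarrow> bool" where
  "reaches Q T p q \<longleftrightarrow> 0 \<le> T \<and> (\<exists>\<gamma>. admissible_curve Q T \<gamma> \<and> \<gamma> 0 = p \<and> \<gamma> T = q)"

lemma reaches_refl:
  assumes "planar_unit_ball Q"
  shows "reaches Q 0 p p"
proof -
  have "((\<lambda>t. p) has_vector_derivative horizontal_lift p 0) (at t within S)" for t S
    by (simp add: horizontal_lift_def)
  then have "admissible_curve Q 0 (\<lambda>t. p)"
    unfolding admissible_curve_iff[OF assms]
    using planar_unit_ball_0[OF assms] by (auto intro!: ac_on_const AE_I2)
  then show ?thesis by (auto simp: reaches_def)
qed

lemma horizontal_lift_along:
  "horizontal_lift (p + t *\<^sub>R horizontal_lift p v) v = horizontal_lift p v"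
  by (simp add: vec_eq_iff forall_3 algebra_simps)

text \<open>The lift of \<open>v\<close> is constant along the line it spans (\<open>horizontal_lift_along\<close>), so this line is an integral
  curve and may be appended to an admissible curve.\<close>

lemma reaches_segment:
  assumes Q: "planar_unit_ball Q" and pq: "reaches Q T p q" and v: "v \<in> Q" and t: "0 \<le> t"
  shows "reaches Q (T + t) p (q + t *\<^sub>R horizontal_lift q v)"
proof -
  obtain \<gamma> where \<gamma>: "admissible_curve Q T \<gamma>" "\<gamma> 0 = p" "\<gamma> T = q" and T: "0 \<le> T"
    using pq by (auto simp: reaches_def)
  define l where "l = horizontal_lift q v"
  define \<kappa> where "\<kappa> s = (if s \<le> T then \<gamma> s else q + (s - T) *\<^sub>R l)" for s
  have ac: "ac_on T \<gamma>" and AE: "AE t in lebesgue. t \<in> {0..T} \<longrightarrow>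
      (\<exists>v\<in>Q. (\<gamma> has_vector_derivative horizontal_lift (\<gamma> t) v) (at t within {0..T}))"
    using \<gamma>(1) admissible_curve_iff[OF Q] by auto
  have "ac_on (T + t) \<kappa>"
    unfolding ac_on_def
  proof (intro allI impI)
    fix e :: real assume "e > 0"
    define L where "L = norm l + 1"
    have L: "L > 0" by (simp add: L_def add_nonneg_pos)
    obtain \<delta> where \<delta>: "\<delta> > 0" and ac\<delta>:
      "\<forall>n a b. interval_system n a b T \<delta> \<longrightarrow> (\<Sum>i<n. norm (\<gamma> (b i) - \<gamma> (a i))) < e / 2"
      by (rule ac_onE[OF ac half_gt_zero[OF \<open>e > 0\<close>]])
    define \<delta>' where "\<delta>' = min \<delta> (e / 2 / L)"
    have \<delta>': "\<delta>' > 0" "\<delta>' \<le> \<delta>" "L * \<delta>' \<le> e / 2"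
      using \<delta> L \<open>e > 0\<close> by (auto simp: \<delta>'_def min_def field_simps)
    show "\<exists>\<delta>>0. \<forall>n a b. interval_system n a b (T + t) \<delta> \<longrightarrow> (\<Sum>i<n. norm (\<kappa> (b i) - \<kappa> (a i))) < e"
    proof (intro exI[of _ \<delta>'] conjI allI impI \<delta>'(1))
      fix n a b assume "interval_system n a b (T + t) \<delta>'"
      then have *: "(\<forall>i<n. 0 \<le> a i \<and> a i \<le> b i \<and> b i \<le> T + t) \<and>
          disjoint_family_on (\<lambda>i. {a i<..<b i}) {..<n} \<and> (\<Sum>i<n. b i - a i) < \<delta>'"
        by (simp add: interval_system_def)
      let ?a = "\<lambda>i. min (a i) T" and ?b = "\<lambda>i. min (b i) T"
      have ab: "0 \<le> a i \<and> a i \<le> b i" if "i < n" for i using * that by auto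
      have "(\<Sum>i<n. norm (\<gamma> (?b i) - \<gamma> (?a i))) < e / 2"
      proof (rule ac\<delta>[rule_format], unfold interval_system_def, intro conjI allI impI)
        show "disjoint_family_on (\<lambda>i. {?a i<..<?b i}) {..<n}"
          using * unfolding disjoint_family_on_def by fastforce
        have "(\<Sum>i<n. ?b i - ?a i) \<le> (\<Sum>i<n. b i - a i)"
        proof (rule sum_mono)
          show "?b i - ?a i \<le> b i - a i" if "i \<in> {..<n}" for i
            using ab[of i] that by (auto simp: min_def)
        qed
        also have "\<dots> < \<delta>" using * \<delta>' by auto
        finally show "(\<Sum>i<n. ?b i - ?a i) < \<delta>" .
        show "?a i \<le> ?b i" if "i < n" for i
          using ab[OF that] by (intro min.mono) auto
        show "0 \<le> ?a i" "?b i \<le> T" if "i < n" for i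
          using ab[OF that] T by auto
      qed
      moreover have "(\<Sum>i<n. L * (b i - a i)) < e / 2"
      proof -
        have "(\<Sum>i<n. L * (b i - a i)) = L * (\<Sum>i<n. b i - a i)" by (simp add: sum_distrib_left)
        also have "\<dots> < L * \<delta>'" using * L by (intro mult_strict_left_mono) auto
        finally show ?thesis using \<delta>' by simp
      qed
      moreover have "norm (\<kappa> (b i) - \<kappa> (a i)) \<le> norm (\<gamma> (?b i) - \<gamma> (?a i)) + L * (b i - a i)"
        if "i < n" for i
      proof -
        \<comment> \<open>Every interval is cut at \<open>T\<close>; the second part has Lipschitz constant \<open>L\<close>.\<close>
        have eq: "\<kappa> s = \<gamma> (min s T) + (max s T - T) *\<^sub>R l" for s
          using \<gamma> by (auto simp: \<kappa>_def min_def max_def)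
        have "\<kappa> (b i) - \<kappa> (a i) = (\<gamma> (?b i) - \<gamma> (?a i)) + (max (b i) T - max (a i) T) *\<^sub>R l"
          unfolding eq by (simp add: algebra_simps)
        also have "norm \<dots> \<le> norm (\<gamma> (?b i) - \<gamma> (?a i)) + \<bar>max (b i) T - max (a i) T\<bar> * norm l"
          by (metis norm_scaleR norm_triangle_ineq)
        also have "\<bar>max (b i) T - max (a i) T\<bar> * norm l \<le> (b i - a i) * L"
          using ab[OF that] by (intro mult_mono) (auto simp: L_def)
        finally show ?thesis by (simp add: mult.commute)
      qed
      then have "(\<Sum>i<n. norm (\<kappa> (b i) - \<kappa> (a i))) \<le> (\<Sum>i<n. norm (\<gamma> (?b i) - \<gamma> (?a i)) + L * (b i - a i))"
        by (intro sum_mono) auto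
      ultimately show "(\<Sum>i<n. norm (\<kappa> (b i) - \<kappa> (a i))) < e" by (simp add: sum.distrib)
    qed
  qed
  moreover have "AE s in lebesgue. s \<in> {0..T + t} \<longrightarrow>
      (\<exists>v\<in>Q. (\<kappa> has_vector_derivative horizontal_lift (\<kappa> s) v) (at s within {0..T + t}))"
  proof -
    have "AE s in lebesgue. s \<noteq> T"
      by (rule AE_I'[of "{T}"]) auto
    with AE show ?thesis
    proof eventually_elim
      case (elim s)
      show ?case
      proof
        assume s: "s \<in> {0..T + t}"
        show "\<exists>v\<in>Q. (\<kappa> has_vector_derivative horizontal_lift (\<kappa> s) v) (at s within {0..T + t})"
        proof (cases "s < T")
          case True
          then obtain w where w: "w \<in> Q" "(\<gamma> has_vector_derivative horizontal_lift (\<gamma> s) w) (at s within {0..T})"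
            using elim s by auto
          have "at s within {0..T} = at s within {0..T + t}"
            using True t by (intro at_within_nhd[of _ "{..<T}"]) auto
          then have "(\<kappa> has_vector_derivative horizontal_lift (\<kappa> s) w) (at s within {0..T + t})"
            using w(2) True s
            by (auto intro!: has_vector_derivative_transform_within[of \<gamma> _ s "{0..T + t}" "T - s" \<kappa>] simp: \<kappa>_def dist_norm)
          with w show ?thesis by blast
        next
          case False
          with elim have "s > T" by auto
          have "((\<lambda>s. q + (s - T) *\<^sub>R l) has_vector_derivative l) (at s within {0..T + t})"
            by (auto intro!: derivative_eq_intros)
          then have "(\<kappa> has_vector_derivative l) (at s within {0..T + t})"
            using \<open>s > T\<close> s
            by (auto intro!: has_vector_derivative_transform_within[of "\<lambda>s. q + (s - T) *\<^sub>R l" _ s "{0..T + t}" "s - T" \<kappa>] simp: \<kappa>_def dist_norm)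
          moreover have "horizontal_lift (\<kappa> s) v = l"
            using \<open>s > T\<close> by (simp add: \<kappa>_def l_def horizontal_lift_along)
          ultimately show ?thesis using v by metis
        qed
      qed
    qed
  qed
  ultimately have "admissible_curve Q (T + t) \<kappa>" using admissible_curve_iff[OF Q] by blast
  moreover have "\<kappa> 0 = p" "\<kappa> (T + t) = q + t *\<^sub>R horizontal_lift q v"
    using T t \<gamma> by (auto simp: \<kappa>_def l_def)
  ultimately show ?thesis
    unfolding reaches_def using T t by (auto intro!: exI[of _ \<kappa>])
qed

lemma reaches_horizontal_lift:
  assumes Q: "planar_unit_ball Q" and r: "r > 0" "cball 0 r \<subseteq> Q" and pq: "reaches Q T p q"
  shows "reaches Q (T + norm w / r) p (q + horizontal_lift q w)"
proof (cases "w = 0")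
  case True
  then show ?thesis using pq by (simp add: horizontal_lift_def)
next
  case False
  have "reaches Q (T + norm w / r) p (q + (norm w / r) *\<^sub>R horizontal_lift q ((r / norm w) *\<^sub>R w))"
    using r False by (intro reaches_segment[OF Q pq]) auto
  also have "(norm w / r) *\<^sub>R horizontal_lift q ((r / norm w) *\<^sub>R w) = horizontal_lift q w"
    using r False by (simp add: vec_eq_iff forall_3 field_simps)
  finally show ?thesis .
qed

lemma norm_vector_axis: "norm (vector [a, 0] :: real^2) = \<bar>a\<bar>" "norm (vector [0, a] :: real^2) = \<bar>a\<bar>"
  by (simp_all add: norm_vec_def L2_set_def sum_2)

text \<open>A horizontal parallelogram with sides \<open>a\<close>, \<open>b\<close> produces the vertical displacement \<open>a * b\<close>;
  its duration is of the order of the square root of this displacement.\<close>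

lemma reaches_vertical:
  assumes Q: "planar_unit_ball Q" and r: "r > 0" "cball 0 r \<subseteq> Q" and pq: "reaches Q T p q"
  shows "reaches Q (T + 4 * sqrt \<bar>c\<bar> / r) p (q + vector [0, 0, c])"
proof -
  define a where "a = sqrt \<bar>c\<bar>"
  define b where "b = sgn c * sqrt \<bar>c\<bar>"
  have "a * b = sgn c * (sqrt \<bar>c\<bar> * sqrt \<bar>c\<bar>)" by (simp only: a_def b_def mult.left_commute)
  then have ab: "a * b = c" by (simp add: sgn_mult_abs)
  have nb: "\<bar>a\<bar> = sqrt \<bar>c\<bar>" "\<bar>b\<bar> = sqrt \<bar>c\<bar>" by (auto simp: a_def b_def abs_mult sgn_if)
  define q1 where "q1 = q + horizontal_lift q (vector [a, 0])"
  define q2 where "q2 = q1 + horizontal_lift q1 (vector [0, b])"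
  define q3 where "q3 = q2 + horizontal_lift q2 (vector [- a, 0])"
  define q4 where "q4 = q3 + horizontal_lift q3 (vector [0, - b])"
  note step = reaches_horizontal_lift[OF Q r]
  have "reaches Q (T + sqrt \<bar>c\<bar> / r + sqrt \<bar>c\<bar> / r + sqrt \<bar>c\<bar> / r + sqrt \<bar>c\<bar> / r) p q4"
    using step[OF step[OF step[OF step[OF pq]]], of "vector [a, 0]" "vector [0, b]" "vector [- a, 0]" "vector [0, - b]"]
    by (simp add: q4_def q3_def q2_def q1_def norm_vector_axis nb)
  moreover have "q4 = q + vector [0, 0, c]"
    unfolding ab[symmetric]
    by (simp add: vec_eq_iff forall_3 q4_def q3_def q2_def q1_def field_simps)
  ultimately show ?thesis by (simp add: algebra_simps)
qed

text \<open>A curve to \<open>q\<close> is prolonged to a nearby point by a horizontal segment and a vertical displacement. The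
  duration of the prolongation depends continuously on the end point and is 0 at \<open>q\<close>, so it fits into the
  time that is left.\<close>

lemma open_reachable:
  assumes Q: "planar_unit_ball Q"
  shows "open {q. \<exists>T<e. reaches Q T p q}"
proof -
  obtain r where r: "r > 0" "cball 0 r \<subseteq> Q" using planar_unit_ball_contains_cball[OF Q] .
  show ?thesis unfolding open_contains_ball
  proof (intro ballI, clarify)
    fix q T assume T: "T < e" "reaches Q T p q"
    define w where "w q' = (vector [q'$1 - q$1, q'$2 - q$2] :: real^2)" for q' :: "real^3"
    define c where "c q' = q'$3 - q$3 - (q$1 * (q'$2 - q$2) - q$2 * (q'$1 - q$1)) / 2" for q' :: "real^3"
    define \<tau> where "\<tau> q' = T + norm (w q') / r + 4 * sqrt \<bar>c q'\<bar> / r" for q'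
    have "isCont \<tau> q"
    proof -
      have "continuous_on UNIV \<tau>"
        unfolding \<tau>_def w_def c_def
        by (intro continuous_intros continuous_on_vector_2) (use r in auto)
      then show ?thesis by (simp add: continuous_on_eq_continuous_at)
    qed
    moreover have "\<tau> q = T"
      using norm_vector_axis(1)[of 0] by (simp add: \<tau>_def w_def c_def)
    ultimately have "\<forall>\<^sub>F q' in nhds q. \<tau> q' < e"
      using T unfolding isCont_def by (metis order_tendstoD(2) tendsto_at_iff_tendsto_nhds)
    then obtain d where d: "d > 0" "\<And>q'. dist q' q < d \<Longrightarrow> \<tau> q' < e"
      unfolding eventually_nhds_metric by blast
    have "reaches Q (\<tau> q') p q'" for q'
    proof -
      have "q' = q + horizontal_lift q (w q') + vector [0, 0, c q']"
        by (simp add: vec_eq_iff forall_3 w_def c_def field_simps)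
      then show ?thesis
        using reaches_vertical[OF Q r reaches_horizontal_lift[OF Q r T(2), of "w q'"], of "c q'"]
        by (simp add: \<tau>_def)
    qed
    then show "\<exists>d>0. ball q d \<subseteq> {q. \<exists>T<e. reaches Q T p q}"
      using d by (metis (no_types, lifting) dist_commute mem_Collect_eq mem_ball subsetI)
  qed
qed

lemma reaches_exists:
  assumes Q: "planar_unit_ball Q"
  shows "\<exists>T. reaches Q T p q"
proof -
  obtain r where r: "r > 0" "cball 0 r \<subseteq> Q" using planar_unit_ball_contains_cball[OF Q] .
  define w where "w = (vector [q$1 - p$1, q$2 - p$2] :: real^2)"
  define c where "c = q$3 - p$3 - (p$1 * (q$2 - p$2) - p$2 * (q$1 - p$1)) / 2"
  have "q = p + horizontal_lift p w + vector [0, 0, c]"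
    by (simp add: vec_eq_iff forall_3 w_def c_def field_simps)
  then show ?thesis
    using reaches_vertical[OF Q r reaches_horizontal_lift[OF Q r reaches_refl[OF Q]], where c = c] by metis
qed

text \<open>Any two points are joined by an admissible curve, so the infimum is over a nonempty set.\<close>

lemma cc_dist_less_iff:
  assumes Q: "planar_unit_ball Q"
  shows "cc_dist Q p q < e \<longleftrightarrow> (\<exists>T<e. reaches Q T p q)"
proof -
  have eq: "cc_dist Q p q = Inf {T. reaches Q T p q}"
    by (simp add: cc_dist_def reaches_def)
  have ne: "{T. reaches Q T p q} \<noteq> {}" using reaches_exists[OF Q] by blast
  have bdd: "bdd_below {T. reaches Q T p q}"
    by (auto intro!: bdd_belowI[of _ 0] simp: reaches_def)
  show ?thesis unfolding eq using cInf_less_iff[OF ne bdd] by auto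
qed

lemma cc_nbhd_eq:
  assumes Q: "planar_unit_ball Q"
  shows "cc_nbhd Q e A = (\<Union>q\<in>A. {p. \<exists>T<e. reaches Q T q p})"
  by (auto simp: cc_nbhd_def cc_dist_less_iff[OF Q])

lemma open_cc_nbhd: "planar_unit_ball Q \<Longrightarrow> open (cc_nbhd Q e A)"
  unfolding cc_nbhd_eq by (intro open_UN ballI open_reachable)

lemma cc_nbhd_superset:
  assumes "planar_unit_ball Q" "0 < e"
  shows "A \<subseteq> cc_nbhd Q e A"
  unfolding cc_nbhd_eq[OF assms(1)] using reaches_refl[OF assms(1)] assms(2) by blast

lemma cc_nbhd_Un: "cc_nbhd Q e (A \<union> B) = cc_nbhd Q e A \<union> cc_nbhd Q e B"
  by (auto simp: cc_nbhd_def)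

lemma cc_nbhd_mono: "A \<subseteq> B \<Longrightarrow> cc_nbhd Q e A \<subseteq> cc_nbhd Q e B"
  by (auto simp: cc_nbhd_def)

text \<open>Admissible curves of duration at most 1 that start in a bounded set have uniformly bounded
  Euclidean speed, because the planar part of the motion stays bounded.\<close>

lemma admissible_curve_displacement:
  assumes Q: "planar_unit_ball Q" and K: "bounded K"
  obtains C where "C > 0"
    "\<And>\<gamma> T t. admissible_curve Q T \<gamma> \<Longrightarrow> \<gamma> 0 \<in> K \<Longrightarrow> T \<le> 1 \<Longrightarrow> t \<in> {0..T} \<Longrightarrow> norm (\<gamma> t - \<gamma> 0) \<le> C * t"
proof -
  obtain C where C: "C > 0" "\<And>v. v \<in> Q \<Longrightarrow> norm v \<le> C"
    using planar_unit_ball_bounded[OF Q] by blast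
  obtain R where R: "R > 0" "\<And>p. p \<in> K \<Longrightarrow> norm p \<le> R"
    using K by (auto simp: bounded_pos)
  define D where "D = 2 * C + (R + C) * C"
  have vi: "\<bar>v $ i\<bar> \<le> C" if "v \<in> Q" for v i
    using component_le_norm_cart[of v i] C(2)[OF that] by linarith
  have "norm (\<gamma> t - \<gamma> 0) \<le> D * t"
    if \<gamma>: "admissible_curve Q T \<gamma>" "\<gamma> 0 \<in> K" "T \<le> 1" "t \<in> {0..T}" for \<gamma> T t
  proof -
    have ac: "ac_on T \<gamma>" and AE: "AE t in lebesgue. t \<in> {0..T} \<longrightarrow>
        (\<exists>v\<in>Q. (\<gamma> has_vector_derivative horizontal_lift (\<gamma> t) v) (at t within {0..T}))"
      using \<gamma>(1) admissible_curve_iff[OF Q] by auto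
    have AEs: "AE r in lebesgue. r \<in> {0..s} \<longrightarrow>
        (\<exists>v\<in>Q. (\<gamma> has_vector_derivative horizontal_lift (\<gamma> r) v) (at r within {0..s}))" if "s \<le> T" for s
      using AE
    proof eventually_elim
      case (elim r)
      have "{0..s} \<subseteq> {0..T}" using that by auto
      then show ?case
        using elim has_vector_derivative_within_subset[where S="{0..T}" and T="{0..s}"] by blast
    qed
    have planar: "\<bar>\<gamma> s $ i\<bar> \<le> R + C" if s: "s \<in> {0..T}" and i: "i = 1 \<or> i = 2" for s i
    proof -
      have "norm (\<gamma> s $ i - \<gamma> 0 $ i) \<le> C * s"
      proof (rule ac_on_norm_increment_le)
        show "ac_on s (\<lambda>s. \<gamma> s $ i)"
        proof (rule ac_on_compose_lipschitz[where f = \<gamma> and g = "\<lambda>p. p $ i" and L = 1])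
          show "ac_on s \<gamma>" using ac s by (auto intro: ac_on_mono)
          show "norm (\<gamma> a $ i - \<gamma> b $ i) \<le> 1 * norm (\<gamma> a - \<gamma> b)" for a b
            using component_le_norm_cart[of "\<gamma> a - \<gamma> b" i] by simp
        qed simp
        have "s \<le> T" using s by simp
        from AEs[OF this]
        show "AE r in lebesgue. r \<in> {0..s} \<longrightarrow>
            (\<exists>d. norm d \<le> C \<and> ((\<lambda>s. \<gamma> s $ i) has_vector_derivative d) (at r within {0..s}))"
        proof eventually_elim
          case (elim r)
          show ?case
          proof
            assume "r \<in> {0..s}"
            then obtain v where v: "v \<in> Q" "(\<gamma> has_vector_derivative horizontal_lift (\<gamma> r) v) (at r within {0..s})"
              using elim by blast
            have "((\<lambda>s. \<gamma> s $ i) has_vector_derivative horizontal_lift (\<gamma> r) v $ i) (at r within {0..s})"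
              by (rule bounded_linear.has_vector_derivative[OF bounded_linear_vec_nth v(2)])
            moreover have "norm (horizontal_lift (\<gamma> r) v $ i) \<le> C"
              using i vi[OF v(1)] by auto
            ultimately show "\<exists>d. norm d \<le> C \<and> ((\<lambda>s. \<gamma> s $ i) has_vector_derivative d) (at r within {0..s})"
              by blast
          qed
        qed
      qed (use s C in auto)
      also have "C * s \<le> C * 1" using s C \<gamma> by (intro mult_left_mono) auto
      finally have "\<bar>\<gamma> s $ i - \<gamma> 0 $ i\<bar> \<le> C" by simp
      moreover have "\<bar>\<gamma> 0 $ i\<bar> \<le> R"
        using component_le_norm_cart[of "\<gamma> 0" i] R(2)[OF \<gamma>(2)] by linarith
      ultimately show ?thesis by linarith
    qed
    show ?thesis
    proof (rule ac_on_norm_increment_le)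
      show "ac_on t \<gamma>" using ac \<gamma> by (auto intro: ac_on_mono)
      show "0 \<le> t" using \<gamma> by simp
      show "0 \<le> D" using C R by (simp add: D_def)
      have "t \<le> T" using \<gamma> by simp
      from AEs[OF this]
      show "AE r in lebesgue. r \<in> {0..t} \<longrightarrow>
            (\<exists>d. norm d \<le> D \<and> (\<gamma> has_vector_derivative d) (at r within {0..t}))"
      proof eventually_elim
        case (elim r)
        show ?case
        proof
          assume r: "r \<in> {0..t}"
          then obtain v where v: "v \<in> Q" "(\<gamma> has_vector_derivative horizontal_lift (\<gamma> r) v) (at r within {0..t})"
            using elim by blast
          have p: "\<bar>\<gamma> r $ 1\<bar> \<le> R + C" "\<bar>\<gamma> r $ 2\<bar> \<le> R + C"
            using planar[of r] r \<gamma> by auto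
          have "norm (horizontal_lift (\<gamma> r) v) \<le> (\<Sum>i\<in>UNIV. \<bar>horizontal_lift (\<gamma> r) v $ i\<bar>)"
            by (rule norm_le_l1_cart)
          also have "\<dots> = \<bar>v $ 1\<bar> + \<bar>v $ 2\<bar> + \<bar>\<gamma> r $ 1 * v $ 2 - \<gamma> r $ 2 * v $ 1\<bar> / 2"
            by (simp add: sum_3)
          also have "\<bar>\<gamma> r $ 1 * v $ 2 - \<gamma> r $ 2 * v $ 1\<bar> \<le> (R + C) * C + (R + C) * C"
          proof -
            have "\<bar>\<gamma> r $ 1 * v $ 2\<bar> \<le> (R + C) * C" "\<bar>\<gamma> r $ 2 * v $ 1\<bar> \<le> (R + C) * C"
              unfolding abs_mult using p vi[OF v(1)] R C by (intro mult_mono; force)+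
            then show ?thesis by linarith
          qed
          finally have "norm (horizontal_lift (\<gamma> r) v) \<le> D"
            using vi[OF v(1), of 1] vi[OF v(1), of 2] by (simp add: D_def mult.commute)
          then show "\<exists>d. norm d \<le> D \<and> (\<gamma> has_vector_derivative d) (at r within {0..t})"
            using v by blast
        qed
      qed
    qed
  qed
  moreover have "D > 0" using C R by (simp add: D_def add_pos_pos)
  ultimately show ?thesis using that by blast
qed

lemma admissible_curve_stays_in:
  assumes Q: "planar_unit_ball Q" and K: "compact K" and B: "open B" "K \<subseteq> B"
  obtains e where "e > 0"
    "\<And>\<gamma> T t. admissible_curve Q T \<gamma> \<Longrightarrow> \<gamma> 0 \<in> K \<Longrightarrow> T < e \<Longrightarrow> t \<in> {0..T} \<Longrightarrow> \<gamma> t \<in> B"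
proof -
  obtain C where C: "C > 0"
    "\<And>\<gamma> T t. admissible_curve Q T \<gamma> \<Longrightarrow> \<gamma> 0 \<in> K \<Longrightarrow> T \<le> 1 \<Longrightarrow> t \<in> {0..T} \<Longrightarrow> norm (\<gamma> t - \<gamma> 0) \<le> C * t"
    using admissible_curve_displacement[OF Q compact_imp_bounded[OF K]] by blast
  obtain d where d: "d > 0" "(\<Union>x\<in>K. ball x d) \<subseteq> B"
    using compact_subset_open_imp_ball_epsilon_subset[OF K B] by blast
  show ?thesis
  proof (rule that[of "min 1 (d / C)"])
    show "0 < min 1 (d / C)" using C d by simp
    fix \<gamma> T t assume *: "admissible_curve Q T \<gamma>" "\<gamma> 0 \<in> K" "T < min 1 (d / C)" "t \<in> {0..T}"
    have "norm (\<gamma> t - \<gamma> 0) \<le> C * t" using C(2)[OF *(1,2) _ *(4)] * by simp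
    also have "\<dots> \<le> C * T" using * C by simp
    also have "\<dots> < d" using * C by (simp add: field_simps)
    finally have "\<gamma> t \<in> ball (\<gamma> 0) d" by (simp add: dist_norm norm_minus_commute)
    then show "\<gamma> t \<in> B" using d * by blast
  qed
qed

lemma cc_nbhd_subset_open:
  assumes Q: "planar_unit_ball Q" and K: "compact K" and B: "open B" "K \<subseteq> B"
  shows "\<forall>\<^sub>F e in at_right 0. cc_nbhd Q e K \<subseteq> B"
proof -
  obtain e where e: "e > 0"
    "\<And>\<gamma> T t. admissible_curve Q T \<gamma> \<Longrightarrow> \<gamma> 0 \<in> K \<Longrightarrow> T < e \<Longrightarrow> t \<in> {0..T} \<Longrightarrow> \<gamma> t \<in> B"
    using admissible_curve_stays_in[OF Q K B] by blast
  have "cc_nbhd Q e' K \<subseteq> B" if e': "e' < e" for e'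
  proof
    fix p assume "p \<in> cc_nbhd Q e' K"
    then obtain \<gamma> T where \<gamma>: "admissible_curve Q T \<gamma>" "\<gamma> 0 \<in> K" "0 \<le> T" "T < e'" "\<gamma> T = p"
      by (auto simp: cc_nbhd_eq[OF Q] reaches_def)
    then show "p \<in> B" using e(2)[OF \<gamma>(1,2), of T] e' by auto
  qed
  then show ?thesis using e by (auto simp: eventually_at_right_field)
qed

lemma admissible_curve_shift:
  assumes Q: "planar_unit_ball Q" and \<gamma>: "admissible_curve Q T \<gamma>" and s: "0 \<le> s"
  shows "admissible_curve Q (T - s) (\<lambda>t. \<gamma> (s + t))"
proof -
  have ac: "ac_on T \<gamma>" and AE: "AE t in lebesgue. t \<in> {0..T} \<longrightarrow>
      (\<exists>v\<in>Q. (\<gamma> has_vector_derivative horizontal_lift (\<gamma> t) v) (at t within {0..T}))"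
    using \<gamma> admissible_curve_iff[OF Q] by auto
  have "ac_on (T - s) (\<lambda>t. \<gamma> (s + t))"
    unfolding ac_on_def
  proof (intro allI impI)
    fix e :: real assume "e > 0"
    with ac obtain \<delta> where \<delta>: "\<delta> > 0" and ac\<delta>:
      "\<forall>n a b. interval_system n a b T \<delta> \<longrightarrow> (\<Sum>i<n. norm (\<gamma> (b i) - \<gamma> (a i))) < e"
      by (rule ac_onE)
    show "\<exists>\<delta>>0. \<forall>n a b. interval_system n a b (T - s) \<delta> \<longrightarrow>
          (\<Sum>i<n. norm (\<gamma> (s + b i) - \<gamma> (s + a i))) < e"
    proof (intro exI[of _ \<delta>] conjI allI impI \<delta>)
      fix n a b assume "interval_system n a b (T - s) \<delta>"
      then have *: "(\<forall>i<n. 0 \<le> a i \<and> a i \<le> b i \<and> b i \<le> T - s) \<and>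
          disjoint_family_on (\<lambda>i. {a i<..<b i}) {..<n} \<and> (\<Sum>i<n. b i - a i) < \<delta>"
        by (simp add: interval_system_def)
      have "disjoint_family_on (\<lambda>i. {s + a i<..<s + b i}) {..<n}"
        unfolding disjoint_family_on_def
      proof (intro ballI impI)
        fix i j assume "i \<in> {..<n}" "j \<in> {..<n}" "i \<noteq> j"
        then have d: "{a i<..<b i} \<inter> {a j<..<b j} = {}" using * by (auto simp: disjoint_family_on_def)
        have "x - s \<in> {a i<..<b i} \<inter> {a j<..<b j}"
          if "x \<in> {s + a i<..<s + b i} \<inter> {s + a j<..<s + b j}" for x
          using that by (auto simp: algebra_simps)
        then show "{s + a i<..<s + b i} \<inter> {s + a j<..<s + b j} = {}" using d by blast
      qed
      then have "interval_system n (\<lambda>i. s + a i) (\<lambda>i. s + b i) T \<delta>"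
        using * s by (auto simp: interval_system_def algebra_simps)
      then show "(\<Sum>i<n. norm (\<gamma> (s + b i) - \<gamma> (s + a i))) < e"
        by (rule ac\<delta>[rule_format])
    qed
  qed
  moreover have "AE t in lebesgue. t \<in> {0..T - s} \<longrightarrow>
      (\<exists>v\<in>Q. ((\<lambda>t. \<gamma> (s + t)) has_vector_derivative horizontal_lift (\<gamma> (s + t)) v) (at t within {0..T - s}))"
  proof -
    obtain N where N: "N \<in> null_sets lebesgue" and good: "\<And>t. t \<notin> N \<Longrightarrow> t \<in> {0..T} \<Longrightarrow>
       \<exists>v\<in>Q. (\<gamma> has_vector_derivative horizontal_lift (\<gamma> t) v) (at t within {0..T})"
      using AE unfolding eventually_ae_filter by auto blast
    have N': "(+) (- s) ` N \<in> null_sets lebesgue"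
      using negligible_translation[of N "- s"] N by (simp add: negligible_iff_null_sets)
    have "\<exists>v\<in>Q. ((\<lambda>t. \<gamma> (s + t)) has_vector_derivative horizontal_lift (\<gamma> (s + t)) v) (at t within {0..T - s})"
      if t: "t \<in> {0..T - s}" "t \<notin> (+) (- s) ` N" for t
    proof -
      have "s + t \<notin> N" using t by (force simp: image_iff)
      then obtain v where v: "v \<in> Q" "(\<gamma> has_vector_derivative horizontal_lift (\<gamma> (s + t)) v) (at (s + t) within {0..T})"
        using good[of "s + t"] t s by auto
      have d: "((+) s has_vector_derivative 1) (at t within {0..T - s})"
        by (auto intro!: derivative_eq_intros)
      have "(\<gamma> has_vector_derivative horizontal_lift (\<gamma> (s + t)) v) (at (s + t) within (+) s ` {0..T - s})"
        using v(2) s by (auto intro: has_vector_derivative_within_subset)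
      from vector_diff_chain_within[OF d this]
      show ?thesis using v(1) by (auto simp: o_def)
    qed
    then show ?thesis
      by (intro AE_I'[OF N']) blast
  qed
  ultimately show ?thesis using admissible_curve_iff[OF Q] by blast
qed

lemma ac_on_imp_continuous_on:
  assumes "ac_on T f"
  shows "continuous_on {0..T} f"
  unfolding continuous_on_iff
proof (intro ballI allI impI)
  fix x e :: real assume x: "x \<in> {0..T}" and "e > 0"
  with assms obtain \<delta> where \<delta>: "\<delta> > 0" and ac\<delta>:
    "\<forall>n a b. interval_system n a b T \<delta> \<longrightarrow> (\<Sum>i<n. norm (f (b i) - f (a i))) < e"
    by (elim ac_onE)
  have *: "norm (f v - f u) < e" if "0 \<le> u" "u \<le> v" "v \<le> T" "v - u < \<delta>" for u v
    using ac\<delta>[rule_format, of 1 "\<lambda>_. u" "\<lambda>_. v"] that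
    by (simp add: interval_system_def disjoint_family_on_def)
  show "\<exists>d>0. \<forall>x'\<in>{0..T}. dist x' x < d \<longrightarrow> dist (f x') (f x) < e"
  proof (intro exI[of _ \<delta>] conjI ballI impI \<delta>)
    fix y assume "y \<in> {0..T}" "dist y x < \<delta>"
    then show "dist (f y) (f x) < e"
      using *[of x y] *[of y x] x by (cases "x \<le> y") (auto simp: dist_norm norm_minus_commute)
  qed
qed

text \<open>A curve leaving \<open>E\<close> crosses the frontier, and its final part is admissible.\<close>

lemma cc_nbhd_diff_eq_frontier:
  assumes Q: "planar_unit_ball Q" and E: "closed E"
  shows "cc_nbhd Q e E - E = cc_nbhd Q e (frontier E) - E"
proof
  show "cc_nbhd Q e (frontier E) - E \<subseteq> cc_nbhd Q e E - E"
    using cc_nbhd_mono[OF frontier_subset_closed[OF E]] by blast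
  show "cc_nbhd Q e E - E \<subseteq> cc_nbhd Q e (frontier E) - E"
  proof
    fix p assume p: "p \<in> cc_nbhd Q e E - E"
    then obtain \<gamma> T where \<gamma>: "admissible_curve Q T \<gamma>" "\<gamma> 0 \<in> E" "0 \<le> T" "T < e" "\<gamma> T = p"
      by (auto simp: cc_nbhd_eq[OF Q] reaches_def)
    have "ac_on T \<gamma>" using \<gamma> admissible_curve_iff[OF Q] by blast
    then have "connected (\<gamma> ` {0..T})"
      by (intro connected_continuous_image ac_on_imp_continuous_on) auto
    moreover have "\<gamma> ` {0..T} \<inter> E \<noteq> {}" "\<gamma> ` {0..T} - E \<noteq> {}"
      using \<gamma> p by force+
    ultimately obtain s where s: "s \<in> {0..T}" "\<gamma> s \<in> frontier E"
      using connected_Int_frontier by blast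
    have "admissible_curve Q (T - s) (\<lambda>t. \<gamma> (s + t))"
      using admissible_curve_shift[OF Q \<gamma>(1)] s by simp
    then have "reaches Q (T - s) (\<gamma> s) p"
      unfolding reaches_def using s \<gamma> by (auto intro!: exI[of _ "\<lambda>t. \<gamma> (s + t)"])
    moreover have "T - s < e" using s \<gamma> by simp
    ultimately show "p \<in> cc_nbhd Q e (frontier E) - E"
      using s p unfolding cc_nbhd_eq[OF Q] by blast
  qed
qed

text \<open>At almost every time the derivative of \<open>F\<close> along the curve is \<open>G \<bullet> horizontal_lift\<close> for some element of
  \<open>Q\<close>. Since \<open>F\<close> is Lipschitz, \<open>F\<close> along the curve is absolutely continuous, so the bound can be integrated.\<close>

lemma admissible_curve_increment_le:
  assumes Q: "planar_unit_ball Q" and \<gamma>: "admissible_curve Q T \<gamma>" and T: "0 \<le> T"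
    and B: "\<And>t. t \<in> {0..T} \<Longrightarrow> \<gamma> t \<in> B"
    and G: "\<And>p. p \<in> B \<Longrightarrow> GDERIV F p :> G p"
    and L: "L-lipschitz_on B F"
    and H: "0 \<le> H" "\<And>p v. p \<in> B \<Longrightarrow> v \<in> Q \<Longrightarrow> G p \<bullet> horizontal_lift p v \<le> H"
  shows "F (\<gamma> T) - F (\<gamma> 0) \<le> H * T"
proof (rule ac_on_increment_le[OF _ T H(1)])
  have ac: "ac_on T \<gamma>" and AE: "AE t in lebesgue. t \<in> {0..T} \<longrightarrow>
      (\<exists>v\<in>Q. (\<gamma> has_vector_derivative horizontal_lift (\<gamma> t) v) (at t within {0..T}))"
    using \<gamma>(1) admissible_curve_iff[OF Q] by auto
  show "ac_on T (\<lambda>t. F (\<gamma> t))"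
    using lipschitz_onD[OF L] B lipschitz_on_nonneg[OF L]
    by (intro ac_on_compose_lipschitz[OF ac, of L]) (auto simp: dist_norm)
  show "AE t in lebesgue. t \<in> {0..T} \<longrightarrow>
      (\<exists>d\<le>H. ((\<lambda>t. F (\<gamma> t)) has_vector_derivative d) (at t within {0..T}))"
    using AE
  proof eventually_elim
    case (elim t)
    show ?case
    proof
      assume t: "t \<in> {0..T}"
      then obtain v where v: "v \<in> Q" "(\<gamma> has_vector_derivative horizontal_lift (\<gamma> t) v) (at t within {0..T})"
        using elim by blast
      have "(F has_derivative (\<lambda>h. h \<bullet> G (\<gamma> t))) (at (\<gamma> t) within \<gamma> ` {0..T})"
        using G[OF B[OF t]] by (auto simp: gderiv_def intro: has_derivative_at_withinI)
      from diff_chain_within[OF v(2)[unfolded has_vector_derivative_def] this]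
      have "((\<lambda>t. F (\<gamma> t)) has_vector_derivative (G (\<gamma> t) \<bullet> horizontal_lift (\<gamma> t) v)) (at t within {0..T})"
        by (simp add: has_vector_derivative_def o_def inner_commute)
      then show "\<exists>d\<le>H. ((\<lambda>t. F (\<gamma> t)) has_vector_derivative d) (at t within {0..T})"
        using H(2)[OF B[OF t] v(1)] by blast
    qed
  qed
qed

section \<open>Charts along transversal left-invariant lines\<close>

text \<open>The left-invariant field \<open>X + b Y + c Z\<close>. Its integral curves are straight lines, and \<open>line_proj\<close> is
  constant on each of them (\<open>line_proj_along\<close>): it takes a point to the second and third coordinate of the
  intersection of its line with the plane \<open>x = 0\<close>.\<close>

definition line_field :: "real \<Rightarrow> real \<Rightarrow> real^3 \<Rightarrow> real^3" where
  "line_field b c p = vector [1, b, c + (b * p$1 - p$2) / 2]"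

definition line_proj :: "real \<Rightarrow> real \<Rightarrow> real^3 \<Rightarrow> real^2" where
  "line_proj b c p =
     vector [p$2 - b * p$1, p$3 - c * p$1 + p$1 * (p$2 - b * p$1) / 2]"

lemma line_field_nth [simp]:
  "line_field b c p $ 1 = 1" "line_field b c p $ 2 = b" "line_field b c p $ 3 = c + (b * p$1 - p$2) / 2"
  by (simp_all add: line_field_def)

lemma line_proj_nth [simp]:
  "line_proj b c p $ 1 = p$2 - b * p$1"
  "line_proj b c p $ 2 = p$3 - c * p$1 + p$1 * (p$2 - b * p$1) / 2"
  by (simp_all add: line_proj_def)

lemma line_proj_along: "line_proj b c (p + t *\<^sub>R line_field b c p) = line_proj b c p"
  by (simp add: vec_eq_iff forall_2 field_simps)

lemma line_field_horizontal: "horizontal_lift p v = v$1 *\<^sub>R line_field (v$2 / v$1) 0 p" if "v$1 \<noteq> 0"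
  using that by (simp add: vec_eq_iff forall_3 field_simps)

text \<open>The fields \<open>X\<close>, \<open>Y\<close>, \<open>Z\<close> span the tangent space, so a nonzero covector cannot vanish on all \<open>X + b Y + c Z\<close>.\<close>

lemma ex_transversal_line_field:
  assumes "n \<noteq> (0 :: real^3)"
  obtains b c where "n \<bullet> line_field b c p \<noteq> 0"
proof (rule ccontr)
  assume "\<not> thesis"
  with that have *: "n \<bullet> line_field b c p = 0" for b c by blast
  have "n$3 = 0" using *[of 0 1] *[of 0 0] by (simp add: inner_vec_def sum_3 field_simps)
  moreover have "n$2 = 0" using *[of 1 0] *[of 0 0] calculation by (simp add: inner_vec_def sum_3 field_simps)
  moreover have "n$1 = 0" using *[of 0 0] calculation by (simp add: inner_vec_def sum_3)
  ultimately show False using assms by (simp add: vec_eq_iff forall_3)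
qed

definition line_chart :: "real \<Rightarrow> real \<Rightarrow> (real^3 \<Rightarrow> real) \<Rightarrow> real^3 \<Rightarrow> real^3" where
  "line_chart b c F p = vector [F p, line_proj b c p $ 1, line_proj b c p $ 2]"

lemma line_chart_nth [simp]:
  "line_chart b c F p $ 1 = F p"
  "line_chart b c F p $ 2 = line_proj b c p $ 1" "line_chart b c F p $ 3 = line_proj b c p $ 2"
  by (simp_all add: line_chart_def)

text \<open>The derivative of the chart at \<open>p\<close>, if \<open>n\<close> is the gradient of \<open>F\<close> there. Its inverse starts from the
  preimage \<open>k'\<close> of \<open>(k$2, k$3)\<close> under the derivative of \<open>line_proj\<close> and corrects it along the line, where
  \<open>line_proj\<close> does not change.\<close>

definition line_chart_deriv :: "real \<Rightarrow> real \<Rightarrow> real^3 \<Rightarrow> real^3 \<Rightarrow> real^3 \<Rightarrow> real^3" where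
  "line_chart_deriv b c n p h =
     vector [h \<bullet> n, h$2 - b * h$1, h$3 - c * h$1 + (h$1 * (p$2 - b * p$1) + p$1 * (h$2 - b * h$1)) / 2]"

definition line_chart_deriv_inv :: "real \<Rightarrow> real \<Rightarrow> real^3 \<Rightarrow> real^3 \<Rightarrow> real^3 \<Rightarrow> real^3" where
  "line_chart_deriv_inv b c n p k =
     (let k' = vector [0, k$2, k$3 - p$1 * k$2 / 2]
      in k' + ((k$1 - n \<bullet> k') / (n \<bullet> line_field b c p)) *\<^sub>R line_field b c p)"

lemma line_chart_deriv_nth [simp]:
  "line_chart_deriv b c n p h $ 1 = h \<bullet> n"
  "line_chart_deriv b c n p h $ 2 = h$2 - b * h$1"
  "line_chart_deriv b c n p h $ 3 = h$3 - c * h$1 + (h$1 * (p$2 - b * p$1) + p$1 * (h$2 - b * h$1)) / 2"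
  by (simp_all add: line_chart_deriv_def)

lemma linear_line_chart_deriv: "linear (line_chart_deriv b c n p)"
  by (rule linearI) (auto simp: vec_eq_iff forall_3 inner_add_left field_simps)

lemma line_chart_deriv_inv_right:
  assumes "n \<bullet> line_field b c p \<noteq> 0"
  shows "line_chart_deriv b c n p (line_chart_deriv_inv b c n p k) = k"
proof -
  define k' where "k' = (vector [0, k$2, k$3 - p$1 * k$2 / 2] :: real^3)"
  define t where "t = (k$1 - n \<bullet> k') / (n \<bullet> line_field b c p)"
  have inv: "line_chart_deriv_inv b c n p k = k' + t *\<^sub>R line_field b c p"
    by (simp add: line_chart_deriv_inv_def k'_def t_def Let_def)
  have "(k' + t *\<^sub>R line_field b c p) \<bullet> n = n \<bullet> k' + t * (n \<bullet> line_field b c p)"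
    by (simp add: inner_add_right inner_commute[of _ n])
  also have "\<dots> = k$1" using assms by (simp add: t_def)
  finally show ?thesis
    unfolding inv by (simp add: vec_eq_iff forall_3 k'_def field_simps)
qed

lemma line_chart_deriv_inv_left:
  assumes "n \<bullet> line_field b c p \<noteq> 0"
  shows "line_chart_deriv_inv b c n p (line_chart_deriv b c n p h) = h"
proof -
  let ?D = "line_chart_deriv b c n p" and ?I = "line_chart_deriv_inv b c n p"
  have "?D \<circ> ?I = id" using line_chart_deriv_inv_right[OF assms] by auto
  then have "surj ?D" by (metis comp_apply id_apply surjI)
  then have "inj ?D" using linear_surjective_imp_injective[OF linear_line_chart_deriv] by blast
  then show ?thesis using line_chart_deriv_inv_right[OF assms, of "?D h"] by (auto dest: injD)
qed

text \<open>The rows of the derivative of \<open>line_proj\<close> have the cross product \<open>line_field\<close>.\<close>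

lemma det_line_chart_deriv: "det (matrix (line_chart_deriv b c n p)) = n \<bullet> line_field b c p"
  by (simp add: det_3 matrix_def axis_def inner_vec_def sum_3 field_simps)

lemma has_derivative_line_proj:
  "(line_proj b c has_derivative
     (\<lambda>h. vector [h$2 - b * h$1, h$3 - c * h$1 + (h$1 * (p$2 - b * p$1) + p$1 * (h$2 - b * h$1)) / 2])) (at p)"
proof (subst has_derivative_componentwise_within, intro ballI)
  fix i :: "real^2" assume "i \<in> Basis"
  then consider "i = axis 1 1" | "i = axis 2 1"
    by (auto simp: Basis_vec_def) (metis exhaust_2)
  then show "((\<lambda>x. line_proj b c x \<bullet> i) has_derivative (\<lambda>h. vector [h$2 - b * h$1,
       h$3 - c * h$1 + (h$1 * (p$2 - b * p$1) + p$1 * (h$2 - b * h$1)) / 2] \<bullet> i)) (at p)"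
    by cases (auto simp: inner_axis intro!: derivative_eq_intros bounded_linear.has_derivative[OF bounded_linear_vec_nth]
        simp: field_simps)
qed

lemma has_derivative_line_chart:
  assumes "GDERIV F p :> n"
  shows "(line_chart b c F has_derivative line_chart_deriv b c n p) (at p)"
proof (subst has_derivative_componentwise_within, intro ballI)
  have F: "(F has_derivative (\<lambda>h. h \<bullet> n)) (at p)" using assms by (simp add: gderiv_def)
  fix i :: "real^3" assume "i \<in> Basis"
  then consider "i = axis 1 1" | "i = axis 2 1" | "i = axis 3 1"
    by (auto simp: Basis_vec_def) (metis exhaust_3)
  then show "((\<lambda>x. line_chart b c F x \<bullet> i) has_derivative (\<lambda>h. line_chart_deriv b c n p h \<bullet> i)) (at p)"
    by cases (auto simp: inner_axis F intro!: derivative_eq_intros bounded_linear.has_derivative[OF bounded_linear_vec_nth]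
        simp: field_simps)
qed

lemma continuous_on_vector_3:
  fixes f g h :: "'a::topological_space \<Rightarrow> real"
  assumes "continuous_on A f" "continuous_on A g" "continuous_on A h"
  shows "continuous_on A (\<lambda>x. vector [f x, g x, h x] :: real^3)"
proof -
  have eq: "(\<lambda>x. vector [f x, g x, h x] :: real^3) = (\<lambda>x. \<chi> i. if i = 1 then f x else if i = 2 then g x else h x)"
    by (auto simp: vec_eq_iff forall_3)
  show ?thesis
    unfolding eq
  proof (rule continuous_on_vec_lambda)
    show "continuous_on A (\<lambda>x. if i = 1 then f x else if i = 2 then g x else h x)" for i :: 3
      using assms by (cases "i = 1"; cases "i = 2") simp_all
  qed
qed

lemma continuous_on_line_field: "continuous_on A (line_field b c)"
  unfolding line_field_def by (intro continuous_on_vector_3 continuous_intros) auto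

lemma continuous_on_line_proj: "continuous_on A (line_proj b c)"
  unfolding line_proj_def by (intro continuous_on_vector_2 continuous_intros) auto

lemma line_chart_local_homeomorphism:
  assumes U: "open U" "\<And>p. p \<in> U \<Longrightarrow> GDERIV F p :> G p" "continuous_on U G"
    and s: "s \<in> U" "G s \<bullet> line_field b c s \<noteq> 0"
  obtains B g where "open B" "s \<in> B" "B \<subseteq> U" "open (line_chart b c F ` B)"
    "homeomorphism B (line_chart b c F ` B) (line_chart b c F) g"
    "\<And>p. p \<in> B \<Longrightarrow> G p \<bullet> line_field b c p \<noteq> 0"
proof -
  define f' where "f' p = Blinfun (line_chart_deriv b c (G p) p)" for p
  have f': "blinfun_apply (f' p) = line_chart_deriv b c (G p) p" for p
    unfolding f'_def
    by (intro bounded_linear_Blinfun_apply linear_conv_bounded_linear[THEN iffD1] linear_line_chart_deriv)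
  define N where "N = {p \<in> U. G p \<bullet> line_field b c p \<noteq> 0}"
  have cont: "continuous_on U (\<lambda>p. G p \<bullet> line_field b c p)"
    by (intro continuous_intros U continuous_on_line_field)
  have "openin (top_of_set U) (U \<inter> (\<lambda>p. G p \<bullet> line_field b c p) -` (- {0}))"
    by (rule continuous_openin_preimage_gen[OF cont]) auto
  then have N: "open N"
    using U(1) by (simp add: openin_open_eq N_def vimage_def Int_def)
  \<comment> \<open>The inverse at \<open>s\<close>, as a bounded linear map.\<close>
  obtain h where h: "linear h" "h \<circ> line_chart_deriv b c (G s) s = id"
    using linear_injective_left_inverse[OF linear_line_chart_deriv, of b c "G s" s] 
      line_chart_deriv_inv_left[OF s(2)] by (metis injI)
  have comp: "Blinfun h o\<^sub>L f' s = id_blinfun"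
    using h by (intro blinfun_eqI)
      (simp add: f' bounded_linear_Blinfun_apply linear_conv_bounded_linear[THEN iffD1] o_def id_def fun_eq_iff)
  have contf': "continuous_on N f'"
    unfolding f'_def
  proof (rule continuous_on_blinfun_componentwise)
    fix i :: "real^3" assume "i \<in> Basis"
    have "continuous_on N (\<lambda>p. line_chart_deriv b c (G p) p i)"
      unfolding line_chart_deriv_def
      by (intro continuous_on_vector_3 continuous_intros continuous_on_subset[OF U(3)]) (auto simp: N_def)
    then show "continuous_on N (\<lambda>p. blinfun_apply (Blinfun (line_chart_deriv b c (G p) p)) i)"
      using f' by (simp add: f'_def)
  qed
  have der: "(line_chart b c F has_derivative blinfun_apply (f' p)) (at p)" if "p \<in> N" for p
    unfolding f' using that by (auto simp: N_def intro!: has_derivative_line_chart U)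
  have sN: "s \<in> N" using s by (simp add: N_def)
  obtain B V g where B: "open B" "B \<subseteq> N" "s \<in> B" "open V" "homeomorphism B V (line_chart b c F) g"
    by (rule inverse_function_theorem[OF N der contf' sN comp]) blast
  then have "V = line_chart b c F ` B" by (auto simp: homeomorphism_def)
  with B that show ?thesis by (auto simp: N_def)
qed

text \<open>The cross product of two vectors orthogonal to \<open>n\<close> is a multiple of \<open>n\<close>.\<close>

lemma cross3_norm_eq:
  assumes "n \<bullet> x = 0" "n \<bullet> y = 0"
  shows "\<bar>w \<bullet> cross3 x y\<bar> * norm n = norm (cross3 x y) * \<bar>n \<bullet> w\<bar>"
proof (cases "n = 0")
  case False
  define N where "N = cross3 x y"
  have "cross3 n N = 0" using assms by (simp add: N_def Lagrange)
  then have eq: "(n \<bullet> N) *\<^sub>R n = (n \<bullet> n) *\<^sub>R N"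
    using Lagrange[of n n N] by simp
  have "\<bar>n \<bullet> N\<bar> * norm n = norm n * norm n * norm N"
    using arg_cong[OF eq, of norm] unfolding norm_scaleR dot_square_norm by (simp add: power2_eq_square)
  then have 1: "\<bar>n \<bullet> N\<bar> = norm n * norm N" using False by simp
  have "\<bar>n \<bullet> N\<bar> * \<bar>n \<bullet> w\<bar> = norm n * norm n * \<bar>N \<bullet> w\<bar>"
    using arg_cong[OF eq, of "\<lambda>v. \<bar>v \<bullet> w\<bar>"] by (simp add: abs_mult dot_square_norm power2_eq_square)
  then have "norm N * \<bar>n \<bullet> w\<bar> = norm n * \<bar>N \<bullet> w\<bar>" unfolding 1 using False by simp
  then show ?thesis by (simp add: N_def inner_commute mult.commute)
qed simp

text \<open>The surface is the set of points of the chart with first coordinate 0, so the inverse chart parametrises it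
  by \<open>u = line_proj\<close>. The area element is determined by two facts: the cross product of the tangent
  vectors is parallel to \<open>G\<close>, and its inner product with \<open>line_field\<close> is 1.\<close>

lemma graph_patch:
  assumes U: "open U" "\<And>p. p \<in> U \<Longrightarrow> GDERIV F p :> G p" "continuous_on U G"
    and M: "M = {p \<in> U. F p = 0}"
    and B: "open B" "B \<subseteq> U" "open (line_chart b c F ` B)"
      "homeomorphism B (line_chart b c F ` B) (line_chart b c F) g"
      "\<And>p. p \<in> B \<Longrightarrow> G p \<bullet> line_field b c p \<noteq> 0"
  obtains D \<phi> \<phi>u \<phi>v where "C1_patch M D \<phi> \<phi>u \<phi>v" "\<phi> ` D = M \<inter> B"
    "\<And>u. u \<in> D \<Longrightarrow> line_proj b c (\<phi> u) = u"
    "\<And>u. u \<in> D \<Longrightarrow> norm (cross3 (\<phi>u u) (\<phi>v u)) = norm (G (\<phi> u)) / \<bar>G (\<phi> u) \<bullet> line_field b c (\<phi> u)\<bar>"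
proof -
  let ?X = "line_chart b c F"
  define j where "j u = (vector [0, u$1, u$2] :: real^3)" for u :: "real^2"
  define D where "D = j -` (?X ` B)"
  define \<phi> where "\<phi> u = g (j u)" for u
  define \<phi>u where "\<phi>u u = line_chart_deriv_inv b c (G (\<phi> u)) (\<phi> u) (vector [0, 1, 0])" for u
  define \<phi>v where "\<phi>v u = line_chart_deriv_inv b c (G (\<phi> u)) (\<phi> u) (vector [0, 0, 1])" for u
  have jcont: "continuous_on A j" for A
    unfolding j_def by (intro continuous_on_vector_3 continuous_intros)
  have j_nth: "j u $ 1 = 0" "j u $ 2 = u$1" "j u $ 3 = u$2" for u by (simp_all add: j_def)
  have D: "open D" unfolding D_def using B(3) jcont[of UNIV] by (rule open_vimage)
  have gX: "g (?X p) = p" if "p \<in> B" for p using B(4) that by (simp add: homeomorphism_def)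
  have Xg: "?X (\<phi> u) = j u" "\<phi> u \<in> B" if "u \<in> D" for u
    using B(4) that by (auto simp: homeomorphism_def \<phi>_def D_def)
  have proj: "line_proj b c (\<phi> u) = u" if "u \<in> D" for u
    using arg_cong[OF Xg(1)[OF that], of "\<lambda>v. v$2"] arg_cong[OF Xg(1)[OF that], of "\<lambda>v. v$3"]
    by (simp add: j_nth vec_eq_iff forall_2 del: line_proj_nth)
  have F0: "F (\<phi> u) = 0" if "u \<in> D" for u
    using arg_cong[OF Xg(1)[OF that], of "\<lambda>v. v$1"] by (simp add: j_nth)
  have img: "\<phi> ` D = M \<inter> B"
  proof
    show "\<phi> ` D \<subseteq> M \<inter> B" using F0 Xg B(2) by (auto simp: M)
    show "M \<inter> B \<subseteq> \<phi> ` D"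
    proof
      fix p assume p: "p \<in> M \<inter> B"
      have "j (line_proj b c p) = ?X p"
        using p by (simp add: vec_eq_iff forall_3 j_nth M)
      then have "\<phi> (line_proj b c p) = p" "line_proj b c p \<in> D"
        using p gX by (auto simp: \<phi>_def D_def)
      then show "p \<in> \<phi> ` D" by force
    qed
  qed
  have der: "(\<phi> has_derivative (\<lambda>h. h$1 *\<^sub>R \<phi>u u + h$2 *\<^sub>R \<phi>v u)) (at u)" if u: "u \<in> D" for u
  proof -
    have nz: "G (\<phi> u) \<bullet> line_field b c (\<phi> u) \<noteq> 0" using B(5) Xg[OF u] by blast
    have "(g has_derivative line_chart_deriv_inv b c (G (\<phi> u)) (\<phi> u)) (at (j u))"
    proof (rule has_derivative_inverse_strong_x[OF B(1), where f = ?X])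
      show "g (j u) \<in> B" using Xg u by (simp add: \<phi>_def)
      show "continuous_on B ?X" using B(4) by (simp add: homeomorphism_def)
      show "g (?X x) = x" if "x \<in> B" for x using gX that .
      show "(?X has_derivative line_chart_deriv b c (G (\<phi> u)) (\<phi> u)) (at (g (j u)))"
        using has_derivative_line_chart[OF U(2)] Xg[OF u] B(2) by (auto simp: \<phi>_def)
      show "line_chart_deriv b c (G (\<phi> u)) (\<phi> u) \<circ> line_chart_deriv_inv b c (G (\<phi> u)) (\<phi> u) = id"
        using line_chart_deriv_inv_right[OF nz] by auto
      show "?X (g (j u)) = j u" using Xg u by (simp add: \<phi>_def)
    qed
    moreover have "linear j" by (rule linearI) (auto simp: vec_eq_iff forall_3 j_nth)
    then have "(j has_derivative j) (at u)"
      by (simp add: linear_conv_bounded_linear bounded_linear_imp_has_derivative)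
    ultimately have "(\<phi> has_derivative (\<lambda>h. line_chart_deriv_inv b c (G (\<phi> u)) (\<phi> u) (j h))) (at u)"
      using diff_chain_at[of j j u g] by (simp add: o_def \<phi>_def[abs_def])
    also have "(\<lambda>h. line_chart_deriv_inv b c (G (\<phi> u)) (\<phi> u) (j h)) = (\<lambda>h. h$1 *\<^sub>R \<phi>u u + h$2 *\<^sub>R \<phi>v u)"
      using nz by (intro ext) (simp add: \<phi>u_def \<phi>v_def line_chart_deriv_inv_def Let_def vec_eq_iff forall_3 j_nth
          inner_vec_def sum_3 divide_simps, simp add: algebra_simps)
    finally show ?thesis .
  qed
  have \<phi>cont: "continuous_on D \<phi>"
    using der by (meson differentiable_imp_continuous_on differentiable_on_def differentiable_def has_derivative_at_withinI)
  have cont_aux: "continuous_on D (\<lambda>u. line_chart_deriv_inv b c (G (\<phi> u)) (\<phi> u) k)" for k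
  proof -
    have "continuous_on B (\<lambda>p. line_chart_deriv_inv b c (G p) p k)"
      unfolding line_chart_deriv_inv_def Let_def
      by (intro continuous_intros continuous_on_vector_3 continuous_on_line_field continuous_on_subset[OF U(3) B(2)])
        (use B(5) in auto)
    then show ?thesis by (rule continuous_on_compose2[OF _ \<phi>cont]) (use Xg in auto)
  qed
  have cross_line: "cross3 (\<phi>u u) (\<phi>v u) \<bullet> line_field b c (\<phi> u) = 1" if "u \<in> D" for u
  proof -
    have "cross3 (vector [0, 1, m] - x *\<^sub>R w) (vector [0, 0, 1] - y *\<^sub>R w) \<bullet> w = 1" if "w$1 = 1"
      for x y m and w :: "real^3"
      using that by (simp add: cross3_def inner_vec_def sum_3 algebra_simps)
    then show ?thesis by (simp add: \<phi>u_def \<phi>v_def line_chart_deriv_inv_def Let_def)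
  qed
  have norm_cross: "norm (cross3 (\<phi>u u) (\<phi>v u)) = norm (G (\<phi> u)) / \<bar>G (\<phi> u) \<bullet> line_field b c (\<phi> u)\<bar>"
    if u: "u \<in> D" for u
  proof -
    have nz: "G (\<phi> u) \<bullet> line_field b c (\<phi> u) \<noteq> 0" using B(5) Xg[OF u] by blast
    have "G (\<phi> u) \<bullet> line_chart_deriv_inv b c (G (\<phi> u)) (\<phi> u) k = k$1" for k
      using arg_cong[OF line_chart_deriv_inv_right[OF nz, of k], of "\<lambda>v. v$1"] by (simp add: inner_commute)
    then have "G (\<phi> u) \<bullet> \<phi>u u = 0" "G (\<phi> u) \<bullet> \<phi>v u = 0" by (simp_all add: \<phi>u_def \<phi>v_def)
    from cross3_norm_eq[OF this, of "line_field b c (\<phi> u)"] show ?thesis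
      using nz cross_line[OF u] by (simp add: field_simps inner_commute)
  qed
  have "inj_on \<phi> D" using proj by (metis inj_on_inverseI)
  moreover have "cross3 (\<phi>u u) (\<phi>v u) \<noteq> 0" if "u \<in> D" for u using cross_line[OF that] by force
  ultimately have "C1_patch M D \<phi> \<phi>u \<phi>v"
    unfolding C1_patch_def using D img der cont_aux by (auto simp: \<phi>u_def[abs_def] \<phi>v_def[abs_def])
  from that[OF this img proj norm_cross] show ?thesis .
qed

text \<open>Moving in the direction of the gradient increases \<open>F\<close>.\<close>

lemma positive_value_near_zero:
  assumes F: "GDERIV F p :> n" and n: "n \<noteq> 0" and p: "F p = 0" "p \<in> A" "open A"
  shows "\<exists>q\<in>A. F q > 0"
proof -
  have "((\<lambda>t. F (p + t *\<^sub>R n)) has_real_derivative n \<bullet> n) (at 0)"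
  proof -
    have "((\<lambda>t. p + t *\<^sub>R n) has_derivative (\<lambda>t. t *\<^sub>R n)) (at 0)"
      by (auto intro!: derivative_eq_intros)
    moreover have "(F has_derivative (\<lambda>h. h \<bullet> n)) (at (p + 0 *\<^sub>R n))" using F by (simp add: gderiv_def)
    ultimately have "(F \<circ> (\<lambda>t. p + t *\<^sub>R n) has_derivative (\<lambda>h. h \<bullet> n) \<circ> (\<lambda>t. t *\<^sub>R n)) (at 0)"
      by (rule diff_chain_at)
    then show ?thesis by (simp add: has_field_derivative_def o_def mult.commute[of _ "n \<bullet> n"])
  qed
  moreover have "0 < n \<bullet> n" using n by simp
  ultimately obtain d where d: "d > 0" "\<And>h. 0 < h \<Longrightarrow> h < d \<Longrightarrow> F (p + 0 *\<^sub>R n) < F (p + (0 + h) *\<^sub>R n)"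
    using DERIV_pos_inc_right by blast
  obtain e where e: "e > 0" "ball p e \<subseteq> A" using p by (meson open_contains_ball)
  define h where "h = min (d / 2) (e / 2 / norm n)"
  have h: "0 < h" "h < d" "h * norm n < e"
  proof -
    have "h * norm n \<le> e / 2 / norm n * norm n" by (intro mult_right_mono) (auto simp: h_def)
    then show "h * norm n < e" using e n by simp
  qed (use d e n in \<open>auto simp: h_def\<close>)
  then have "p + h *\<^sub>R n \<in> A" using e by (auto simp: dist_norm)
  moreover have "F (p + h *\<^sub>R n) > 0" using d(2)[OF h(1,2)] p by simp
  ultimately show ?thesis by blast
qed

subsection \<open>Volume in a chart\<close>

text \<open>The volume of the image is the integral of the Jacobian determinant, which lies between the two bounds.\<close>

lemma measure_image_bounds:
  fixes f :: "real^'n::{finite,wellorder} \<Rightarrow> real^'n::_"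
  assumes A: "A \<in> lmeasurable" "A \<subseteq> B" and B: "open B"
    and der: "\<And>x. x \<in> B \<Longrightarrow> (f has_derivative f' x) (at x)"
    and inj: "inj_on f B"
    and cont: "continuous_on B (\<lambda>x. det (matrix (f' x)))"
    and bnd: "\<And>x. x \<in> B \<Longrightarrow> l \<le> \<bar>det (matrix (f' x))\<bar>" "\<And>x. x \<in> B \<Longrightarrow> \<bar>det (matrix (f' x))\<bar> \<le> u"
  shows "f ` A \<in> lmeasurable"
    and "l * measure lebesgue A \<le> measure lebesgue (f ` A)"
    and "measure lebesgue (f ` A) \<le> u * measure lebesgue A"
proof -
  let ?d = "\<lambda>x. \<bar>det (matrix (f' x))\<bar>"
  have Al: "A \<in> sets lebesgue" using A(1) by blast
  have derA: "(f has_derivative f' x) (at x within A)" if "x \<in> A" for x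
    using der A(2) that by (auto intro: has_derivative_at_withinI)
  have injA: "inj_on f A" using inj A(2) by (rule inj_on_subset)
  have "continuous_on A ?d" using cont A(2) by (intro continuous_intros) (rule continuous_on_subset)
  then have "?d \<in> borel_measurable (lebesgue_on A)"
    using Al by (rule continuous_imp_measurable_on_sets_lebesgue)
  then have int: "?d integrable_on A"
    by (rule measurable_bounded_by_integrable_imp_integrable[OF _ integrable_on_const[OF A(1), of u]])
      (use bnd A(2) Al in auto)
  show "f ` A \<in> lmeasurable"
    using measurable_differentiable_image_eq[OF Al derA injA] int by blast
  have eq: "measure lebesgue (f ` A) = integral A ?d"
    by (rule measure_differentiable_image_eq[OF Al derA injA int])
  have cst: "integral A (\<lambda>x. k) = k * measure lebesgue A" for k :: real
    using integral_mult_right[of A k "\<lambda>x. 1"] lmeasure_integral[OF A(1)] by simp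
  show "l * measure lebesgue A \<le> measure lebesgue (f ` A)"
    unfolding eq cst[symmetric] using A(2) bnd by (intro integral_le integrable_on_const A(1) int) auto
  show "measure lebesgue (f ` A) \<le> u * measure lebesgue A"
    unfolding eq cst[symmetric] using A(2) bnd by (intro integral_le integrable_on_const A(1) int) auto
qed

lemma prod_UNIV_2: "prod f (UNIV :: 2 set) = f 1 * f 2"
  unfolding UNIV_2 by simp

lemma prod_UNIV_3: "prod f (UNIV :: 3 set) = f 1 * f 2 * f 3"
  unfolding UNIV_3 by (simp add: ac_simps)

text \<open>In the chart the first coordinate, the value of \<open>F\<close>, has to be separated from the two coordinates in the
  base; the product measure agrees with Lebesgue measure because it does on boxes.\<close>

lemma lborel_vec3_eq_distr:
  "(lborel :: (real^3) measure) =
     distr (lborel \<Otimes>\<^sub>M lborel) borel (\<lambda>(x, u :: real^2). vector [x, u$1, u$2 :: real])"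
proof (rule lborel_eqI)
  let ?j = "\<lambda>(x, u::real^2). (vector [x, u$1, u$2 :: real] :: real^3)"
  have "continuous_on UNIV ?j"
    unfolding case_prod_beta by (intro continuous_on_vector_3 continuous_intros)
  then have meas: "?j \<in> borel_measurable (lborel \<Otimes>\<^sub>M lborel)"
    unfolding lborel_prod by (simp add: borel_measurable_continuous_onI)
  fix l u :: "real^3" assume lu: "\<And>b. b \<in> Basis \<Longrightarrow> l \<bullet> b \<le> u \<bullet> b"
  have le: "l $ i \<le> u $ i" for i using lu[of "axis i 1"] by (simp add: inner_axis)
  have prod: "(\<Prod>b\<in>Basis. (u - l) \<bullet> b) = (u$1 - l$1) * (u$2 - l$2) * (u$3 - l$3)"
  proof -
    have "l \<in> cbox l u" using le by (simp add: mem_box_cart)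
    then have "cbox l u \<noteq> {}" by blast
    then have "(\<Prod>b\<in>Basis. (u - l) \<bullet> b) = (\<Prod>i\<in>UNIV. u$i - l$i)"
      unfolding inner_diff_left using trans[OF sym[OF content_cbox'] content_cbox_cart] by blast
    then show ?thesis by (simp add: prod_UNIV_3)
  qed
  define l' u' where "l' = (vector [l$2, l$3] :: real^2)" and "u' = (vector [u$2, u$3] :: real^2)"
  have le': "l' $ i \<le> u' $ i" for i
    using exhaust_2[of i] le[of 2] le[of 3] by (auto simp: l'_def u'_def)
  have lu': "l' \<bullet> b \<le> u' \<bullet> b" if "b \<in> Basis" for b
    using that le' by (auto simp: Basis_vec_def inner_axis)
  have prod2: "(\<Prod>b\<in>Basis. (u' - l') \<bullet> b) = (u$2 - l$2) * (u$3 - l$3)"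
  proof -
    have "l' \<in> cbox l' u'" using le' by (simp add: mem_box_cart)
    then have "cbox l' u' \<noteq> {}" by blast
    then have "(\<Prod>b\<in>Basis. (u' - l') \<bullet> b) = (\<Prod>i\<in>UNIV. u'$i - l'$i)"
      unfolding inner_diff_left using trans[OF sym[OF content_cbox'] content_cbox_cart] by blast
    then show ?thesis by (simp add: prod_UNIV_2 l'_def u'_def)
  qed
  have "emeasure (distr (lborel \<Otimes>\<^sub>M lborel) borel ?j) (box l u) =
        emeasure (lborel \<Otimes>\<^sub>M lborel) (?j -` box l u)"
    using meas by (subst emeasure_distr) (auto simp: space_pair_measure)
  also have "?j -` box l u = {l$1<..<u$1} \<times> box l' u'"
    by (auto simp: mem_box_cart forall_3 forall_2 l'_def u'_def)
  also have "emeasure (lborel \<Otimes>\<^sub>M lborel) \<dots> = emeasure lborel {l$1<..<u$1} * emeasure lborel (box l' u')"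
    by (rule lborel.emeasure_pair_measure_Times) auto
  also have "\<dots> = ennreal (u$1 - l$1) * ennreal ((u$2 - l$2) * (u$3 - l$3))"
    using le lu' by (simp add: emeasure_lborel_box prod2)
  also have "\<dots> = ennreal (\<Prod>b\<in>Basis. (u - l) \<bullet> b)"
    using le by (simp add: prod ennreal_mult[symmetric] mult.assoc)
  finally show "emeasure (distr (lborel \<Otimes>\<^sub>M lborel) borel ?j) (box l u) = ennreal (\<Prod>b\<in>Basis. (u - l) \<bullet> b)" .
qed simp

lemma emeasure_slab:
  fixes A :: "real set" and B :: "(real^2) set"
  assumes A: "A \<in> sets borel" and B: "B \<in> sets borel"
  shows "{v :: real^3. v$1 \<in> A \<and> vector [v$2, v$3] \<in> B} \<in> sets borel"
    and "emeasure lborel {v :: real^3. v$1 \<in> A \<and> vector [v$2, v$3] \<in> B} = emeasure lborel A * emeasure lborel B"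
proof -
  let ?S = "{v :: real^3. v$1 \<in> A \<and> vector [v$2, v$3] \<in> B}"
  let ?j = "\<lambda>(x, u::real^2). (vector [x, u$1, u$2 :: real] :: real^3)"
  have m1: "(\<lambda>v :: real^3. v$1) \<in> borel_measurable borel"
    by (intro borel_measurable_continuous_onI continuous_intros)
  have m2: "(\<lambda>v :: real^3. vector [v$2, v$3] :: real^2) \<in> borel_measurable borel"
    by (intro borel_measurable_continuous_onI continuous_on_vector_2 continuous_intros)
  have "(\<lambda>v :: real^3. v$1) -` A \<inter> (\<lambda>v :: real^3. vector [v$2, v$3] :: real^2) -` B \<in> sets borel"
    by (intro sets.Int measurable_sets_borel[OF m1 A] measurable_sets_borel[OF m2 B])
  then show S: "?S \<in> sets borel" by (simp add: vimage_def Int_def)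
  have "continuous_on UNIV ?j"
    unfolding case_prod_beta by (intro continuous_on_vector_3 continuous_intros)
  then have meas: "?j \<in> borel_measurable (lborel \<Otimes>\<^sub>M lborel)"
    unfolding lborel_prod by (simp add: borel_measurable_continuous_onI)
  have "emeasure lborel ?S = emeasure (lborel \<Otimes>\<^sub>M lborel) (?j -` ?S)"
    using meas S by (subst lborel_vec3_eq_distr, subst emeasure_distr) (auto simp: space_pair_measure)
  also have "?j -` ?S = A \<times> B"
  proof -
    have "(vector [u$1, u$2] :: real^2) = u" for u :: "real^2" by (simp add: vec_eq_iff forall_2)
    then show ?thesis by auto
  qed
  also have "emeasure (lborel \<Otimes>\<^sub>M lborel) (A \<times> B) = emeasure lborel A * emeasure lborel B"
    using A B by (intro lborel.emeasure_pair_measure_Times) auto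
  finally show "emeasure lborel ?S = emeasure lborel A * emeasure lborel B" .
qed

section \<open>The surface measure of a level surface\<close>

lemma borel_vimage_continuous_on:
  assumes A: "A \<in> sets borel" and f: "continuous_on A f" and P: "P \<in> sets borel"
  shows "A \<inter> f -` P \<in> sets borel"
proof -
  have "f -` P \<inter> space (restrict_space borel A) \<in> sets (restrict_space borel A)"
    using borel_measurable_continuous_on_restrict[OF f] P by (rule measurable_sets)
  then show ?thesis
    using A by (auto simp: sets_restrict_space_iff space_restrict_space Int_commute)
qed

text \<open>On compact sets an injective continuous map is a homeomorphism, and open sets are countable
  unions of compact ones.\<close>

lemma borel_image_continuous_injective:
  fixes f :: "'a::euclidean_space \<Rightarrow> 'b::euclidean_space"
  assumes V: "open V" and f: "continuous_on V f" "inj_on f V" and B: "B \<in> sets borel" "B \<subseteq> V"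
  shows "f ` B \<in> sets borel"
proof -
  obtain C where C: "\<And>n::nat. compact (C n)" "\<And>n. C n \<subseteq> V" "\<Union>(range C) = V"
    using open_Union_compact_subsets[OF V] by metis
  have "f ` (B \<inter> C n) \<in> sets borel" for n
  proof -
    have inj: "inj_on f (C n)" using f(2) C(2) by (rule inj_on_subset)
    have cont: "continuous_on (C n) f" using f(1) C(2) by (rule continuous_on_subset)
    define g where "g = the_inv_into (C n) f"
    have g: "continuous_on (f ` C n) g"
      unfolding g_def using cont C(1) inj by (rule continuous_on_inv_into)
    have "f ` C n \<inter> g -` B \<in> sets borel"
      by (rule borel_vimage_continuous_on[OF _ g B(1)])
         (intro borel_compact compact_continuous_image cont C)
    also have "f ` C n \<inter> g -` B = f ` (B \<inter> C n)"
      using the_inv_into_f_f[OF inj] by (auto simp: g_def)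
    finally show ?thesis .
  qed
  then have "(\<Union>n. f ` (B \<inter> C n)) \<in> sets borel" by blast
  also have "(\<Union>n. f ` (B \<inter> C n)) = f ` B" using C(3) B(2) by blast
  finally show ?thesis .
qed

lemma absolutely_integrable_iff_nn_integral_finite:
  fixes h :: "'a::euclidean_space \<Rightarrow> real"
  assumes T: "T \<in> sets lebesgue" and h: "h \<in> borel_measurable (lebesgue_on T)"
    and nn: "\<And>x. x \<in> T \<Longrightarrow> 0 \<le> h x"
  shows "h absolutely_integrable_on T \<longleftrightarrow> (\<integral>\<^sup>+x\<in>T. ennreal (h x) \<partial>lebesgue) < \<infinity>"
    and "h absolutely_integrable_on T \<Longrightarrow> (\<integral>\<^sup>+x\<in>T. ennreal (h x) \<partial>lebesgue) = ennreal (integral T h)"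
proof -
  let ?k = "\<lambda>x. indicator T x *\<^sub>R h x"
  have k: "?k \<in> borel_measurable lebesgue"
    using h T by (subst (asm) borel_measurable_restrict_space_iff) auto
  have knn: "0 \<le> ?k x" for x using nn by (auto simp: indicator_def)
  have eq: "(\<integral>\<^sup>+x\<in>T. ennreal (h x) \<partial>lebesgue) = (\<integral>\<^sup>+x. ennreal (?k x) \<partial>lebesgue)"
    by (intro nn_integral_cong) (auto simp: indicator_def)
  show "h absolutely_integrable_on T \<longleftrightarrow> (\<integral>\<^sup>+x\<in>T. ennreal (h x) \<partial>lebesgue) < \<infinity>"
    unfolding set_integrable_def integrable_iff_bounded eq using k knn by (simp add: indicator_def)
  assume a: "h absolutely_integrable_on T"
  then have "integrable lebesgue ?k" by (simp add: set_integrable_def)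
  then have "(\<integral>\<^sup>+x. ennreal (?k x) \<partial>lebesgue) = ennreal (LINT x|lebesgue. ?k x)"
    using knn by (intro nn_integral_eq_integral) auto
  also have "(LINT x|lebesgue. ?k x) = integral T h"
    using set_lebesgue_integral_eq_integral(2)[OF a] by (simp add: set_lebesgue_integral_def)
  finally show "(\<integral>\<^sup>+x\<in>T. ennreal (h x) \<partial>lebesgue) = ennreal (integral T h)" unfolding eq .
qed

text \<open>Integrability is transported in both directions by a change of variables, so for a nonnegative function both
  sides are infinite or both are given by the formula for integrable functions.\<close>

lemma nn_integral_change_of_variables:
  fixes f :: "real^'m::{finite,wellorder} \<Rightarrow> real" and g :: "real^'m::_ \<Rightarrow> real^'m::_"
  assumes S: "S \<in> sets lebesgue" "g ` S \<in> sets lebesgue"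
    and der: "\<And>x. x \<in> S \<Longrightarrow> (g has_derivative g' x) (at x within S)"
    and inj: "inj_on g S"
    and f: "f \<in> borel_measurable (lebesgue_on (g ` S))" "\<And>y. y \<in> g ` S \<Longrightarrow> 0 \<le> f y"
    and meas: "(\<lambda>x. \<bar>det (matrix (g' x))\<bar> * f (g x)) \<in> borel_measurable (lebesgue_on S)"
  shows "(\<integral>\<^sup>+x\<in>S. ennreal (\<bar>det (matrix (g' x))\<bar> * f (g x)) \<partial>lebesgue) = (\<integral>\<^sup>+y\<in>g ` S. ennreal (f y) \<partial>lebesgue)"
proof -
  let ?h = "\<lambda>x. \<bar>det (matrix (g' x))\<bar> * f (g x)"
  have nn: "0 \<le> ?h x" if "x \<in> S" for x using f(2) that by auto
  have iff: "?h absolutely_integrable_on S \<and> integral S ?h = b \<longleftrightarrow>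
        f absolutely_integrable_on (g ` S) \<and> integral (g ` S) f = b" for b
    using has_absolute_integral_change_of_variables[OF S(1) der inj, of "\<lambda>x. vec (f x) :: real^1" "vec b"]
    by (simp add: absolutely_integrable_on_1_iff integral_on_1_eq)
  show ?thesis
  proof (cases "f absolutely_integrable_on (g ` S)")
    case True
    then have "?h absolutely_integrable_on S" "integral S ?h = integral (g ` S) f" using iff by auto
    then show ?thesis
      using True absolutely_integrable_iff_nn_integral_finite(2)[OF S(1) meas nn]
        absolutely_integrable_iff_nn_integral_finite(2)[OF S(2) f] by simp
  next
    case False
    then have "\<not> ?h absolutely_integrable_on S" using iff by auto
    with False have "(\<integral>\<^sup>+x\<in>S. ennreal (?h x) \<partial>lebesgue) = \<infinity>" "(\<integral>\<^sup>+y\<in>g ` S. ennreal (f y) \<partial>lebesgue) = \<infinity>"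
      using absolutely_integrable_iff_nn_integral_finite(1)[OF S(1) meas nn]
        absolutely_integrable_iff_nn_integral_finite(1)[OF S(2) f] by (simp_all add: less_top[symmetric])
    then show ?thesis by simp
  qed
qed

lemma C1_patch_continuous_on:
  assumes "C1_patch M V \<phi> \<phi>u \<phi>v"
  shows "continuous_on V \<phi>" "continuous_on V (\<lambda>w. norm (cross3 (\<phi>u w) (\<phi>v w)))"
proof -
  show "continuous_on V \<phi>"
    using assms unfolding C1_patch_def
    by (meson differentiable_imp_continuous_on differentiable_on_def differentiable_def has_derivative_at_withinI)
  have eq: "cross3 x y = vector [x$2 * y$3 - x$3 * y$2, x$3 * y$1 - x$1 * y$3, x$1 * y$2 - x$2 * y$1]"
    for x y by (simp add: cross3_def)
  show "continuous_on V (\<lambda>w. norm (cross3 (\<phi>u w) (\<phi>v w)))"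
    using assms unfolding C1_patch_def eq by (intro continuous_intros continuous_on_vector_3) auto
qed

text \<open>An open set \<open>B\<close> in which the surface is a graph over the plane of the lines of \<open>line_field b c\<close>. The last
  clause records the area element.\<close>

definition graph_chart ::
    "(real^3 \<Rightarrow> real^3) \<Rightarrow> (real^3) set \<Rightarrow> real \<Rightarrow> real \<Rightarrow> (real^3) set \<Rightarrow> (real^2) set \<Rightarrow>
     (real^2 \<Rightarrow> real^3) \<Rightarrow> (real^2 \<Rightarrow> real^3) \<Rightarrow> (real^2 \<Rightarrow> real^3) \<Rightarrow> bool" where
  "graph_chart G M b c B D \<phi> \<phi>u \<phi>v \<longleftrightarrow>
     open B \<and> C1_patch M D \<phi> \<phi>u \<phi>v \<and> \<phi> ` D = M \<inter> B \<and>
     (\<forall>u\<in>D. line_proj b c (\<phi> u) = u \<and>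
       norm (cross3 (\<phi>u u) (\<phi>v u)) = norm (G (\<phi> u)) / \<bar>G (\<phi> u) \<bullet> line_field b c (\<phi> u)\<bar>)"

lemma ex_graph_chart:
  assumes M: "C1_level_surface U F G M" and s: "s \<in> M"
  obtains b c B D \<phi> \<phi>u \<phi>v where "s \<in> B" "graph_chart G M b c B D \<phi> \<phi>u \<phi>v"
proof -
  have U: "open U" "\<And>p. p \<in> U \<Longrightarrow> GDERIV F p :> G p" "continuous_on U G" "M = {p \<in> U. F p = 0}"
    "\<And>p. p \<in> M \<Longrightarrow> G p \<noteq> 0"
    using M by (auto simp: C1_level_surface_def)
  obtain b c where bc: "G s \<bullet> line_field b c s \<noteq> 0"
    using ex_transversal_line_field[OF U(5)[OF s]] by blast
  have "s \<in> U" using s U(4) by blast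
  from line_chart_local_homeomorphism[OF U(1-3) this bc]
  obtain B g where B: "open B" "s \<in> B" "B \<subseteq> U" "open (line_chart b c F ` B)"
    "homeomorphism B (line_chart b c F ` B) (line_chart b c F) g"
    "\<And>p. p \<in> B \<Longrightarrow> G p \<bullet> line_field b c p \<noteq> 0" by metis
  from graph_patch[OF U(1-4) B(1,3-6)]
  obtain D \<phi> \<phi>u \<phi>v where "C1_patch M D \<phi> \<phi>u \<phi>v" "\<phi> ` D = M \<inter> B"
    "\<And>u. u \<in> D \<Longrightarrow> line_proj b c (\<phi> u) = u"
    "\<And>u. u \<in> D \<Longrightarrow> norm (cross3 (\<phi>u u) (\<phi>v u)) = norm (G (\<phi> u)) / \<bar>G (\<phi> u) \<bullet> line_field b c (\<phi> u)\<bar>"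
    by metis
  with B have "graph_chart G M b c B D \<phi> \<phi>u \<phi>v" by (simp add: graph_chart_def)
  with B(2) show ?thesis by (rule that)
qed

text \<open>The transition map from an arbitrary patch to a graph chart is a restriction of the smooth map
  \<^const>\<open>line_proj\<close>, hence differentiable.\<close>

lemma patch_transition:
  assumes M: "C1_level_surface U F G M"
    and \<psi>: "C1_patch M V \<psi> \<psi>u \<psi>v"
    and \<phi>: "graph_chart G M b c A D \<phi> \<phi>u \<phi>v"
    and B: "B \<in> sets borel" "B \<subseteq> V" "\<psi> ` B \<subseteq> A"
    and C: "C \<in> sets borel" "C \<subseteq> D" "\<phi> ` C = \<psi> ` B"
  shows "(\<integral>\<^sup>+ w\<in>B. ennreal (norm (cross3 (\<psi>u w) (\<psi>v w))) \<partial>lborel) =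
         (\<integral>\<^sup>+ u\<in>C. ennreal (norm (cross3 (\<phi>u u) (\<phi>v u))) \<partial>lborel)"
proof -
  have U: "\<And>p. p \<in> U \<Longrightarrow> GDERIV F p :> G p" "M = {p \<in> U. F p = 0}"
    using M by (auto simp: C1_level_surface_def)
  have V: "open V" "inj_on \<psi> V" "\<psi> ` V \<subseteq> M"
    and der\<psi>: "\<And>w. w \<in> V \<Longrightarrow> (\<psi> has_derivative (\<lambda>h. h$1 *\<^sub>R \<psi>u w + h$2 *\<^sub>R \<psi>v w)) (at w)"
    using \<psi> by (auto simp: C1_patch_def)
  have projD: "\<And>u. u \<in> D \<Longrightarrow> line_proj b c (\<phi> u) = u"
    and normD: "\<And>u. u \<in> D \<Longrightarrow> norm (cross3 (\<phi>u u) (\<phi>v u)) = norm (G (\<phi> u)) / \<bar>G (\<phi> u) \<bullet> line_field b c (\<phi> u)\<bar>"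
    and crossD: "\<And>u. u \<in> D \<Longrightarrow> cross3 (\<phi>u u) (\<phi>v u) \<noteq> 0"
    using \<phi> by (auto simp: graph_chart_def C1_patch_def)
  define \<theta> where "\<theta> w = line_proj b c (\<psi> w)" for w
  have \<phi>\<theta>: "\<phi> (\<theta> w) = \<psi> w" "\<theta> w \<in> C" if "w \<in> B" for w
  proof -
    have "\<psi> w \<in> \<phi> ` C" using C(3) that by blast
    then obtain u where "u \<in> C" "\<psi> w = \<phi> u" by blast
    then show "\<phi> (\<theta> w) = \<psi> w" "\<theta> w \<in> C" using projD[of u] C(2) by (auto simp: \<theta>_def)
  qed
  have img: "\<theta> ` B = C"
  proof
    show "\<theta> ` B \<subseteq> C" using \<phi>\<theta> by blast
    show "C \<subseteq> \<theta> ` B"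
    proof
      fix u assume u: "u \<in> C"
      then obtain w where w: "w \<in> B" "\<phi> u = \<psi> w" using C(3) by blast
      then have "\<theta> w = u" using projD[of u] C(2) u by (auto simp: \<theta>_def)
      then show "u \<in> \<theta> ` B" using w by blast
    qed
  qed
  have inj: "inj_on \<theta> B"
    using V(2) B(2) \<phi>\<theta>(1) by (metis (no_types, lifting) inj_onI inj_on_def subsetD)
  let ?P = "\<lambda>p h :: real^3. (vector [h$2 - b * h$1, h$3 - c * h$1 + (h$1 * (p$2 - b * p$1) + p$1 * (h$2 - b * h$1)) / 2] :: real^2)"
  define \<theta>' where "\<theta>' w = (\<lambda>h :: real^2. ?P (\<psi> w) (h$1 *\<^sub>R \<psi>u w + h$2 *\<^sub>R \<psi>v w))" for w
  have der\<theta>: "(\<theta> has_derivative \<theta>' w) (at w within B)" if "w \<in> B" for w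
  proof -
    have "(\<theta> has_derivative \<theta>' w) (at w)"
      using diff_chain_at[OF der\<psi> has_derivative_line_proj] B(2) that
      unfolding \<theta>_def[abs_def] \<theta>'_def by (auto simp: o_def)
    then show ?thesis by (rule has_derivative_at_withinI)
  qed
  have det: "\<bar>det (matrix (\<theta>' w))\<bar> = \<bar>line_field b c (\<psi> w) \<bullet> cross3 (\<psi>u w) (\<psi>v w)\<bar>" for w
  proof -
    have "det (matrix (\<theta>' w)) = line_field b c (\<psi> w) \<bullet> cross3 (\<psi>u w) (\<psi>v w)"
      by (simp add: det_2 matrix_def axis_def \<theta>'_def inner_vec_def sum_3 cross3_def field_simps)
    then show ?thesis by simp
  qed
  \<comment> \<open>Both cross products are parallel to the gradient at the common image point; the determinant is the
    component of one of them along the line field.\<close>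
  have jac: "\<bar>det (matrix (\<theta>' w))\<bar> * norm (cross3 (\<phi>u (\<theta> w)) (\<phi>v (\<theta> w))) = norm (cross3 (\<psi>u w) (\<psi>v w))"
    if w: "w \<in> B" for w
  proof -
    have wV: "w \<in> V" and \<theta>D: "\<theta> w \<in> D" using w B(2) \<phi>\<theta>(2) C(2) by auto
    have \<psi>U: "\<psi> w \<in> U" using wV V(3) U(2) by blast
    have "((\<lambda>w. F (\<psi> w)) has_derivative (\<lambda>h. (h$1 *\<^sub>R \<psi>u w + h$2 *\<^sub>R \<psi>v w) \<bullet> G (\<psi> w))) (at w)"
      using diff_chain_at[OF der\<psi>[OF wV] U(1)[OF \<psi>U, unfolded gderiv_def]] by (simp add: o_def)
    moreover have "((\<lambda>w. F (\<psi> w)) has_derivative (\<lambda>h. 0)) (at w)"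
      by (rule has_derivative_transform_within_open[OF has_derivative_const[of 0] V(1) wV])
         (use V(3) U(2) in auto)
    ultimately have "(\<lambda>h :: real^2. (h$1 *\<^sub>R \<psi>u w + h$2 *\<^sub>R \<psi>v w) \<bullet> G (\<psi> w)) = (\<lambda>h. 0)"
      by (rule has_derivative_unique)
    from fun_cong[OF this, of "vector [1, 0]"] fun_cong[OF this, of "vector [0, 1]"]
    have "G (\<psi> w) \<bullet> \<psi>u w = 0" "G (\<psi> w) \<bullet> \<psi>v w = 0" by (simp_all add: inner_commute)
    note ce = cross3_norm_eq[OF this, of "line_field b c (\<psi> w)"]
    have "norm (G (\<psi> w)) / \<bar>G (\<psi> w) \<bullet> line_field b c (\<psi> w)\<bar> \<noteq> 0"
      using normD[OF \<theta>D] crossD[OF \<theta>D] \<phi>\<theta>(1)[OF w] by auto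
    then show ?thesis
      using ce unfolding det normD[OF \<theta>D] \<phi>\<theta>(1)[OF w] by (auto simp: field_simps)
  qed
  let ?f = "\<lambda>u. norm (cross3 (\<phi>u u) (\<phi>v u))"
  have contf: "continuous_on C ?f"
    using C1_patch_continuous_on(2)[of M D] \<phi> C(2) unfolding graph_chart_def by (meson continuous_on_subset)
  have contj: "continuous_on B (\<lambda>w. norm (cross3 (\<psi>u w) (\<psi>v w)))"
    using C1_patch_continuous_on(2)[OF \<psi>] B(2) by (rule continuous_on_subset)
  have "(\<integral>\<^sup>+w\<in>B. ennreal (\<bar>det (matrix (\<theta>' w))\<bar> * ?f (\<theta> w)) \<partial>lebesgue) = (\<integral>\<^sup>+u\<in>\<theta> ` B. ennreal (?f u) \<partial>lebesgue)"
  proof (rule nn_integral_change_of_variables[OF _ _ der\<theta> inj])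
    show "B \<in> sets lebesgue" "\<theta> ` B \<in> sets lebesgue" using B(1) C(1) img by auto
    show "?f \<in> borel_measurable (lebesgue_on (\<theta> ` B))"
      unfolding img using C(1) by (intro continuous_imp_measurable_on_sets_lebesgue contf) auto
    have "(\<lambda>w. norm (cross3 (\<psi>u w) (\<psi>v w))) \<in> borel_measurable (lebesgue_on B)"
      using B(1) by (intro continuous_imp_measurable_on_sets_lebesgue contj) auto
    then show "(\<lambda>w. \<bar>det (matrix (\<theta>' w))\<bar> * ?f (\<theta> w)) \<in> borel_measurable (lebesgue_on B)"
      by (rule measurable_cong[THEN iffD1, rotated]) (use jac in auto)
  qed auto
  moreover have "(\<integral>\<^sup>+w\<in>B. ennreal (\<bar>det (matrix (\<theta>' w))\<bar> * ?f (\<theta> w)) \<partial>lebesgue) =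
      (\<integral>\<^sup>+ w\<in>B. ennreal (norm (cross3 (\<psi>u w) (\<psi>v w))) \<partial>lborel)"
    unfolding nn_integral_completion by (intro nn_integral_cong) (auto simp: jac indicator_def)
  ultimately show ?thesis unfolding img nn_integral_completion by simp
qed

lemma ex_countable_graph_charts:
  assumes M: "C1_level_surface U F G M"
  obtains b c A D \<phi> \<phi>u \<phi>v where
    "\<forall>i::nat. graph_chart G M (b i) (c i) (A i) (D i) (\<phi> i) (\<phi>u i) (\<phi>v i)" "M \<subseteq> (\<Union>i. A i)"
proof -
  define \<A> where "\<A> = {B. \<exists>b c D \<phi> \<phi>u \<phi>v. graph_chart G M b c B D \<phi> \<phi>u \<phi>v}"
  have "open B" if "B \<in> \<A>" for B using that by (auto simp: \<A>_def graph_chart_def)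
  then obtain \<B> where \<B>: "\<B> \<subseteq> \<A>" "countable \<B>" "\<Union>\<B> = \<Union>\<A>" using Lindelof by blast
  \<comment> \<open>A countable family can be enumerated only if it is not empty; this matters if \<open>M\<close> is.\<close>
  have "{} \<in> \<A>"
  proof -
    have "graph_chart G M 0 0 {} {} (\<lambda>_. 0) (\<lambda>_. 0) (\<lambda>_. 0)"
      by (simp add: graph_chart_def C1_patch_def)
    then show ?thesis unfolding \<A>_def by blast
  qed
  then have "insert {} \<B> \<subseteq> \<A>" using \<B> by blast
  define A where "A = from_nat_into (insert {} \<B>)"
  have rangeA: "range A = insert {} \<B>"
    unfolding A_def using \<B>(2) by (intro range_from_nat_into) auto
  have "\<exists>z. case z of (b, c, D, \<phi>, \<phi>u, \<phi>v) \<Rightarrow> graph_chart G M b c (A i) D \<phi> \<phi>u \<phi>v" for i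
  proof -
    have "A i \<in> \<A>" using \<open>insert {} \<B> \<subseteq> \<A>\<close> rangeA by blast
    then show ?thesis unfolding \<A>_def by auto
  qed
  then obtain z where z: "case z i of (b, c, D, \<phi>, \<phi>u, \<phi>v) \<Rightarrow> graph_chart G M b c (A i) D \<phi> \<phi>u \<phi>v" for i
    using choice[of "\<lambda>i z. case z of (b, c, D, \<phi>, \<phi>u, \<phi>v) \<Rightarrow> graph_chart G M b c (A i) D \<phi> \<phi>u \<phi>v"] by blast
  have "graph_chart G M (fst (z i)) (fst (snd (z i))) (A i) (fst (snd (snd (z i)))) (fst (snd (snd (snd (z i)))))
      (fst (snd (snd (snd (snd (z i)))))) (snd (snd (snd (snd (snd (z i))))))" for i
    using z[of i] by (cases "z i" rule: prod_cases6) (simp only: prod.case fst_conv snd_conv)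
  then have "\<forall>i. graph_chart G M (fst (z i)) (fst (snd (z i))) (A i) (fst (snd (snd (z i)))) (fst (snd (snd (snd (z i)))))
      (fst (snd (snd (snd (snd (z i)))))) (snd (snd (snd (snd (snd (z i))))))" ..
  moreover have "M \<subseteq> (\<Union>i. A i)"
  proof
    fix s assume "s \<in> M"
    then obtain b c B D \<phi> \<phi>u \<phi>v where sB: "s \<in> B" and chart: "graph_chart G M b c B D \<phi> \<phi>u \<phi>v"
      by (rule ex_graph_chart[OF M])
    have "B \<in> \<A>" unfolding \<A>_def mem_Collect_eq using chart by (intro exI)
    with sB have "s \<in> \<Union>(range A)" using \<B>(3) rangeA by auto
    then show "s \<in> (\<Union>i. A i)" by simp
  qed
  ultimately show ?thesis by (rule that)
qed

lemma borel_C1_level_surface: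
  assumes "C1_level_surface U F G M"
  shows "M \<in> sets borel"
proof -
  have U: "open U" "\<And>p. p \<in> U \<Longrightarrow> GDERIV F p :> G p" "M = {p \<in> U. F p = 0}"
    using assms by (auto simp: C1_level_surface_def)
  have "continuous_on U F"
    using U(2) by (meson continuous_at_imp_continuous_on gderiv_def has_derivative_continuous)
  then have "U \<inter> F -` {0} \<in> sets borel" using U(1) by (intro borel_vimage_continuous_on) auto
  also have "U \<inter> F -` {0} = M" using U(3) by auto
  finally show ?thesis .
qed

lemma is_surface_measure_patch:
  assumes "is_surface_measure M \<sigma>" "C1_patch M V \<phi> \<phi>u \<phi>v" "B \<in> sets borel" "B \<subseteq> V"
  shows "emeasure \<sigma> (\<phi> ` B) = (\<integral>\<^sup>+ w\<in>B. ennreal (norm (cross3 (\<phi>u w) (\<phi>v w))) \<partial>lborel)"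
  using assms unfolding is_surface_measure_def by blast

lemma suminf_ennreal_swap:
  fixes f :: "nat \<Rightarrow> nat \<Rightarrow> ennreal"
  shows "(\<Sum>i. \<Sum>n. f i n) = (\<Sum>n. \<Sum>i. f i n)"
proof -
  have "(\<Sum>i. \<Sum>n. f i n) = (\<integral>\<^sup>+i. (\<Sum>n. f i n) \<partial>count_space UNIV)"
    by (rule nn_integral_count_space_nat[symmetric])
  also have "\<dots> = (\<Sum>n. \<integral>\<^sup>+i. f i n \<partial>count_space UNIV)" by (rule nn_integral_suminf) simp
  also have "\<dots> = (\<Sum>n. \<Sum>i. f i n)" by (simp add: nn_integral_count_space_nat)
  finally show ?thesis .
qed

text \<open>Countably many graph charts cover the surface; cutting them down to disjoint Borel pieces and adding up their
  area elements defines a measure. By \<open>patch_transition\<close> it has the right value on the image of every patch.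
  Any other such measure agrees with it on each piece, hence everywhere.\<close>

lemma is_surface_measure_ex1:
  assumes M: "C1_level_surface U F G M"
  shows "\<exists>!\<sigma>. is_surface_measure M \<sigma>"
proof -
  obtain b c A D \<phi> \<phi>u \<phi>v where
    all_charts: "\<forall>i::nat. graph_chart G M (b i) (c i) (A i) (D i) (\<phi> i) (\<phi>u i) (\<phi>v i)" and cov: "M \<subseteq> (\<Union>i. A i)"
    by (rule ex_countable_graph_charts[OF M])
  note charts = all_charts[rule_format]
  have opA: "open (A i)" and patch: "C1_patch M (D i) (\<phi> i) (\<phi>u i) (\<phi>v i)" and img: "\<phi> i ` D i = M \<inter> A i" for i
    using charts[of i] by (auto simp: graph_chart_def)
  have Mb: "M \<in> sets borel" by (rule borel_C1_level_surface[OF M])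
  have opD: "open (D i)" and cont\<phi>: "continuous_on (D i) (\<phi> i)" for i
    using patch[of i] C1_patch_continuous_on(1)[OF patch[of i]] by (auto simp: C1_patch_def)
  define P where "P i = M \<inter> disjointed A i" for i
  have Pb: "P i \<in> sets borel" for i
  proof -
    have "range (disjointed A) \<subseteq> sets borel" using opA by (intro sets.range_disjointed_sets) auto
    then show ?thesis unfolding P_def using Mb by auto
  qed
  have disjP: "disjoint_family P"
    using disjoint_family_disjointed[of A] unfolding P_def disjoint_family_on_def by blast
  have UnP: "(\<Union>i. P i) = M"
    using cov UN_disjointed_eq[of A] unfolding P_def by auto
  have PA: "P i \<subseteq> M \<inter> A i" for i unfolding P_def using disjointed_subset[of A i] by auto
  define J where "J i u = ennreal (norm (cross3 (\<phi>u i u) (\<phi>v i u)))" for i u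
  \<comment> \<open>The part of \<open>X\<close> in the piece \<open>P i\<close>, seen in the \<open>i\<close>-th parameter domain.\<close>
  define T where "T i X = D i \<inter> \<phi> i -` (X \<inter> P i)" for i X
  have Tb: "T i X \<in> sets borel" if "X \<in> sets borel" for i X
    unfolding T_def using that Pb opD cont\<phi> by (intro borel_vimage_continuous_on) auto
  have TD: "T i X \<subseteq> D i" for i X by (auto simp: T_def)
  have imgT: "\<phi> i ` T i X = X \<inter> P i" for i X
  proof
    show "\<phi> i ` T i X \<subseteq> X \<inter> P i" by (auto simp: T_def)
    show "X \<inter> P i \<subseteq> \<phi> i ` T i X"
    proof
      fix x assume x: "x \<in> X \<inter> P i"
      then have "x \<in> \<phi> i ` D i" using img[of i] PA[of i] by auto
      then obtain u where "u \<in> D i" "x = \<phi> i u" by blast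
      then show "x \<in> \<phi> i ` T i X" using x by (auto simp: T_def)
    qed
  qed
  define N where "N i = density lborel (\<lambda>u. indicator (D i) u * J i u)" for i
  have Jm: "(\<lambda>u. indicator (D i) u * J i u) \<in> borel_measurable borel" for i
  proof -
    have "(\<lambda>u. indicator (D i) u *\<^sub>R norm (cross3 (\<phi>u i u) (\<phi>v i u))) \<in> borel_measurable borel"
      using opD by (intro borel_measurable_continuous_on_indicator C1_patch_continuous_on(2)[OF patch[of i]]) auto
    then have "(\<lambda>u. ennreal (indicator (D i) u *\<^sub>R norm (cross3 (\<phi>u i u) (\<phi>v i u)))) \<in> borel_measurable borel"
      by measurable
    also have "(\<lambda>u. ennreal (indicator (D i) u *\<^sub>R norm (cross3 (\<phi>u i u) (\<phi>v i u)))) = (\<lambda>u. indicator (D i) u * J i u)"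
      by (auto simp: J_def indicator_def)
    finally show ?thesis .
  qed
  have emN: "emeasure (N i) X = (\<integral>\<^sup>+u\<in>X. J i u \<partial>lborel)" if "X \<in> sets borel" "X \<subseteq> D i" for i X
    unfolding N_def using that Jm by (subst emeasure_density) (auto intro!: nn_integral_cong simp: indicator_def)
  have setsN: "sets (N i) = sets borel" for i by (simp add: N_def)
  define \<mu> where "\<mu> X = (\<Sum>i. emeasure (N i) (T i X))" for X
  define \<sigma> where "\<sigma> = measure_of UNIV (sets borel) \<mu>"
  have sets\<sigma>: "sets \<sigma> = sets borel"
    unfolding \<sigma>_def using sets.sigma_sets_eq[of "borel :: (real^3) measure"] by (simp add: sets_measure_of)
  have em\<sigma>: "emeasure \<sigma> X = \<mu> X" if X: "X \<in> sets borel" for X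
  proof -
    have "countably_additive (sets borel) \<mu>"
      unfolding countably_additive_def
    proof (intro allI impI)
      fix X :: "nat \<Rightarrow> (real^3) set" assume X: "range X \<subseteq> sets borel" "disjoint_family X"
      have "(\<Sum>n. emeasure (N i) (T i (X n))) = emeasure (N i) (T i (\<Union>n. X n))" for i
      proof -
        have "(\<Sum>n. emeasure (N i) (T i (X n))) = emeasure (N i) (\<Union>n. T i (X n))"
        proof (rule suminf_emeasure)
          show "range (\<lambda>n. T i (X n)) \<subseteq> sets (N i)" using Tb X by (auto simp: setsN)
          show "disjoint_family (\<lambda>n. T i (X n))"
            using X(2) unfolding disjoint_family_on_def T_def by blast
        qed
        also have "(\<Union>n. T i (X n)) = T i (\<Union>n. X n)" by (auto simp: T_def)
        finally show ?thesis .
      qed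
      then have "\<mu> (\<Union>n. X n) = (\<Sum>i. \<Sum>n. emeasure (N i) (T i (X n)))" by (simp add: \<mu>_def)
      also have "\<dots> = (\<Sum>n. \<Sum>i. emeasure (N i) (T i (X n)))"
        by (rule suminf_ennreal_swap)
      finally show "(\<Sum>n. \<mu> (X n)) = \<mu> (\<Union>n. X n)" by (simp add: \<mu>_def)
    qed
    moreover have "positive (sets borel) \<mu>" by (simp add: positive_def \<mu>_def T_def)
    moreover have "sigma_algebra UNIV (sets (borel :: (real^3) measure))"
      using sets.sigma_algebra_axioms[of "borel :: (real^3) measure"] by simp
    ultimately show ?thesis
      unfolding \<sigma>_def using X by (intro emeasure_measure_of_sigma) 
  qed
  have ex: "is_surface_measure M \<sigma>"
    unfolding is_surface_measure_def
  proof (intro conjI allI impI)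
    show "sets \<sigma> = sets borel" by (rule sets\<sigma>)
    have "T i (- M) = {}" for i using PA[of i] by (auto simp: T_def)
    then show "emeasure \<sigma> (- M) = 0" using em\<sigma>[of "- M"] Mb by (simp add: \<mu>_def)
    fix V \<psi> \<psi>u \<psi>v B
    assume *: "C1_patch M V \<psi> \<psi>u \<psi>v \<and> B \<in> sets borel \<and> B \<subseteq> V"
    then have \<psi>: "C1_patch M V \<psi> \<psi>u \<psi>v" and B: "B \<in> sets borel" "B \<subseteq> V" by auto
    have V: "open V" "inj_on \<psi> V" "\<psi> ` V \<subseteq> M" and cont\<psi>: "continuous_on V \<psi>"
      using \<psi> C1_patch_continuous_on(1)[OF \<psi>] by (auto simp: C1_patch_def)
    have \<psi>B: "\<psi> ` B \<in> sets borel" by (rule borel_image_continuous_injective[OF V(1) cont\<psi> V(2) B])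
    define B' where "B' i = B \<inter> \<psi> -` P i" for i
    have B': "B' i \<in> sets borel" for i
      unfolding B'_def using B Pb continuous_on_subset[OF cont\<psi> B(2)] by (intro borel_vimage_continuous_on) auto
    have UnB': "(\<Union>i. B' i) = B" using UnP V(3) B(2) unfolding B'_def by blast
    have disjB': "disjoint_family B'" using disjP unfolding B'_def disjoint_family_on_def by blast
    let ?K = "\<lambda>w. ennreal (norm (cross3 (\<psi>u w) (\<psi>v w)))"
    have "emeasure \<sigma> (\<psi> ` B) = (\<Sum>i. emeasure (N i) (T i (\<psi> ` B)))" using em\<sigma>[OF \<psi>B] by (simp add: \<mu>_def)
    also have "\<dots> = (\<Sum>i. \<integral>\<^sup>+w\<in>B' i. ?K w \<partial>lborel)"
    proof (rule suminf_cong)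
      fix i
      have "\<psi> ` B' i = \<phi> i ` T i (\<psi> ` B)" unfolding imgT B'_def by blast
      moreover have "\<psi> ` B' i \<subseteq> A i" using PA[of i] unfolding B'_def by blast
      ultimately have "(\<integral>\<^sup>+w\<in>B' i. ?K w \<partial>lborel) = (\<integral>\<^sup>+u\<in>T i (\<psi> ` B). J i u \<partial>lborel)"
        unfolding J_def using B' Tb[OF \<psi>B] TD B(2)
        by (intro patch_transition[OF M \<psi> charts[of i]]) (auto simp: B'_def)
      then show "emeasure (N i) (T i (\<psi> ` B)) = (\<integral>\<^sup>+w\<in>B' i. ?K w \<partial>lborel)"
        using emN[OF Tb[OF \<psi>B] TD] by simp
    qed
    also have "\<dots> = (\<Sum>i. \<integral>\<^sup>+w\<in>B' i. (indicator V w * ?K w) \<partial>lborel)"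
      using B(2) by (intro suminf_cong nn_integral_cong) (auto simp: indicator_def B'_def)
    also have "\<dots> = (\<integral>\<^sup>+w\<in>(\<Union>i. B' i). (indicator V w * ?K w) \<partial>lborel)"
    proof (rule nn_integral_disjoint_family[symmetric])
      have "(\<lambda>w. indicator V w *\<^sub>R norm (cross3 (\<psi>u w) (\<psi>v w))) \<in> borel_measurable borel"
        using V(1) by (intro borel_measurable_continuous_on_indicator C1_patch_continuous_on(2)[OF \<psi>]) auto
      then have "(\<lambda>w. ennreal (indicator V w *\<^sub>R norm (cross3 (\<psi>u w) (\<psi>v w)))) \<in> borel_measurable borel"
        by measurable
      also have "(\<lambda>w. ennreal (indicator V w *\<^sub>R norm (cross3 (\<psi>u w) (\<psi>v w)))) = (\<lambda>w. indicator V w * ?K w)"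
        by (auto simp: indicator_def)
      finally show "(\<lambda>w. indicator V w * ?K w) \<in> borel_measurable lborel" by simp
    qed (use B' disjB' in auto)
    also have "\<dots> = (\<integral>\<^sup>+w\<in>B. ?K w \<partial>lborel)"
      unfolding UnB' using B(2) by (intro nn_integral_cong) (auto simp: indicator_def)
    finally show "emeasure \<sigma> (\<psi> ` B) = (\<integral>\<^sup>+w\<in>B. ?K w \<partial>lborel)" .
  qed
  have unique: "\<sigma>1 = \<sigma>2" if \<sigma>1: "is_surface_measure M \<sigma>1" and \<sigma>2: "is_surface_measure M \<sigma>2" for \<sigma>1 \<sigma>2
  proof (rule measure_eqI)
    show "sets \<sigma>1 = sets \<sigma>2" using \<sigma>1 \<sigma>2 by (simp add: is_surface_measure_def)
    fix X assume "X \<in> sets \<sigma>1"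
    then have X: "X \<in> sets borel" using \<sigma>1 by (simp add: is_surface_measure_def)
    have "emeasure \<rho> X = (\<Sum>i. \<integral>\<^sup>+ u\<in>T i X. J i u \<partial>lborel)" if \<rho>: "is_surface_measure M \<rho>" for \<rho>
    proof -
      have sets\<rho>: "sets \<rho> = sets borel" and null: "emeasure \<rho> (- M) = 0" using \<rho> by (auto simp: is_surface_measure_def)
      have "- M \<in> null_sets \<rho>" using null Mb sets\<rho> by (auto simp: null_sets_def)
      then have "emeasure \<rho> X = emeasure \<rho> (X - - M)"
        using X sets\<rho> by (intro emeasure_Diff_null_set[symmetric]) auto
      also have "X - - M = (\<Union>i. X \<inter> P i)" using UnP by auto
      also have "emeasure \<rho> \<dots> = (\<Sum>i. emeasure \<rho> (X \<inter> P i))"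
        using X Pb disjP sets\<rho> by (intro suminf_emeasure[symmetric]) (auto simp: disjoint_family_on_def)
      also have "\<dots> = (\<Sum>i. \<integral>\<^sup>+ u\<in>T i X. J i u \<partial>lborel)"
        unfolding J_def imgT[symmetric]
        by (intro suminf_cong is_surface_measure_patch[OF \<rho> patch Tb[OF X] TD])
      finally show ?thesis .
    qed
    then show "emeasure \<sigma>1 X = emeasure \<sigma>2 X" using \<sigma>1 \<sigma>2 by simp
  qed
  show ?thesis using ex unique by (intro ex1I[of _ \<sigma>])
qed

lemma is_surface_measure_surface_measure:
  assumes "C1_level_surface U F G M"
  shows "is_surface_measure M (surface_measure M)"
  unfolding surface_measure_def by (rule theI'[OF is_surface_measure_ex1[OF assms]])

section \<open>The content of small pieces\<close>

lemma local_chart: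
  assumes M: "C1_level_surface U F G M" and s: "s \<in> M" "G s \<bullet> line_field b c s \<noteq> 0"
    and N: "open N" "s \<in> N"
  obtains B D \<phi> \<phi>u \<phi>v where "s \<in> B" "B \<subseteq> N" "B \<subseteq> U" "graph_chart G M b c B D \<phi> \<phi>u \<phi>v"
    "inj_on (line_chart b c F) B"
proof -
  have U: "open U" "\<And>p. p \<in> U \<Longrightarrow> GDERIV F p :> G p" "continuous_on U G" "M = {p \<in> U. F p = 0}"
    using M by (auto simp: C1_level_surface_def)
  have UN: "open (U \<inter> N)" "\<And>p. p \<in> U \<inter> N \<Longrightarrow> GDERIV F p :> G p" "continuous_on (U \<inter> N) G" "s \<in> U \<inter> N"
    using U N s(1) by (auto intro: continuous_on_subset)
  from line_chart_local_homeomorphism[OF UN s(2)]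
  obtain B g where B: "open B" "s \<in> B" "B \<subseteq> U \<inter> N" "open (line_chart b c F ` B)"
    "homeomorphism B (line_chart b c F ` B) (line_chart b c F) g"
    and nz: "\<And>p. p \<in> B \<Longrightarrow> G p \<bullet> line_field b c p \<noteq> 0" by blast
  have BU: "B \<subseteq> U" using B(3) by blast
  obtain D \<phi> \<phi>u \<phi>v where *: "C1_patch M D \<phi> \<phi>u \<phi>v" "\<phi> ` D = M \<inter> B"
    "\<forall>u\<in>D. line_proj b c (\<phi> u) = u \<and>
       norm (cross3 (\<phi>u u) (\<phi>v u)) = norm (G (\<phi> u)) / \<bar>G (\<phi> u) \<bullet> line_field b c (\<phi> u)\<bar>"
    by (rule graph_patch[OF U(1-4) B(1) BU B(4,5) nz]) simp_all
  then have chart: "graph_chart G M b c B D \<phi> \<phi>u \<phi>v" using B(1) by (simp add: graph_chart_def)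
  have "inj_on (line_chart b c F) B"
    using B(5) by (metis homeomorphism_def inj_on_inverseI)
  from that[OF B(2) _ BU chart this] B(3) show ?thesis by blast
qed

text \<open>In a graph chart the surface measure has the density \<open>|G| / |G \<bullet> line_field|\<close> with respect to the area
  of the projection.\<close>

lemma surface_measure_projection_bounds:
  assumes \<sigma>: "is_surface_measure M \<sigma>" and chart: "graph_chart G M b c B D \<phi> \<phi>u \<phi>v"
    and A: "A \<in> sets borel" "A \<subseteq> M \<inter> B"
    and l: "0 \<le> l" "\<And>p. p \<in> M \<inter> B \<Longrightarrow> l \<le> norm (G p) / \<bar>G p \<bullet> line_field b c p\<bar>"
    and u: "\<And>p. p \<in> M \<inter> B \<Longrightarrow> norm (G p) / \<bar>G p \<bullet> line_field b c p\<bar> \<le> u"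
  shows "line_proj b c ` A \<in> sets borel"
    and "ennreal l * emeasure lborel (line_proj b c ` A) \<le> emeasure \<sigma> A"
    and "emeasure \<sigma> A \<le> ennreal u * emeasure lborel (line_proj b c ` A)"
proof -
  have patch: "C1_patch M D \<phi> \<phi>u \<phi>v" and img: "\<phi> ` D = M \<inter> B"
    and proj: "\<And>u. u \<in> D \<Longrightarrow> line_proj b c (\<phi> u) = u"
    and nrm: "\<And>u. u \<in> D \<Longrightarrow> norm (cross3 (\<phi>u u) (\<phi>v u)) = norm (G (\<phi> u)) / \<bar>G (\<phi> u) \<bullet> line_field b c (\<phi> u)\<bar>"
    using chart by (auto simp: graph_chart_def)
  have D: "open D" using patch by (simp add: C1_patch_def)
  define C where "C = D \<inter> \<phi> -` A"
  have C: "C \<in> sets borel"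
    unfolding C_def using D A(1) C1_patch_continuous_on(1)[OF patch] by (intro borel_vimage_continuous_on) auto
  have \<phi>C: "\<phi> ` C = A"
  proof
    show "A \<subseteq> \<phi> ` C"
    proof
      fix p assume p: "p \<in> A"
      then have "p \<in> \<phi> ` D" using A(2) img by blast
      with p show "p \<in> \<phi> ` C" by (auto simp: C_def)
    qed
  qed (auto simp: C_def)
  have pC: "line_proj b c ` A = C" unfolding \<phi>C[symmetric] image_image using proj by (force simp: C_def)
  show "line_proj b c ` A \<in> sets borel" unfolding pC by (rule C)
  have em: "emeasure \<sigma> A = (\<integral>\<^sup>+ w\<in>C. ennreal (norm (cross3 (\<phi>u w) (\<phi>v w))) \<partial>lborel)"
    using is_surface_measure_patch[OF \<sigma> patch C] unfolding \<phi>C by (simp add: C_def)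
  have mem: "\<phi> w \<in> M \<inter> B" if "w \<in> C" for w using that A(2) by (auto simp: C_def)
  have cst: "(\<integral>\<^sup>+ w\<in>C. ennreal x \<partial>lborel) = ennreal x * emeasure lborel C" for x
    using C by (subst nn_integral_cmult_indicator) auto
  show "ennreal l * emeasure lborel (line_proj b c ` A) \<le> emeasure \<sigma> A"
    unfolding pC em cst[symmetric] using l(2)[OF mem] nrm
    by (intro nn_integral_mono) (auto simp: indicator_def C_def intro!: ennreal_leI)
  show "emeasure \<sigma> A \<le> ennreal u * emeasure lborel (line_proj b c ` A)"
    unfolding pC em cst[symmetric] using u[OF mem] nrm
    by (intro nn_integral_mono) (auto simp: indicator_def C_def intro!: ennreal_leI)
qed

text \<open>A curve of duration \<open>\<epsilon>\<close> starting on \<open>K\<close> raises \<open>F\<close> by at most \<open>\<epsilon> H\<close> and stays over any given neighbourhood of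
  the projection of \<open>K\<close> if \<open>\<epsilon>\<close> is small. In the chart, the neighbourhood of \<open>K\<close> on the side \<open>F \<ge> 0\<close> is
  therefore contained in a box, and the area of its base exceeds that of the projection by less than \<open>\<eta>'\<close>.\<close>

lemma cc_nbhd_measure_upper:
  assumes Q: "planar_unit_ball Q" and B: "open B" "bounded B"
    and G: "\<And>p. p \<in> B \<Longrightarrow> GDERIV F p :> G p" "continuous_on B G"
    and inj: "inj_on (line_chart b c F) B"
    and L: "L-lipschitz_on B F"
    and H: "0 \<le> H" "\<And>p v. p \<in> B \<Longrightarrow> v \<in> Q \<Longrightarrow> G p \<bullet> horizontal_lift p v \<le> H"
    and m: "0 < m" "\<And>p. p \<in> B \<Longrightarrow> m \<le> \<bar>G p \<bullet> line_field b c p\<bar>"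
      "\<And>p. p \<in> B \<Longrightarrow> \<bar>G p \<bullet> line_field b c p\<bar> \<le> m'"
    and K: "compact K" "K \<subseteq> B" "\<And>p. p \<in> K \<Longrightarrow> F p = 0"
    and W: "W \<in> sets lebesgue" "\<And>p. p \<in> W \<Longrightarrow> p \<in> B \<Longrightarrow> 0 \<le> F p"
    and \<eta>: "\<eta> > 0"
  shows "\<forall>\<^sub>F e in at_right 0. measure lebesgue (cc_nbhd Q e K \<inter> W) \<le>
           e * (H / m * measure lebesgue (line_proj b c ` K) + \<eta>)"
proof -
  let ?X = "line_chart b c F" and ?\<mu> = "measure lebesgue"
  let ?P = "line_proj b c ` K"
  define \<eta>' where "\<eta>' = \<eta> * m / (H + 1)"
  have \<eta>': "\<eta>' > 0" "H / m * \<eta>' \<le> \<eta>"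
    using \<eta> m(1) H(1) by (auto simp: \<eta>'_def field_simps)
  have P: "compact ?P" by (intro compact_continuous_image continuous_on_line_proj K)
  then have Pl: "?P \<in> lmeasurable" by (rule lmeasurable_compact)
  obtain T where T: "open T" "?P \<subseteq> T" "T - ?P \<in> lmeasurable" "emeasure lebesgue (T - ?P) < ennreal \<eta>'"
    using sets_lebesgue_outer_open[of ?P \<eta>'] Pl \<eta>'(1) by blast
  have TP: "T = ?P \<union> (T - ?P)" using T(2) by blast
  have Tl: "T \<in> lmeasurable" using fmeasurable.Un[OF Pl T(3)] TP by simp
  have "?\<mu> T \<le> ?\<mu> ?P + ?\<mu> (T - ?P)"
    using measure_Un_le[of ?P lebesgue "T - ?P"] Pl T(3) TP by auto
  moreover have "?\<mu> (T - ?P) < \<eta>'"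
    using T(3,4) \<eta>'(1) by (simp add: emeasure_eq_measure2 ennreal_less_iff)
  ultimately have mT: "?\<mu> T \<le> ?\<mu> ?P + \<eta>'" by simp
  \<comment> \<open>Staying over \<open>T\<close> is an open condition satisfied on \<open>K\<close>.\<close>
  define BT where "BT = B \<inter> line_proj b c -` T"
  have "open BT" unfolding BT_def
    using B(1) T(1) by (intro continuous_open_preimage continuous_on_line_proj)
  moreover have "K \<subseteq> BT" using K(2) T(2) by (auto simp: BT_def)
  ultimately obtain e0 where e0: "e0 > 0"
    "\<And>\<gamma> T t. admissible_curve Q T \<gamma> \<Longrightarrow> \<gamma> 0 \<in> K \<Longrightarrow> T < e0 \<Longrightarrow> t \<in> {0..T} \<Longrightarrow> \<gamma> t \<in> BT"
    using admissible_curve_stays_in[OF Q K(1)] by blast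
  have "?\<mu> (cc_nbhd Q e K \<inter> W) \<le> e * (H / m * ?\<mu> ?P + \<eta>)" if e: "0 < e" "e < e0" for e
  proof -
    define A where "A = cc_nbhd Q e K \<inter> W"
    have A: "p \<in> BT \<and> F p \<le> e * H" if p: "p \<in> A" for p
    proof -
      obtain \<gamma> T where \<gamma>: "admissible_curve Q T \<gamma>" "\<gamma> 0 \<in> K" "0 \<le> T" "T < e" "\<gamma> T = p"
        using p by (auto simp: A_def cc_nbhd_eq[OF Q] reaches_def)
      have in_BT: "\<gamma> t \<in> BT" if "t \<in> {0..T}" for t using e0(2)[OF \<gamma>(1,2) _ that] \<gamma>(4) e by simp
      have "F (\<gamma> T) - F (\<gamma> 0) \<le> H * T"
        using in_BT by (intro admissible_curve_increment_le[OF Q \<gamma>(1,3) _ G(1) L H]) (auto simp: BT_def)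
      also have "H * T \<le> e * H" using \<gamma>(4) H(1) by (simp add: mult.commute mult_left_mono)
      finally show ?thesis using in_BT[of T] \<gamma> K(3) by simp
    qed
    then have AB: "A \<subseteq> B" by (auto simp: BT_def)
    have Al: "A \<in> lmeasurable"
    proof (rule bounded_set_imp_lmeasurable)
      show "bounded A" using B(2) AB by (rule bounded_subset)
      have "cc_nbhd Q e K \<in> sets lebesgue" using open_cc_nbhd[OF Q, of e K] by auto
      then show "A \<in> sets lebesgue" using W(1) by (auto simp: A_def)
    qed
    have cont: "continuous_on B (\<lambda>p. det (matrix (line_chart_deriv b c (G p) p)))"
      unfolding det_line_chart_deriv by (intro continuous_intros G(2) continuous_on_line_field)
    note bounds = measure_image_bounds[OF Al AB B(1) has_derivative_line_chart[OF G(1)] inj cont,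
        unfolded det_line_chart_deriv, OF _ m(2,3)]
    let ?S = "{v :: real^3. v$1 \<in> {0..e * H} \<and> vector [v$2, v$3] \<in> T}"
    have S: "?S \<in> sets borel" "emeasure lborel ?S = ennreal (e * H * ?\<mu> T)"
    proof -
      show "?S \<in> sets borel" using T(1) by (intro emeasure_slab) auto
      have "emeasure lborel T = ennreal (?\<mu> T)"
        using emeasure_eq_measure2[OF Tl] T(1) by simp
      then show "emeasure lborel ?S = ennreal (e * H * ?\<mu> T)"
        using T(1) e H(1) by (subst emeasure_slab) (auto simp: ennreal_mult)
    qed
    have Sl: "?S \<in> lmeasurable" using S by (auto simp: fmeasurable_def)
    have mS: "?\<mu> ?S = e * H * ?\<mu> T"
      using S e H(1) by (simp add: measure_def)
    have vec2: "vector [line_proj b c p $ 1, line_proj b c p $ 2] = line_proj b c p" for p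
      by (simp add: vec_eq_iff forall_2)
    have "?X ` A \<subseteq> ?S"
      using A W(2) by (auto simp: A_def BT_def vec2 simp del: line_proj_nth)
    have "m * ?\<mu> A \<le> ?\<mu> (?X ` A)" using bounds(2) .
    also have "\<dots> \<le> ?\<mu> ?S" using \<open>?X ` A \<subseteq> ?S\<close> bounds(1) Sl by (intro measure_mono_fmeasurable) auto
    also have "\<dots> = e * H * ?\<mu> T" by (rule mS)
    also have "\<dots> \<le> e * H * (?\<mu> ?P + \<eta>')" using mT e H(1) by (intro mult_left_mono) auto
    finally have "?\<mu> A \<le> e * (H / m * ?\<mu> ?P + H / m * \<eta>')" using m(1) by (simp add: field_simps)
    also have "\<dots> \<le> e * (H / m * ?\<mu> ?P + \<eta>)" using e \<eta>'(2) by (intro mult_left_mono) auto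
    finally show ?thesis by (simp add: A_def)
  qed
  then show ?thesis using e0(1) by (auto simp: eventually_at_right_field)
qed

text \<open>The horizontal segments with direction \<open>v\<close> and duration \<open>\<epsilon>\<close> that start on \<open>K\<close> move in the chart vertically
  and reach at least the height \<open>\<epsilon> \<mu>\<close>, so they sweep out the full box of this height over the projection of
  \<open>K\<close>.\<close>

lemma cc_nbhd_measure_lower:
  assumes Q: "planar_unit_ball Q" and B: "open B" "bounded B"
    and G: "\<And>p. p \<in> B \<Longrightarrow> GDERIV F p :> G p" "continuous_on B G"
    and v: "v \<in> Q" "v$1 \<noteq> 0" "b = v$2 / v$1"
    and inj: "inj_on (line_chart b 0 F) B"
    and \<mu>: "0 < \<mu>" "\<And>p. p \<in> B \<Longrightarrow> \<mu> \<le> G p \<bullet> horizontal_lift p v"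
    and m: "0 < m" "\<And>p. p \<in> B \<Longrightarrow> \<bar>G p \<bullet> line_field b 0 p\<bar> \<le> m"
    and K: "compact K" "K \<subseteq> B" "\<And>p. p \<in> K \<Longrightarrow> F p = 0"
    and W: "W \<in> sets lebesgue" "\<And>p. p \<in> B \<Longrightarrow> 0 < F p \<Longrightarrow> p \<in> W"
  shows "\<forall>\<^sub>F e in at_right 0. e * (\<mu> / m * measure lebesgue (line_proj b 0 ` K)) \<le>
           measure lebesgue (cc_nbhd Q e K \<inter> W)"
proof -
  let ?X = "line_chart b 0 F" and ?\<mu> = "measure lebesgue"
  let ?P = "line_proj b 0 ` K"
  have P: "compact ?P" by (intro compact_continuous_image continuous_on_line_proj K)
  have *: "e * (\<mu> / m * ?\<mu> ?P) \<le> ?\<mu> (cc_nbhd Q e K \<inter> W)" if e: "0 < e" and sub: "cc_nbhd Q e K \<subseteq> B" for e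
  proof -
    have seg: "q + t *\<^sub>R horizontal_lift q v \<in> cc_nbhd Q e K" if "q \<in> K" "0 \<le> t" "t < e" for q t
      using reaches_segment[OF Q reaches_refl[OF Q] v(1) that(2), of q] that
      unfolding cc_nbhd_eq[OF Q] by auto
    have proj_seg: "line_proj b 0 (q + t *\<^sub>R horizontal_lift q v) = line_proj b 0 q" for q t
      using line_proj_along[of b 0 q "t * v$1"] line_field_horizontal[OF v(2), of q] v(3) by simp
    have hit: "\<exists>p\<in>cc_nbhd Q e K. F p = x \<and> line_proj b 0 p = line_proj b 0 q"
      if q: "q \<in> K" and x: "0 < x" "x < e * \<mu>" for q x
    proof -
      define f where "f t = F (q + t *\<^sub>R horizontal_lift q v)" for t
      \<comment> \<open>A time before \<open>e\<close> at which the height \<open>x\<close> has been passed.\<close>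
      define e' where "e' = (x / \<mu> + e) / 2"
      have e': "0 < e'" "e' < e" "x < e' * \<mu>"
        using x \<mu>(1) e by (auto simp: e'_def field_simps)
      have der: "(f has_real_derivative G (q + t *\<^sub>R horizontal_lift q v) \<bullet> horizontal_lift q v) (at t)"
        if "0 \<le> t" "t \<le> e'" for t
      proof -
        have "q + t *\<^sub>R horizontal_lift q v \<in> B" using seg[OF q, of t] that e' sub by auto
        from G(1)[OF this] have "(F has_derivative (\<lambda>h. h \<bullet> G (q + t *\<^sub>R horizontal_lift q v))) (at (q + t *\<^sub>R horizontal_lift q v))"
          by (simp add: gderiv_def)
        moreover have "((\<lambda>t. q + t *\<^sub>R horizontal_lift q v) has_derivative (\<lambda>t. t *\<^sub>R horizontal_lift q v)) (at t)"
          by (auto intro!: derivative_eq_intros)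
        ultimately have "(F \<circ> (\<lambda>t. q + t *\<^sub>R horizontal_lift q v) has_derivative
            (\<lambda>h. h \<bullet> G (q + t *\<^sub>R horizontal_lift q v)) \<circ> (\<lambda>t. t *\<^sub>R horizontal_lift q v)) (at t)"
          by (intro diff_chain_at) auto
        then show ?thesis
          unfolding f_def[abs_def] has_field_derivative_def
          by (simp add: o_def inner_commute mult_commute_abs)
      qed
      have "e' * \<mu> \<le> f e' - f 0"
      proof -
        obtain z where z: "0 < z" "z < e'"
          "f e' - f 0 = (e' - 0) * (G (q + z *\<^sub>R horizontal_lift q v) \<bullet> horizontal_lift q v)"
          using MVT2[OF e'(1) der] by auto
        have "q + z *\<^sub>R horizontal_lift q v \<in> B" using seg[OF q, of z] z e' sub by auto
        from \<mu>(2)[OF this] have "\<mu> \<le> G (q + z *\<^sub>R horizontal_lift q v) \<bullet> horizontal_lift q v"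
          by (simp add: horizontal_lift_along)
        then show ?thesis using z(3) e'(1) by simp
      qed
      moreover have f0: "f 0 = 0" using K(3)[OF q] by (simp add: f_def)
      ultimately have fe: "x \<le> f e'" using e' by simp
      have "\<exists>t. 0 \<le> t \<and> t \<le> e' \<and> f t = x"
        using f0 x e' fe der by (intro IVT) (auto intro: DERIV_isCont)
      then obtain t where t: "0 \<le> t" "t \<le> e'" "f t = x" by blast
      then show ?thesis
        using seg[OF q, of t] proj_seg[of q t] e'(2) by (intro bexI[of _ "q + t *\<^sub>R horizontal_lift q v"]) (auto simp: f_def)
    qed
    define A where "A = {p \<in> B. line_proj b 0 p \<in> ?P \<and> 0 < F p \<and> F p < e * \<mu>}"
    have AB: "A \<subseteq> B" by (auto simp: A_def)
    have sub_A: "A \<subseteq> cc_nbhd Q e K \<inter> W"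
    proof
      fix p assume p: "p \<in> A"
      then obtain q where q: "q \<in> K" "line_proj b 0 p = line_proj b 0 q" by (auto simp: A_def)
      obtain p' where p': "p' \<in> cc_nbhd Q e K" "F p' = F p" "line_proj b 0 p' = line_proj b 0 q"
        using hit[OF q(1), of "F p"] p by (auto simp: A_def)
      then have "?X p' = ?X p" using q(2) by (simp add: line_chart_def)
      then have "p' = p" using inj_onD[OF inj] p' sub p by (auto simp: A_def)
      then show "p \<in> cc_nbhd Q e K \<inter> W" using p' p W(2) by (auto simp: A_def)
    qed
    have contF: "continuous_on B F"
      using G(1) by (meson continuous_at_imp_continuous_on gderiv_def has_derivative_continuous)
    have Ab: "A \<in> sets borel"
    proof -
      have "B \<inter> line_proj b 0 -` ?P \<in> sets borel"
        using B(1) P by (intro borel_vimage_continuous_on continuous_on_line_proj) (auto intro: borel_compact)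
      moreover have "B \<inter> F -` {0<..<e * \<mu>} \<in> sets borel"
        using B(1) by (intro borel_vimage_continuous_on contF) auto
      ultimately have "(B \<inter> line_proj b 0 -` ?P) \<inter> (B \<inter> F -` {0<..<e * \<mu>}) \<in> sets borel" by blast
      also have "(B \<inter> line_proj b 0 -` ?P) \<inter> (B \<inter> F -` {0<..<e * \<mu>}) = A" by (auto simp: A_def)
      finally show ?thesis .
    qed
    have Al: "A \<in> lmeasurable"
      using Ab bounded_subset[OF B(2) AB] by (intro bounded_set_imp_lmeasurable) auto
    have cont: "continuous_on B (\<lambda>p. det (matrix (line_chart_deriv b 0 (G p) p)))"
      unfolding det_line_chart_deriv by (intro continuous_intros G(2) continuous_on_line_field)
    note bounds = measure_image_bounds[OF Al AB B(1) has_derivative_line_chart[OF G(1)] inj cont,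
        unfolded det_line_chart_deriv, OF _ abs_ge_zero m(2)]
    let ?S = "{v :: real^3. v$1 \<in> {0<..<e * \<mu>} \<and> vector [v$2, v$3] \<in> ?P}"
    have vec2: "vector [line_proj b 0 p $ 1, line_proj b 0 p $ 2] = line_proj b 0 p" for p
      by (simp add: vec_eq_iff forall_2)
    have XA: "?X ` A = ?S"
    proof
      show "?X ` A \<subseteq> ?S" by (auto simp: A_def vec2 simp del: line_proj_nth)
      show "?S \<subseteq> ?X ` A"
      proof
        fix y :: "real^3" assume y: "y \<in> ?S"
        then obtain q where q: "q \<in> K" "vector [y$2, y$3] = line_proj b 0 q" by auto
        obtain p where p: "p \<in> cc_nbhd Q e K" "F p = y$1" "line_proj b 0 p = line_proj b 0 q"
          using hit[OF q(1), of "y$1"] y by auto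
        have pv: "line_proj b 0 p = vector [y$2, y$3]" using p(3) q(2) by simp
        have "?X p = y"
          unfolding line_chart_def pv p(2) by (simp add: vec_eq_iff forall_3)
        moreover have "p \<in> A" using p sub q y by (auto simp: A_def)
        ultimately show "y \<in> ?X ` A" by blast
      qed
    qed
    have "emeasure lborel ?P = ennreal (?\<mu> ?P)"
      using emeasure_eq_measure2[OF lmeasurable_compact[OF P]] P by (simp add: borel_compact)
    then have "emeasure lborel ?S = ennreal (e * \<mu> * ?\<mu> ?P)"
      using P e \<mu>(1) by (subst emeasure_slab) (auto simp: ennreal_mult borel_compact)
    moreover have "?S \<in> sets borel" using borel_compact[OF P] by (intro emeasure_slab) auto
    ultimately have "?\<mu> ?S = e * \<mu> * ?\<mu> ?P"
      using e \<mu>(1) by (simp add: measure_def)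
    then have "e * \<mu> * ?\<mu> ?P \<le> m * ?\<mu> A" using bounds(3) XA by simp
    then have "e * (\<mu> / m * ?\<mu> ?P) \<le> ?\<mu> A" using m(1) by (simp add: field_simps)
    also have "\<dots> \<le> ?\<mu> (cc_nbhd Q e K \<inter> W)"
    proof (rule measure_mono_fmeasurable[OF sub_A])
      show "A \<in> sets lebesgue" using Al by blast
      have "cc_nbhd Q e K \<in> sets lebesgue" using open_cc_nbhd[OF Q, of e K] by auto
      then show "cc_nbhd Q e K \<inter> W \<in> lmeasurable"
        using W(1) bounded_subset[OF B(2), of "cc_nbhd Q e K \<inter> W"] sub
        by (intro bounded_set_imp_lmeasurable) auto
    qed
    finally show ?thesis .
  qed
  have "\<forall>\<^sub>F e in at_right 0. (0::real) < e" by (simp add: eventually_at_right_less)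
  with cc_nbhd_subset_open[OF Q K(1) B(1) K(2)] show ?thesis
    by eventually_elim (use * in auto)
qed

lemma surface_measure_compact_bounds:
  assumes \<sigma>: "is_surface_measure M \<sigma>" and chart: "graph_chart G M b c B D \<phi> \<phi>u \<phi>v"
    and K: "compact K" "K \<subseteq> M \<inter> B"
    and l: "0 \<le> l" "\<And>p. p \<in> M \<inter> B \<Longrightarrow> l \<le> norm (G p) / \<bar>G p \<bullet> line_field b c p\<bar>"
    and u: "0 \<le> u" "\<And>p. p \<in> M \<inter> B \<Longrightarrow> norm (G p) / \<bar>G p \<bullet> line_field b c p\<bar> \<le> u"
  shows "emeasure \<sigma> K < \<infinity>"
    and "l * measure lebesgue (line_proj b c ` K) \<le> measure \<sigma> K"
    and "measure \<sigma> K \<le> u * measure lebesgue (line_proj b c ` K)"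
proof -
  let ?P = "line_proj b c ` K"
  have Kb: "K \<in> sets borel" using K(1) by (rule borel_compact)
  note bounds = surface_measure_projection_bounds(2,3)[OF \<sigma> chart Kb K(2) l u(2)]
  have P: "compact ?P" by (intro compact_continuous_image continuous_on_line_proj K)
  have emP: "emeasure lborel ?P = ennreal (measure lebesgue ?P)"
    using emeasure_eq_measure2[OF lmeasurable_compact[OF P]] P by (simp add: borel_compact)
  have ub: "emeasure \<sigma> K \<le> ennreal (u * measure lebesgue ?P)"
    using bounds(2) emP u(1) by (simp add: ennreal_mult)
  also have "\<dots> < \<infinity>" by simp
  finally show fin: "emeasure \<sigma> K < \<infinity>" .
  then have em: "emeasure \<sigma> K = ennreal (measure \<sigma> K)" by (intro emeasure_eq_ennreal_measure) auto
  show "measure \<sigma> K \<le> u * measure lebesgue ?P"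
    using ub u(1) unfolding em by (simp add: ennreal_le_iff)
  have "ennreal (l * measure lebesgue ?P) \<le> ennreal (measure \<sigma> K)"
    using bounds(1) l(1) unfolding em emP by (simp add: ennreal_mult)
  then show "l * measure lebesgue ?P \<le> measure \<sigma> K" by (simp add: ennreal_le_iff)
qed

lemma GDERIV_imp_lipschitz_on:
  assumes B: "convex B" and G: "\<And>p. p \<in> B \<Longrightarrow> GDERIV F p :> G p" and L: "0 \<le> L" "\<And>p. p \<in> B \<Longrightarrow> norm (G p) \<le> L"
  shows "L-lipschitz_on B F"
proof (rule bounded_derivative_imp_lipschitz[OF _ B _ L(1)])
  show "(F has_derivative (\<lambda>h. h \<bullet> G p)) (at p within B)" if "p \<in> B" for p
    using G[OF that] by (auto simp: gderiv_def intro: has_derivative_at_withinI)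
  show "onorm (\<lambda>h. h \<bullet> G p) \<le> L" if p: "p \<in> B" for p
  proof (rule onorm_bound[OF L(1)])
    show "norm (h \<bullet> G p) \<le> L * norm h" for h
      using Cauchy_Schwarz_ineq2[of h "G p"] mult_right_mono[OF L(2)[OF p], of "norm h"] by (simp add: mult.commute)
  qed
qed

lemma level_surface_ball:
  assumes Q: "planar_unit_ball Q" and M: "C1_level_surface U F G M" and s: "s \<in> M"
    and N: "open N" "s \<in> N" and \<tau>: "0 < \<tau>"
  obtains r where "r > 0" "ball s r \<subseteq> U \<inter> N"
    "\<forall>p\<in>ball s r. \<bar>norm (G p) - norm (G s)\<bar> < \<tau>"
    "\<forall>p\<in>ball s r. \<bar>G p \<bullet> line_field b c p - G s \<bullet> line_field b c s\<bar> < \<tau>"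
    "\<forall>p\<in>ball s r. \<bar>norm (G p) * horizontal_density Q G p - norm (G s) * horizontal_density Q G s\<bar> < \<tau>"
    "(norm (G s) + \<tau>)-lipschitz_on (ball s r) F"
proof -
  have U: "open U" "\<And>p. p \<in> U \<Longrightarrow> GDERIV F p :> G p" "continuous_on U G" "M = {p \<in> U. F p = 0}" "G s \<noteq> 0"
    using M s by (auto simp: C1_level_surface_def)
  have sU: "s \<in> U" using s U(4) by blast
  have "open {p \<in> U. G p \<noteq> 0}"
  proof -
    have "open (U \<inter> G -` (- {0}))" by (rule continuous_open_preimage[OF U(3,1)]) auto
    then show ?thesis by (simp add: vimage_def Int_def)
  qed
  moreover have "s \<in> {p \<in> U. G p \<noteq> 0}" using sU U(5) by blast
  moreover have "continuous_on {p \<in> U. G p \<noteq> 0} (\<lambda>p. norm (G p) * horizontal_density Q G p)"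
    by (intro continuous_intros continuous_on_horizontal_density[OF Q] continuous_on_subset[OF U(3)]) auto
  ultimately have c3: "isCont (\<lambda>p. norm (G p) * horizontal_density Q G p) s"
    by (simp add: continuous_on_eq_continuous_at)
  have c1: "isCont (\<lambda>p. norm (G p)) s" and c2: "isCont (\<lambda>p. G p \<bullet> line_field b c p) s"
    using U(1) sU U(3)
    by (auto intro!: continuous_on_interior[of U] continuous_intros continuous_on_line_field simp: interior_open)
  have near: "\<forall>\<^sub>F p in nhds s. \<bar>f p - f s\<bar> < \<tau>" if "isCont f s" for f :: "real^3 \<Rightarrow> real"
    using tendstoD[OF iffD1[OF tendsto_at_iff_tendsto_nhds that[unfolded isCont_def]] \<tau>]
    by (simp add: dist_real_def)
  have inUN: "\<forall>\<^sub>F p in nhds s. p \<in> U \<inter> N"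
    using U(1) N sU by (intro eventually_nhds_in_open) auto
  have "\<forall>\<^sub>F p in nhds s. p \<in> U \<inter> N \<and> \<bar>norm (G p) - norm (G s)\<bar> < \<tau> \<and>
      \<bar>G p \<bullet> line_field b c p - G s \<bullet> line_field b c s\<bar> < \<tau> \<and>
      \<bar>norm (G p) * horizontal_density Q G p - norm (G s) * horizontal_density Q G s\<bar> < \<tau>"
    using near[OF c1] near[OF c2] near[OF c3] inUN
    by (intro eventually_conj)
  then obtain r where r: "r > 0" "\<And>p. dist p s < r \<Longrightarrow> p \<in> U \<inter> N \<and> \<bar>norm (G p) - norm (G s)\<bar> < \<tau> \<and>
      \<bar>G p \<bullet> line_field b c p - G s \<bullet> line_field b c s\<bar> < \<tau> \<and>
      \<bar>norm (G p) * horizontal_density Q G p - norm (G s) * horizontal_density Q G s\<bar> < \<tau>"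
    unfolding eventually_nhds_metric by blast
  show ?thesis
  proof (rule that[OF r(1)])
    show "ball s r \<subseteq> U \<inter> N" using r(2) by (auto simp: dist_commute)
    show "(norm (G s) + \<tau>)-lipschitz_on (ball s r) F"
    proof (rule GDERIV_imp_lipschitz_on[OF convex_ball U(2)])
      show "norm (G p) \<le> norm (G s) + \<tau>" if "p \<in> ball s r" for p
        using r(2)[of p] that by (auto simp: dist_commute)
    qed (use r(2) \<tau> in \<open>auto simp: dist_commute\<close>)
  qed (use r(2) in \<open>auto simp: dist_commute\<close>)
qed

text \<open>Around a point of the surface there is a chart in which all the data are constant up to \<open>\<tau>\<close>; the
  surface measure of a piece is then, up to a factor close to 1, the area of its projection times
  \<open>|G s| / |G s \<bullet> line_field b c s|\<close>.\<close>

lemma level_surface_chart: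
  assumes Q: "planar_unit_ball Q" and M: "C1_level_surface U F G M" and \<sigma>: "is_surface_measure M \<sigma>"
    and s: "s \<in> M" and N: "open N" "s \<in> N"
    and a: "a = \<bar>G s \<bullet> line_field b c s\<bar>" and n: "n = norm (G s)" and \<tau>: "0 < \<tau>" "\<tau> < a" "\<tau> < n"
  obtains B r where "open B" "bounded B" "B \<subseteq> U" "B \<subseteq> N" "r > 0" "ball s r \<subseteq> B"
    "inj_on (line_chart b c F) B" "(n + \<tau>)-lipschitz_on B F"
    "\<forall>p\<in>B. \<bar>G p \<bullet> line_field b c p - G s \<bullet> line_field b c s\<bar> < \<tau>"
    "\<forall>p\<in>B. norm (G p) * horizontal_density Q G p < n * horizontal_density Q G s + \<tau>"
    "\<forall>K. compact K \<longrightarrow> K \<subseteq> M \<inter> B \<longrightarrow> emeasure \<sigma> K < \<infinity> \<and>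
       (n - \<tau>) / (a + \<tau>) * measure lebesgue (line_proj b c ` K) \<le> measure \<sigma> K \<and>
       measure \<sigma> K \<le> (n + \<tau>) / (a - \<tau>) * measure lebesgue (line_proj b c ` K)"
proof -
  obtain r1 where r1: "r1 > 0" "ball s r1 \<subseteq> U \<inter> N"
    "\<forall>p\<in>ball s r1. \<bar>norm (G p) - norm (G s)\<bar> < \<tau>"
    "\<forall>p\<in>ball s r1. \<bar>G p \<bullet> line_field b c p - G s \<bullet> line_field b c s\<bar> < \<tau>"
    "\<forall>p\<in>ball s r1. \<bar>norm (G p) * horizontal_density Q G p - norm (G s) * horizontal_density Q G s\<bar> < \<tau>"
    "(norm (G s) + \<tau>)-lipschitz_on (ball s r1) F"
    by (rule level_surface_ball[OF Q M s N \<tau>(1)])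
  have bc: "G s \<bullet> line_field b c s \<noteq> 0" using a \<tau> by auto
  have "s \<in> ball s r1" using r1(1) by simp
  then obtain B D \<phi> \<phi>u \<phi>v where B: "s \<in> B" "B \<subseteq> ball s r1" "B \<subseteq> U" "graph_chart G M b c B D \<phi> \<phi>u \<phi>v"
    "inj_on (line_chart b c F) B"
    by (rule local_chart[OF M s bc open_ball])
  have opB: "open B" using B(4) by (simp add: graph_chart_def)
  then obtain r where r: "r > 0" "ball s r \<subseteq> B" using B(1) by (meson open_contains_ball)
  have B1: "\<bar>norm (G p) - n\<bar> < \<tau>" "\<bar>G p \<bullet> line_field b c p - G s \<bullet> line_field b c s\<bar> < \<tau>"
    "norm (G p) * horizontal_density Q G p < n * horizontal_density Q G s + \<tau>" if "p \<in> B" for p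
  proof -
    have p: "p \<in> ball s r1" using B(2) that by blast
    show "\<bar>norm (G p) - n\<bar> < \<tau>" "\<bar>G p \<bullet> line_field b c p - G s \<bullet> line_field b c s\<bar> < \<tau>"
      using bspec[OF r1(3) p] bspec[OF r1(4) p] by (auto simp: n)
    show "norm (G p) * horizontal_density Q G p < n * horizontal_density Q G s + \<tau>"
      using bspec[OF r1(5) p] unfolding n by linarith
  qed
  have quot: "(n - \<tau>) / (a + \<tau>) \<le> norm (G p) / \<bar>G p \<bullet> line_field b c p\<bar>"
    "norm (G p) / \<bar>G p \<bullet> line_field b c p\<bar> \<le> (n + \<tau>) / (a - \<tau>)" if p: "p \<in> M \<inter> B" for p
  proof -
    have "n - \<tau> \<le> norm (G p)" "norm (G p) \<le> n + \<tau>"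
      "a - \<tau> \<le> \<bar>G p \<bullet> line_field b c p\<bar>" "\<bar>G p \<bullet> line_field b c p\<bar> \<le> a + \<tau>"
      using B1[of p] p unfolding a by auto
    then show "(n - \<tau>) / (a + \<tau>) \<le> norm (G p) / \<bar>G p \<bullet> line_field b c p\<bar>"
      "norm (G p) / \<bar>G p \<bullet> line_field b c p\<bar> \<le> (n + \<tau>) / (a - \<tau>)"
      using \<tau> by (auto intro!: frac_le)
  qed
  have nn: "0 \<le> (n - \<tau>) / (a + \<tau>)" "0 \<le> (n + \<tau>) / (a - \<tau>)" using \<tau> by auto
  note bounds = surface_measure_compact_bounds[OF \<sigma> B(4) _ _ nn(1) quot(1) nn(2) quot(2)]
  show ?thesis
  proof (rule that[OF opB _ B(3) _ r B(5)])
    show "bounded B" using bounded_ball B(2) by (rule bounded_subset)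
    show "B \<subseteq> N" using B(2) r1(2) by blast
    show "(n + \<tau>)-lipschitz_on B F" unfolding n using r1(6) B(2) by (rule lipschitz_on_subset)
  qed (use B1 bounds in auto)
qed

text \<open>With \<open>\<tau>\<close> as in \<open>level_surface_chart\<close>, the neighbourhood has height \<open>\<epsilon> (n k + \<tau>)\<close>, the Jacobian is at least
  \<open>a - \<tau>\<close> and the area of the projection at most \<open>(a + \<tau>) / (n - \<tau>)\<close> times the surface measure. The product
  tends to \<open>k\<close> for \<open>\<tau> \<rightarrow> 0\<close>, whichever transversal line field is used.\<close>

lemma local_content_upper:
  assumes Q: "planar_unit_ball Q" and M: "C1_level_surface U F G M" and \<sigma>: "is_surface_measure M \<sigma>"
    and s: "s \<in> M" and \<delta>: "\<delta> > 0"
    and N: "open N" "s \<in> N" and W: "W \<in> sets lebesgue" "\<And>p. p \<in> N \<Longrightarrow> p \<in> W \<Longrightarrow> 0 \<le> F p"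
  obtains r where "r > 0"
    "\<And>K \<eta>. compact K \<Longrightarrow> K \<subseteq> M \<inter> ball s r \<Longrightarrow> \<eta> > 0 \<Longrightarrow> \<forall>\<^sub>F e in at_right 0.
       measure lebesgue (cc_nbhd Q e K \<inter> W) \<le> e * ((horizontal_density Q G s + \<delta>) * measure \<sigma> K + \<eta>)"
proof -
  have U: "\<And>p. p \<in> U \<Longrightarrow> GDERIV F p :> G p" "continuous_on U G" "\<And>p. p \<in> M \<Longrightarrow> F p = 0" "G s \<noteq> 0"
    using M s by (auto simp: C1_level_surface_def)
  obtain b c where bc: "G s \<bullet> line_field b c s \<noteq> 0"
    using ex_transversal_line_field[OF U(4)] by blast
  define a where "a = \<bar>G s \<bullet> line_field b c s\<bar>"
  define n where "n = norm (G s)"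
  define k where "k = horizontal_density Q G s"
  have pos: "0 < a" "0 < n" "0 \<le> k"
    using bc U(4) horizontal_density_nonneg[OF Q] by (auto simp: a_def n_def k_def)
  have "((\<lambda>\<tau>. (n * k + \<tau>) / (a - \<tau>) * ((a + \<tau>) / (n - \<tau>))) \<longlongrightarrow> (n * k + 0) / (a - 0) * ((a + 0) / (n - 0))) (at_right 0)"
    using pos by (intro tendsto_intros) auto
  moreover have "(n * k + 0) / (a - 0) * ((a + 0) / (n - 0)) < k + \<delta>" using pos \<delta> by (simp add: field_simps)
  ultimately have "\<forall>\<^sub>F \<tau> in at_right 0. (n * k + \<tau>) / (a - \<tau>) * ((a + \<tau>) / (n - \<tau>)) < k + \<delta>"
    by (rule order_tendstoD)
  moreover have "\<forall>\<^sub>F \<tau> in at_right 0. 0 < \<tau> \<and> \<tau> < min a n"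
    using pos by (auto simp: eventually_at_right_field intro!: exI[of _ "min a n"])
  ultimately have "\<forall>\<^sub>F \<tau> in at_right 0. (n * k + \<tau>) / (a - \<tau>) * ((a + \<tau>) / (n - \<tau>)) < k + \<delta> \<and> 0 < \<tau> \<and> \<tau> < min a n"
    by (rule eventually_conj)
  from eventually_happens'[OF trivial_limit_at_right_real this]
  obtain \<tau> where "(n * k + \<tau>) / (a - \<tau>) * ((a + \<tau>) / (n - \<tau>)) < k + \<delta> \<and> 0 < \<tau> \<and> \<tau> < min a n" ..
  then have \<tau>: "(n * k + \<tau>) / (a - \<tau>) * ((a + \<tau>) / (n - \<tau>)) < k + \<delta>" "0 < \<tau>" "\<tau> < a" "\<tau> < n"
    by simp_all
  obtain B r where B: "open B" "bounded B" "B \<subseteq> U" "B \<subseteq> N" and r: "r > 0" "ball s r \<subseteq> B"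
    and inj: "inj_on (line_chart b c F) B" and lip: "(n + \<tau>)-lipschitz_on B F"
    and line: "\<forall>p\<in>B. \<bar>G p \<bullet> line_field b c p - G s \<bullet> line_field b c s\<bar> < \<tau>"
    and dens: "\<forall>p\<in>B. norm (G p) * horizontal_density Q G p < n * horizontal_density Q G s + \<tau>"
    and area: "\<forall>K. compact K \<longrightarrow> K \<subseteq> M \<inter> B \<longrightarrow> emeasure \<sigma> K < \<infinity> \<and>
       (n - \<tau>) / (a + \<tau>) * measure lebesgue (line_proj b c ` K) \<le> measure \<sigma> K \<and>
       measure \<sigma> K \<le> (n + \<tau>) / (a - \<tau>) * measure lebesgue (line_proj b c ` K)"
    by (rule level_surface_chart[OF Q M \<sigma> s N a_def n_def \<tau>(2-4)])
  have ab: "a - \<tau> \<le> \<bar>G p \<bullet> line_field b c p\<bar>" "\<bar>G p \<bullet> line_field b c p\<bar> \<le> a + \<tau>" if "p \<in> B" for p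
    using bspec[OF line that] unfolding a_def by auto
  show ?thesis
  proof (rule that[OF r(1)])
    fix K and \<eta> :: real assume K: "compact K" "K \<subseteq> M \<inter> ball s r" and \<eta>: "\<eta> > 0"
    have KB: "K \<subseteq> M \<inter> B" using K(2) r(2) by blast
    let ?P = "measure lebesgue (line_proj b c ` K)"
    have ev: "\<forall>\<^sub>F e in at_right 0. measure lebesgue (cc_nbhd Q e K \<inter> W) \<le> e * ((n * k + \<tau>) / (a - \<tau>) * ?P + \<eta>)"
    proof (rule cc_nbhd_measure_upper[OF Q B(1,2) _ _ inj lip _ _ _ _ _ K(1) _ _ W(1) _ \<eta>])
      show "GDERIV F p :> G p" if "p \<in> B" for p using U(1) B(3) that by blast
      show "continuous_on B G" using U(2) B(3) by (rule continuous_on_subset)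
      show "G p \<bullet> horizontal_lift p v \<le> n * k + \<tau>" if "p \<in> B" "v \<in> Q" for p v
        using inner_horizontal_lift_le[OF Q that(2), of G p] bspec[OF dens that(1)] by (simp add: k_def)
      show "F p = 0" if "p \<in> K" for p using K(2) U(3) that by blast
      show "0 \<le> F p" if "p \<in> W" "p \<in> B" for p using W(2) that B(4) by blast
      show "K \<subseteq> B" using KB by blast
    qed (use pos \<tau> ab in auto)
    have le: "(n * k + \<tau>) / (a - \<tau>) * ?P \<le> (k + \<delta>) * measure \<sigma> K"
    proof -
      have "?P \<le> (a + \<tau>) / (n - \<tau>) * measure \<sigma> K"
        using area[rule_format, OF K(1) KB] \<tau> pos by (simp add: field_simps)
      then have "(n * k + \<tau>) / (a - \<tau>) * ?P \<le> (n * k + \<tau>) / (a - \<tau>) * ((a + \<tau>) / (n - \<tau>) * measure \<sigma> K)"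
        using pos \<tau> by (intro mult_left_mono) auto
      also have "\<dots> = ((n * k + \<tau>) / (a - \<tau>) * ((a + \<tau>) / (n - \<tau>))) * measure \<sigma> K" by simp
      also have "\<dots> \<le> (k + \<delta>) * measure \<sigma> K" using \<tau>(1) by (intro mult_right_mono) auto
      finally show ?thesis .
    qed
    have "\<forall>\<^sub>F e in at_right 0. (0::real) < e" by (simp add: eventually_at_right_less)
    with ev show "\<forall>\<^sub>F e in at_right 0. measure lebesgue (cc_nbhd Q e K \<inter> W) \<le>
        e * ((horizontal_density Q G s + \<delta>) * measure \<sigma> K + \<eta>)"
      unfolding k_def[symmetric]
    proof eventually_elim
      case (elim e)
      have "e * ((n * k + \<tau>) / (a - \<tau>) * ?P + \<eta>) \<le> e * ((k + \<delta>) * measure \<sigma> K + \<eta>)"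
        using le elim(2) by (intro mult_left_mono) auto
      with elim(1) show ?case by linarith
    qed
  qed
qed

text \<open>The direction in which the dual norm is attained may have first component 0, whereas a line field has first
  component 1. Moving it by the fraction \<open>t\<close> towards a vector of \<open>Q\<close> on the first axis costs at most the
  fraction \<open>2 t\<close> of the value.\<close>

lemma ex_almost_optimal_direction:
  assumes Q: "planar_unit_ball Q" and \<delta>: "0 < \<delta>" and k: "\<delta> \<le> horizontal_density Q G p" and n: "G p \<noteq> 0"
  obtains v where "v \<in> Q" "v$1 \<noteq> 0"
    "norm (G p) * (horizontal_density Q G p - \<delta> / 2) \<le> G p \<bullet> horizontal_lift p v"
proof -
  define k where "k = horizontal_density Q G p"
  have k_pos: "k > 0" "\<delta> \<le> k" using \<delta> k by (auto simp: k_def)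
  obtain x where x: "x \<in> Q" "x \<bullet> (horizontal_matrix p *v (G p /\<^sub>R norm (G p))) = k"
    using dual_norm_of_attained[OF Q] unfolding k_def horizontal_density_def by metis
  have xk: "G p \<bullet> horizontal_lift p x = norm (G p) * k"
    using x(2) n by (simp add: inner_horizontal_lift[symmetric] field_simps)
  obtain r where r: "r > 0" "cball 0 r \<subseteq> Q" using planar_unit_ball_contains_cball[OF Q] .
  define e where "e = (vector [if x$1 \<ge> 0 then r else - r, 0] :: real^2)"
  have e: "e \<in> Q" "- e \<in> Q"
    using r Q norm_vector_axis(1)[of "if x$1 \<ge> 0 then r else - r"] 
    by (auto simp: e_def planar_unit_ball_def subset_iff)
  define t where "t = \<delta> / (4 * k)"
  have t: "0 < t" "t < 1" "2 * t * k = \<delta> / 2" using \<delta> k_pos by (auto simp: t_def field_simps)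
  define v where "v = (1 - t) *\<^sub>R x + t *\<^sub>R e"
  have "v \<in> Q"
    using Q x(1) e(1) t unfolding v_def planar_unit_ball_def by (intro convexD) auto
  moreover have "v$1 \<noteq> 0"
  proof (cases "x$1 \<ge> 0")
    case True
    then have "0 \<le> (1 - t) * x$1" "0 < t * r" using t r by auto
    then show ?thesis using True by (simp add: v_def e_def)
  next
    case False
    then have "(1 - t) * x$1 < 0" "0 < t * r" using t r by (auto simp: mult_pos_neg)
    then show ?thesis using False by (simp add: v_def e_def)
  qed
  moreover have "norm (G p) * (k - \<delta> / 2) \<le> G p \<bullet> horizontal_lift p v"
  proof -
    have lin: "G p \<bullet> horizontal_lift p v = (1 - t) * (G p \<bullet> horizontal_lift p x) + t * (G p \<bullet> horizontal_lift p e)"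
      by (simp add: v_def inner_horizontal_lift inner_add_left)
    have "- (G p \<bullet> horizontal_lift p e) \<le> norm (G p) * k"
      using inner_horizontal_lift_le[OF Q e(2), of G p] by (simp add: inner_horizontal_lift k_def)
    then have "t * (- (norm (G p) * k)) \<le> t * (G p \<bullet> horizontal_lift p e)" using t by (intro mult_left_mono) auto
    then have "norm (G p) * (k - 2 * t * k) \<le> G p \<bullet> horizontal_lift p v"
      unfolding lin xk by (simp add: algebra_simps)
    then show ?thesis using t by simp
  qed
  ultimately show ?thesis using that unfolding k_def by blast
qed

text \<open>If \<open>k < \<delta>\<close> at \<open>s\<close>, as at the characteristic points, the left-hand side is not positive. Otherwise the line
  field is chosen along an almost optimal direction \<open>v\<close>, for which \<open>G \<bullet> horizontal_lift = v$1 * (G \<bullet> line_field)\<close>.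
  The box then has height \<open>\<epsilon> w (a - \<tau>)\<close> with \<open>w = |v$1|\<close>, and \<open>w a\<close> is at least \<open>n (k - \<delta> / 2)\<close>.\<close>

lemma local_content_lower:
  assumes Q: "planar_unit_ball Q" and M: "C1_level_surface U F G M" and \<sigma>: "is_surface_measure M \<sigma>"
    and s: "s \<in> M" and \<delta>: "\<delta> > 0"
    and N: "open N" "s \<in> N" and W: "W \<in> sets lebesgue" "\<And>p. p \<in> N \<Longrightarrow> 0 < F p \<Longrightarrow> p \<in> W"
  obtains r where "r > 0"
    "\<And>K. compact K \<Longrightarrow> K \<subseteq> M \<inter> ball s r \<Longrightarrow> \<forall>\<^sub>F e in at_right 0.
       e * ((horizontal_density Q G s - \<delta>) * measure \<sigma> K) \<le> measure lebesgue (cc_nbhd Q e K \<inter> W)"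
proof (cases "horizontal_density Q G s < \<delta>")
  case True
  have "\<forall>\<^sub>F e in at_right 0. e * ((horizontal_density Q G s - \<delta>) * measure \<sigma> K) \<le> measure lebesgue (cc_nbhd Q e K \<inter> W)" for K
  proof -
    have "\<forall>\<^sub>F e in at_right 0. (0::real) < e" by (simp add: eventually_at_right_less)
    then show ?thesis
    proof eventually_elim
      case (elim e)
      have "e * ((horizontal_density Q G s - \<delta>) * measure \<sigma> K) \<le> 0"
        using elim True by (intro mult_nonneg_nonpos mult_nonpos_nonneg) auto
      then show ?case using measure_nonneg[of lebesgue "cc_nbhd Q e K \<inter> W"] by linarith
    qed
  qed
  then show ?thesis using that[of 1] by simp
next
  case False
  have U: "\<And>p. p \<in> U \<Longrightarrow> GDERIV F p :> G p" "continuous_on U G" "\<And>p. p \<in> M \<Longrightarrow> F p = 0" "G s \<noteq> 0"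
    using M s by (auto simp: C1_level_surface_def)
  define n where "n = norm (G s)"
  define k where "k = horizontal_density Q G s"
  obtain v where v: "v \<in> Q" "v$1 \<noteq> 0" "n * (k - \<delta> / 2) \<le> G s \<bullet> horizontal_lift s v"
    using ex_almost_optimal_direction[where Q = Q and G = G and p = s and \<delta> = \<delta>] Q \<delta> U(4) False
    unfolding n_def k_def by (metis not_less)
  define b where "b = v$2 / v$1"
  define x where "x = G s \<bullet> horizontal_lift s v"
  define a where "a = \<bar>G s \<bullet> line_field b 0 s\<bar>"
  have n: "n > 0" using U(4) by (simp add: n_def)
  have "k - \<delta> / 2 > 0" using False \<delta> by (simp add: k_def)
  then have "n * (k - \<delta> / 2) > 0" using n by (intro mult_pos_pos)
  then have x: "x > 0" using v(3) unfolding x_def by linarith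
  have xa: "x = v$1 * (G s \<bullet> line_field b 0 s)"
    unfolding x_def line_field_horizontal[OF v(2)] b_def by simp
  then have bc: "G s \<bullet> line_field b 0 s \<noteq> 0" and a: "a > 0" using x by (auto simp: a_def)
  define w where "w = \<bar>v$1\<bar>"
  have "x = \<bar>v$1 * (G s \<bullet> line_field b 0 s)\<bar>" using x xa by simp
  then have w: "w > 0" "x = w * a" using v(2) by (simp_all add: w_def a_def abs_mult)
  have "((\<lambda>\<tau>. w * (a - \<tau>) / (a + \<tau>) * ((a - \<tau>) / (n + \<tau>))) \<longlongrightarrow> w * (a - 0) / (a + 0) * ((a - 0) / (n + 0))) (at_right 0)"
    using a n by (intro tendsto_intros) auto
  moreover have "k - \<delta> < w * (a - 0) / (a + 0) * ((a - 0) / (n + 0))"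
  proof -
    have "n * (k - \<delta>) < n * (k - \<delta> / 2)" using n \<delta> by simp
    also have "\<dots> \<le> w * a" using v(3) w(2) by (simp add: x_def)
    finally show ?thesis using n a by (simp add: field_simps)
  qed
  ultimately have "\<forall>\<^sub>F \<tau> in at_right 0. k - \<delta> < w * (a - \<tau>) / (a + \<tau>) * ((a - \<tau>) / (n + \<tau>))"
    by (rule order_tendstoD)
  moreover have "\<forall>\<^sub>F \<tau> in at_right 0. 0 < \<tau> \<and> \<tau> < min a n"
    using a n by (auto simp: eventually_at_right_field intro!: exI[of _ "min a n"])
  ultimately have "\<forall>\<^sub>F \<tau> in at_right 0. k - \<delta> < w * (a - \<tau>) / (a + \<tau>) * ((a - \<tau>) / (n + \<tau>)) \<and> 0 < \<tau> \<and> \<tau> < min a n"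
    by (rule eventually_conj)
  from eventually_happens'[OF trivial_limit_at_right_real this]
  obtain \<tau> where "k - \<delta> < w * (a - \<tau>) / (a + \<tau>) * ((a - \<tau>) / (n + \<tau>)) \<and> 0 < \<tau> \<and> \<tau> < min a n" ..
  then have \<tau>: "k - \<delta> < w * (a - \<tau>) / (a + \<tau>) * ((a - \<tau>) / (n + \<tau>))" "0 < \<tau>" "\<tau> < a" "\<tau> < n"
    by simp_all
  obtain B r where B: "open B" "bounded B" "B \<subseteq> U" "B \<subseteq> N" and r: "r > 0" "ball s r \<subseteq> B"
    and inj: "inj_on (line_chart b 0 F) B" and lip: "(n + \<tau>)-lipschitz_on B F"
    and line: "\<forall>p\<in>B. \<bar>G p \<bullet> line_field b 0 p - G s \<bullet> line_field b 0 s\<bar> < \<tau>"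
    and dens: "\<forall>p\<in>B. norm (G p) * horizontal_density Q G p < n * horizontal_density Q G s + \<tau>"
    and area: "\<forall>K. compact K \<longrightarrow> K \<subseteq> M \<inter> B \<longrightarrow> emeasure \<sigma> K < \<infinity> \<and>
       (n - \<tau>) / (a + \<tau>) * measure lebesgue (line_proj b 0 ` K) \<le> measure \<sigma> K \<and>
       measure \<sigma> K \<le> (n + \<tau>) / (a - \<tau>) * measure lebesgue (line_proj b 0 ` K)"
    by (rule level_surface_chart[OF Q M \<sigma> s N a_def n_def \<tau>(2-4)])
  show ?thesis
  proof (rule that[OF r(1)])
    fix K assume K: "compact K" "K \<subseteq> M \<inter> ball s r"
    let ?P = "measure lebesgue (line_proj b 0 ` K)"
    have KB: "K \<subseteq> M \<inter> B" using K(2) r(2) by blast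
    have sb: "measure \<sigma> K \<le> (n + \<tau>) / (a - \<tau>) * ?P" using area K(1) KB by blast
    have ev: "\<forall>\<^sub>F e in at_right 0. e * (w * (a - \<tau>) / (a + \<tau>) * ?P) \<le> measure lebesgue (cc_nbhd Q e K \<inter> W)"
    proof (rule cc_nbhd_measure_lower[OF Q B(1,2) _ _ v(1,2) b_def inj _ _ _ _ K(1) _ _ W(1)])
      show "GDERIV F p :> G p" if "p \<in> B" for p using U(1) B(3) that by blast
      show "continuous_on B G" using U(2) B(3) by (rule continuous_on_subset)
      show "w * (a - \<tau>) \<le> G p \<bullet> horizontal_lift p v" if "p \<in> B" for p
      proof -
        have "\<bar>v$1 * (G p \<bullet> line_field b 0 p) - x\<bar> \<le> w * \<tau>"
          using bspec[OF line that] w(1) unfolding xa right_diff_distrib[symmetric] abs_mult w_def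
          by (intro mult_left_mono) auto
        then show ?thesis
          unfolding line_field_horizontal[OF v(2)] b_def[symmetric] using w(2) by (simp add: algebra_simps abs_le_iff)
      qed
      show "\<bar>G p \<bullet> line_field b 0 p\<bar> \<le> a + \<tau>" if "p \<in> B" for p
        using bspec[OF line that] unfolding a_def by auto
      show "F p = 0" if "p \<in> K" for p using K(2) U(3) that by blast
      show "p \<in> W" if "p \<in> B" "0 < F p" for p using W(2) that B(4) by blast
      show "K \<subseteq> B" using KB by blast
    qed (use \<tau> a w in auto)
    have le: "(k - \<delta>) * measure \<sigma> K \<le> w * (a - \<tau>) / (a + \<tau>) * ?P"
    proof -
      have "(k - \<delta>) * measure \<sigma> K \<le> (w * (a - \<tau>) / (a + \<tau>) * ((a - \<tau>) / (n + \<tau>))) * measure \<sigma> K"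
        using \<tau>(1) by (intro mult_right_mono) auto
      also have "\<dots> = w * (a - \<tau>) / (a + \<tau>) * ((a - \<tau>) / (n + \<tau>) * measure \<sigma> K)" by simp
      also have "\<dots> \<le> w * (a - \<tau>) / (a + \<tau>) * ?P"
        using sb \<tau> n a w by (intro mult_left_mono) (auto simp: field_simps)
      finally show ?thesis .
    qed
    have "\<forall>\<^sub>F e in at_right 0. (0::real) < e" by (simp add: eventually_at_right_less)
    with ev show "\<forall>\<^sub>F e in at_right 0. e * ((horizontal_density Q G s - \<delta>) * measure \<sigma> K) \<le>
        measure lebesgue (cc_nbhd Q e K \<inter> W)"
      unfolding k_def[symmetric]
    proof eventually_elim
      case (elim e)
      have "e * ((k - \<delta>) * measure \<sigma> K) \<le> e * (w * (a - \<tau>) / (a + \<tau>) * ?P)"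
        using le elim(2) by (intro mult_left_mono) auto
      with elim(1) show ?case by linarith
    qed
  qed
qed

section \<open>From small pieces to compact surfaces\<close>

text \<open>A finite measure charges only countably many of the disjoint spheres around \<open>s\<close>.\<close>

lemma ex_null_sphere:
  fixes \<rho> \<iota> :: "'a::euclidean_space measure"
  assumes \<rho>: "finite_measure \<rho>" "sets \<rho> = sets borel" and \<iota>: "finite_measure \<iota>" "sets \<iota> = sets borel"
    and r: "0 < (r :: real)"
  obtains t where "0 < t" "t < r" "measure \<rho> (sphere s t) = 0" "measure \<iota> (sphere s t) = 0"
proof -
  have bad: "countable {t. measure \<mu> (sphere s t) \<noteq> 0}"
    if \<mu>: "finite_measure \<mu>" "sets \<mu> = sets borel" for \<mu> :: "'a measure"
  proof -
    have d: "dist s \<in> borel_measurable \<mu>"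
      unfolding measurable_cong_sets[OF \<mu>(2) refl] by (intro borel_measurable_continuous_onI continuous_intros)
    interpret D: finite_measure "distr \<mu> borel (dist s)"
      by (rule finite_measure.finite_measure_distr[OF \<mu>(1) d])
    have "measure (distr \<mu> borel (dist s)) {t} = measure \<mu> (sphere s t)" for t
    proof -
      have "dist s -` {t} \<inter> space \<mu> = sphere s t"
        using sets_eq_imp_space_eq[OF \<mu>(2)] by auto
      then show ?thesis using d by (simp add: measure_distr)
    qed
    then show ?thesis using D.countable_support by simp
  qed
  have "uncountable {0<..<r}" using r by (simp add: uncountable_open_interval)
  then have "\<not> {0<..<r} \<subseteq> {t. measure \<rho> (sphere s t) \<noteq> 0} \<union> {t. measure \<iota> (sphere s t) \<noteq> 0}"
    using bad[OF \<rho>] bad[OF \<iota>] by (metis countable_Un countable_subset)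
  then show ?thesis using that by auto
qed

text \<open>Both halves of the estimate are localised by cutting along spheres of measure 0. For the lower half the
  two parts have to be separated, at the cost of a thin shell inside the sphere.\<close>

lemma content_estimate_globalise:
  fixes \<rho> \<iota> :: "'a::euclidean_space measure" and m :: "real \<Rightarrow> 'a set \<Rightarrow> real" and S :: "'a set" and \<delta> :: real
  defines "good \<equiv> \<lambda>K. \<forall>\<eta>>0. \<forall>\<^sub>F e in at_right 0.
      e * (measure \<iota> K - \<delta> * measure \<rho> K - \<eta>) \<le> m e K \<and> m e K \<le> e * (measure \<iota> K + \<delta> * measure \<rho> K + \<eta>)"
  assumes \<rho>: "finite_measure \<rho>" "sets \<rho> = sets borel" and \<iota>: "finite_measure \<iota>" "sets \<iota> = sets borel"
    and \<delta>: "0 \<le> \<delta>" and S: "compact S"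
    and empty: "good {}"
    and sub: "\<And>K1 K2. compact K1 \<Longrightarrow> compact K2 \<Longrightarrow> K1 \<union> K2 \<subseteq> S \<Longrightarrow>
        \<forall>\<^sub>F e in at_right 0. m e (K1 \<union> K2) \<le> m e K1 + m e K2"
    and sup: "\<And>K1 K2 K. compact K1 \<Longrightarrow> compact K2 \<Longrightarrow> compact K \<Longrightarrow> K \<subseteq> S \<Longrightarrow> K1 \<union> K2 \<subseteq> K \<Longrightarrow> K1 \<inter> K2 = {} \<Longrightarrow>
        \<forall>\<^sub>F e in at_right 0. m e K1 + m e K2 \<le> m e K"
    and near: "\<And>s. s \<in> S \<Longrightarrow> \<exists>r>0. \<forall>K. compact K \<longrightarrow> K \<subseteq> S \<inter> ball s r \<longrightarrow> good K"
  shows "good S"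
proof -
  interpret \<rho>: finite_measure \<rho> by fact
  interpret \<iota>: finite_measure \<iota> by fact
  have ev_pos: "\<forall>\<^sub>F e in at_right 0. (0::real) < e" by (simp add: eventually_at_right_less)
  have "\<exists>t>0. (\<forall>K. compact K \<longrightarrow> K \<subseteq> S \<inter> cball s t \<longrightarrow> good K) \<and>
      measure \<rho> (sphere s t) = 0 \<and> measure \<iota> (sphere s t) = 0" if s: "s \<in> S" for s
  proof -
    obtain r where r: "r > 0" "\<forall>K. compact K \<longrightarrow> K \<subseteq> S \<inter> ball s r \<longrightarrow> good K" using near[OF s] by blast
    obtain t where t: "0 < t" "t < r" "measure \<rho> (sphere s t) = 0" "measure \<iota> (sphere s t) = 0"
      by (rule ex_null_sphere[OF \<rho> \<iota> r(1)])
    have "cball s t \<subseteq> ball s r" using t(2) by auto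
    then show ?thesis using r(2) t by blast
  qed
  then obtain t where t: "\<And>s. s \<in> S \<Longrightarrow> t s > 0"
    "\<And>s K. s \<in> S \<Longrightarrow> compact K \<Longrightarrow> K \<subseteq> S \<inter> cball s (t s) \<Longrightarrow> good K"
    "\<And>s. s \<in> S \<Longrightarrow> measure \<rho> (sphere s (t s)) = 0" "\<And>s. s \<in> S \<Longrightarrow> measure \<iota> (sphere s (t s)) = 0"
    by metis
  have step: "good K" if "finite J" "J \<subseteq> S" "compact K" "K \<subseteq> S" "K \<subseteq> (\<Union>s\<in>J. ball s (t s))" for J K
    using that
  proof (induction J arbitrary: K rule: finite_induct)
    case empty
    then show ?case using \<open>good {}\<close> by simp
  next
    case (insert s J)
    then have s: "s \<in> S" by simp
    define K1 where "K1 = K \<inter> cball s (t s)"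
    define K2 where "K2 = K - ball s (t s)"
    have cK1: "compact K1" unfolding K1_def using insert.prems(2) by (simp add: compact_Int_closed)
    have cK2: "compact K2" unfolding K2_def using insert.prems(2) by (simp add: compact_diff)
    have K: "K = K1 \<union> K2" unfolding K1_def K2_def by auto
    have good1: "good K1" using t(2)[OF s cK1] insert.prems(3) by (auto simp: K1_def)
    have good2: "good K2" using insert.prems by (intro insert.IH cK2) (auto simp: K2_def)
    have borel: "K1 \<in> sets borel" "K2 \<in> sets borel" "K \<in> sets borel"
      using cK1 cK2 insert.prems(2) by (auto intro: borel_compact)
    have sphere: "K1 \<inter> K2 \<subseteq> sphere s (t s)" by (auto simp: K1_def K2_def)
    have add: "measure \<mu> K = measure \<mu> K1 + measure \<mu> K2"
      if \<mu>: "finite_measure \<mu>" "sets \<mu> = sets borel" "measure \<mu> (sphere s (t s)) = 0" for \<mu> :: "'a measure"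
    proof -
      interpret \<mu>: finite_measure \<mu> by fact
      have "measure \<mu> (K1 \<inter> K2) \<le> measure \<mu> (sphere s (t s))"
        using sphere \<mu>(2) by (intro \<mu>.finite_measure_mono) auto
      then have "measure \<mu> (K1 \<inter> K2) = 0" using \<mu>(3) measure_nonneg[of \<mu> "K1 \<inter> K2"] by linarith
      then show ?thesis
        using \<mu>.finite_measure_Union'[of K1 K2] \<mu>.finite_measure_Diff'[of K2 K1] borel \<mu>(2)
        by (simp add: K Int_commute)
    qed
    have add\<rho>: "measure \<rho> K = measure \<rho> K1 + measure \<rho> K2" by (rule add[OF \<rho> t(3)[OF s]])
    have add\<iota>: "measure \<iota> K = measure \<iota> K1 + measure \<iota> K2" by (rule add[OF \<iota> t(4)[OF s]])
    show ?case
      unfolding good_def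
    proof (intro allI impI)
      fix \<eta> :: real assume "\<eta> > 0"
      then have \<eta>: "\<eta> / 3 > 0" by simp
      \<comment> \<open>\<open>B n\<close> omits a shell of width \<open>d n\<close> from \<open>K1\<close>, which separates it from \<open>K2\<close>.\<close>
      define d where "d n = inverse (real (Suc n))" for n
      have d_pos: "d n > 0" for n by (simp add: d_def)
      define B where "B n = K \<inter> cball s (t s - d n)" for n
      have "\<exists>n. measure \<iota> K1 - \<eta> / 3 < measure \<iota> (B n)"
      proof -
        have "(\<lambda>n. measure \<iota> (B n)) \<longlonglongrightarrow> measure \<iota> (\<Union>n. B n)"
        proof (rule \<iota>.finite_Lim_measure_incseq)
          have "B n \<in> sets \<iota>" for n unfolding B_def \<iota>(2) using borel(3) by (intro sets.Int) auto
          then show "range B \<subseteq> sets \<iota>" by blast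
          have "d n \<le> d m" if "m \<le> n" for m n
            unfolding d_def using that by (intro le_imp_inverse_le) auto
          then have "B m \<subseteq> B n" if "m \<le> n" for m n
            using cball_subset_cball_iff that unfolding B_def by (intro Int_mono order_refl subset_cball) force
          then show "incseq B" unfolding incseq_def by blast
        qed
        moreover have "measure \<iota> (\<Union>n. B n) = measure \<iota> K1"
        proof -
          have "(\<Union>n. B n) = K \<inter> ball s (t s)"
          proof
            show "(\<Union>n. B n) \<subseteq> K \<inter> ball s (t s)"
            proof
              fix x assume "x \<in> (\<Union>n. B n)"
              then obtain n where "x \<in> K" "dist s x \<le> t s - d n" by (auto simp: B_def)
              then show "x \<in> K \<inter> ball s (t s)" using d_pos[of n] by auto
            qed
            show "K \<inter> ball s (t s) \<subseteq> (\<Union>n. B n)"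
            proof
              fix x assume x: "x \<in> K \<inter> ball s (t s)"
              then obtain n where "d n < t s - dist s x"
                using reals_Archimedean[of "t s - dist s x"] by (auto simp: d_def)
              then show "x \<in> (\<Union>n. B n)" using x by (auto simp: B_def intro!: exI[of _ n])
            qed
          qed
          also have "\<dots> = K1 - (K1 \<inter> sphere s (t s))" by (auto simp: K1_def)
          also have "measure \<iota> \<dots> = measure \<iota> K1 - measure \<iota> (K1 \<inter> sphere s (t s))"
            using borel \<iota>(2) by (intro \<iota>.finite_measure_Diff) auto
          also have "measure \<iota> (K1 \<inter> sphere s (t s)) = 0"
          proof -
            have "measure \<iota> (K1 \<inter> sphere s (t s)) \<le> measure \<iota> (sphere s (t s))"
              using \<iota>(2) by (intro \<iota>.finite_measure_mono) auto
            then show ?thesis using t(4)[OF s] measure_nonneg[of \<iota> "K1 \<inter> sphere s (t s)"] by linarith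
          qed
          finally show ?thesis by simp
        qed
        ultimately have "\<forall>\<^sub>F n in sequentially. measure \<iota> K1 - \<eta> / 3 < measure \<iota> (B n)"
          using \<eta> by (intro order_tendstoD) auto
        then show ?thesis by (auto simp: eventually_sequentially)
      qed
      then obtain n where n: "measure \<iota> K1 - \<eta> / 3 < measure \<iota> (B n)" ..
      have cB: "compact (B n)" unfolding B_def using insert.prems(2) by (simp add: compact_Int_closed)
      have BK1: "B n \<subseteq> K1"
        using d_pos[of n] by (auto simp: B_def K1_def)
      have disj: "B n \<inter> K2 = {}"
        using d_pos[of n] by (auto simp: B_def K2_def)
      have goodB: "good (B n)" using t(2)[OF s cB] BK1 insert.prems(3) by (auto simp: K1_def)
      have \<rho>B: "measure \<rho> (B n) \<le> measure \<rho> K1" using BK1 borel \<rho>(2) by (intro \<rho>.finite_measure_mono) auto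
      have ev1: "\<forall>\<^sub>F e in at_right 0. m e K1 \<le> e * (measure \<iota> K1 + \<delta> * measure \<rho> K1 + \<eta> / 3)"
        using good1[unfolded good_def, rule_format, OF \<eta>] by (rule eventually_mono) simp
      have ev2: "\<forall>\<^sub>F e in at_right 0. e * (measure \<iota> K2 - \<delta> * measure \<rho> K2 - \<eta> / 3) \<le> m e K2 \<and>
          m e K2 \<le> e * (measure \<iota> K2 + \<delta> * measure \<rho> K2 + \<eta> / 3)"
        using good2[unfolded good_def, rule_format, OF \<eta>] .
      have ev3: "\<forall>\<^sub>F e in at_right 0. e * (measure \<iota> (B n) - \<delta> * measure \<rho> (B n) - \<eta> / 3) \<le> m e (B n)"
        using goodB[unfolded good_def, rule_format, OF \<eta>] by (rule eventually_mono) simp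
      have ev4: "\<forall>\<^sub>F e in at_right 0. m e K \<le> m e K1 + m e K2"
        using sub[OF cK1 cK2] insert.prems(3) K by simp
      have ev5: "\<forall>\<^sub>F e in at_right 0. m e (B n) + m e K2 \<le> m e K"
        using cB cK2 insert.prems(2,3) BK1 disj K by (intro sup) auto
      from ev1 ev2 ev3 ev4 ev5 ev_pos
      show "\<forall>\<^sub>F e in at_right 0. e * (measure \<iota> K - \<delta> * measure \<rho> K - \<eta>) \<le> m e K \<and>
          m e K \<le> e * (measure \<iota> K + \<delta> * measure \<rho> K + \<eta>)"
      proof eventually_elim
        case (elim e)
        have "m e K \<le> e * (measure \<iota> K1 + \<delta> * measure \<rho> K1 + \<eta> / 3) + e * (measure \<iota> K2 + \<delta> * measure \<rho> K2 + \<eta> / 3)"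
          using elim by linarith
        also have "\<dots> = e * (measure \<iota> K + \<delta> * measure \<rho> K + 2 * (\<eta> / 3))"
          unfolding add\<rho> add\<iota> by (simp add: algebra_simps)
        also have "\<dots> \<le> e * (measure \<iota> K + \<delta> * measure \<rho> K + \<eta>)"
          using elim \<eta> by (intro mult_left_mono) auto
        finally have 1: "m e K \<le> e * (measure \<iota> K + \<delta> * measure \<rho> K + \<eta>)" .
        have "\<delta> * measure \<rho> (B n) \<le> \<delta> * measure \<rho> K1" using \<rho>B \<delta> by (rule mult_left_mono)
        then have "measure \<iota> K - \<delta> * measure \<rho> K - \<eta> \<le>
          (measure \<iota> (B n) - \<delta> * measure \<rho> (B n) - \<eta> / 3) + (measure \<iota> K2 - \<delta> * measure \<rho> K2 - \<eta> / 3)"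
          unfolding add\<rho> add\<iota> using n by (simp add: algebra_simps)
        then have "e * (measure \<iota> K - \<delta> * measure \<rho> K - \<eta>) \<le>
          e * ((measure \<iota> (B n) - \<delta> * measure \<rho> (B n) - \<eta> / 3) + (measure \<iota> K2 - \<delta> * measure \<rho> K2 - \<eta> / 3))"
          using elim by (intro mult_left_mono) auto
        also have "\<dots> = e * (measure \<iota> (B n) - \<delta> * measure \<rho> (B n) - \<eta> / 3) + e * (measure \<iota> K2 - \<delta> * measure \<rho> K2 - \<eta> / 3)"
          by (rule distrib_left)
        also have "\<dots> \<le> m e K" using elim by linarith
        finally show ?case using 1 by blast
      qed
    qed
  qed
  obtain J where "J \<subseteq> S" "finite J" "S \<subseteq> (\<Union>s\<in>J. ball s (t s))"
  proof (rule compactE_image[OF S, of S "\<lambda>s. ball s (t s)"])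
    show "S \<subseteq> (\<Union>s\<in>S. ball s (t s))" using t(1) by force
  qed auto
  then show ?thesis using step[of J S] S by blast
qed

text \<open>\<open>W\<close> lies on one side of the surface \<open>F = 0\<close> near \<open>s\<close>; points on the surface itself are left open.\<close>

definition one_sided :: "(real^3 \<Rightarrow> real) \<Rightarrow> (real^3) set \<Rightarrow> real^3 \<Rightarrow> bool" where
  "one_sided F W s \<longleftrightarrow> (\<exists>N. open N \<and> s \<in> N \<and>
     ((\<forall>p\<in>N. (p \<in> W \<longrightarrow> 0 \<le> F p) \<and> (0 < F p \<longrightarrow> p \<in> W)) \<or>
      (\<forall>p\<in>N. (p \<in> W \<longrightarrow> F p \<le> 0) \<and> (F p < 0 \<longrightarrow> p \<in> W))))"

lemma C1_level_surface_uminus: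
  assumes "C1_level_surface U F G M"
  shows "C1_level_surface U (\<lambda>p. - F p) (\<lambda>p. - G p) M"
  using assms unfolding C1_level_surface_def by (auto intro: GDERIV_minus continuous_intros)

text \<open>If \<open>W\<close> is the side \<open>F \<le> 0\<close>, the surface is regarded as the level set of \<open>- F\<close>; this changes neither the
  surface measure nor the density.\<close>

lemma local_content:
  assumes Q: "planar_unit_ball Q" and M: "C1_level_surface U F G M" and \<sigma>: "is_surface_measure M \<sigma>"
    and s: "s \<in> M" and \<delta>: "\<delta> > 0" and W: "W \<in> sets lebesgue" "one_sided F W s"
  shows "\<exists>r>0. \<forall>K. compact K \<longrightarrow> K \<subseteq> M \<inter> ball s r \<longrightarrow>
    (\<forall>\<eta>>0. \<forall>\<^sub>F e in at_right 0.
       e * ((horizontal_density Q G s - \<delta>) * measure \<sigma> K) \<le> measure lebesgue (cc_nbhd Q e K \<inter> W) \<and>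
       measure lebesgue (cc_nbhd Q e K \<inter> W) \<le> e * ((horizontal_density Q G s + \<delta>) * measure \<sigma> K + \<eta>))"
proof -
  have pos: "\<exists>r>0. \<forall>K. compact K \<longrightarrow> K \<subseteq> M \<inter> ball s r \<longrightarrow>
    (\<forall>\<eta>>0. \<forall>\<^sub>F e in at_right 0.
       e * ((horizontal_density Q G s - \<delta>) * measure \<sigma> K) \<le> measure lebesgue (cc_nbhd Q e K \<inter> W) \<and>
       measure lebesgue (cc_nbhd Q e K \<inter> W) \<le> e * ((horizontal_density Q G s + \<delta>) * measure \<sigma> K + \<eta>))"
    if M: "C1_level_surface U F G M" and N: "open N" "s \<in> N"
      "\<forall>p\<in>N. (p \<in> W \<longrightarrow> 0 \<le> F p) \<and> (0 < F p \<longrightarrow> p \<in> W)" for F G N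
  proof -
    have N3: "\<And>p. p \<in> N \<Longrightarrow> p \<in> W \<Longrightarrow> 0 \<le> F p" and N4: "\<And>p. p \<in> N \<Longrightarrow> 0 < F p \<Longrightarrow> p \<in> W"
      using N(3) by auto
    obtain r1 where r1: "r1 > 0"
      "\<And>K \<eta>. compact K \<Longrightarrow> K \<subseteq> M \<inter> ball s r1 \<Longrightarrow> \<eta> > 0 \<Longrightarrow> \<forall>\<^sub>F e in at_right 0.
         measure lebesgue (cc_nbhd Q e K \<inter> W) \<le> e * ((horizontal_density Q G s + \<delta>) * measure \<sigma> K + \<eta>)"
      using local_content_upper[OF Q M \<sigma> s \<delta> N(1,2) W(1) N3] by blast
    obtain r2 where r2: "r2 > 0" "\<And>K. compact K \<Longrightarrow> K \<subseteq> M \<inter> ball s r2 \<Longrightarrow> \<forall>\<^sub>F e in at_right 0.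
         e * ((horizontal_density Q G s - \<delta>) * measure \<sigma> K) \<le> measure lebesgue (cc_nbhd Q e K \<inter> W)"
      using local_content_lower[OF Q M \<sigma> s \<delta> N(1,2) W(1) N4] by blast
    show ?thesis
    proof (intro exI[of _ "min r1 r2"] conjI allI impI)
      show "0 < min r1 r2" using r1(1) r2(1) by simp
      fix K assume K: "compact K" "K \<subseteq> M \<inter> ball s (min r1 r2)"
      then have K12: "K \<subseteq> M \<inter> ball s r1" "K \<subseteq> M \<inter> ball s r2" by auto
      show "\<forall>\<^sub>F e in at_right 0.
         e * ((horizontal_density Q G s - \<delta>) * measure \<sigma> K) \<le> measure lebesgue (cc_nbhd Q e K \<inter> W) \<and>
         measure lebesgue (cc_nbhd Q e K \<inter> W) \<le> e * ((horizontal_density Q G s + \<delta>) * measure \<sigma> K + \<eta>)"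
        if "\<eta> > 0" for \<eta>
        using r2(2)[OF K(1) K12(2)] r1(2)[OF K(1) K12(1) that] by (rule eventually_conj)
    qed
  qed
  obtain N where N: "open N" "s \<in> N" and side:
     "(\<forall>p\<in>N. (p \<in> W \<longrightarrow> 0 \<le> F p) \<and> (0 < F p \<longrightarrow> p \<in> W)) \<or>
      (\<forall>p\<in>N. (p \<in> W \<longrightarrow> F p \<le> 0) \<and> (F p < 0 \<longrightarrow> p \<in> W))"
    using W(2) unfolding one_sided_def by blast
  from side show ?thesis
  proof
    assume "\<forall>p\<in>N. (p \<in> W \<longrightarrow> 0 \<le> F p) \<and> (0 < F p \<longrightarrow> p \<in> W)"
    then show ?thesis by (rule pos[OF M N])
  next
    assume "\<forall>p\<in>N. (p \<in> W \<longrightarrow> F p \<le> 0) \<and> (F p < 0 \<longrightarrow> p \<in> W)"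
    then have "\<forall>p\<in>N. (p \<in> W \<longrightarrow> 0 \<le> - F p) \<and> (0 < - F p \<longrightarrow> p \<in> W)" by simp
    from pos[OF C1_level_surface_uminus[OF M] N this] show ?thesis
      unfolding horizontal_density_uminus[OF Q] .
  qed
qed

lemma eventually_lmeasurable_cc_nbhd:
  assumes Q: "planar_unit_ball Q" and K: "compact K" and W: "W \<in> sets lebesgue"
  shows "\<forall>\<^sub>F e in at_right 0. cc_nbhd Q e K \<inter> W \<in> lmeasurable"
proof -
  obtain R where R: "K \<subseteq> ball 0 R" using compact_imp_bounded[OF K] by (meson bounded_subset_ballD)
  show ?thesis
    using cc_nbhd_subset_open[OF Q K open_ball R]
  proof eventually_elim
    case (elim e)
    have "cc_nbhd Q e K \<in> sets lebesgue" using open_cc_nbhd[OF Q, of e K] by auto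
    moreover have "bounded (cc_nbhd Q e K \<inter> W)"
      using elim by (intro bounded_subset[OF bounded_ball, of _ 0 R]) auto
    ultimately show ?case using W by (intro bounded_set_imp_lmeasurable) auto
  qed
qed

lemma measure_Un_disjoint_fmeasurable:
  assumes "A \<in> fmeasurable M" "B \<in> fmeasurable M" "A \<inter> B = {}"
  shows "measure M (A \<union> B) = measure M A + measure M B"
  using assms by (intro measure_Union) (auto simp: fmeasurableD2)

lemma surface_measure_compact_finite:
  assumes Q: "planar_unit_ball Q" and M: "C1_level_surface U F G M" and \<sigma>: "is_surface_measure M \<sigma>"
    and S: "compact S" "S \<subseteq> M"
  shows "emeasure \<sigma> S < \<infinity>"
proof -
  have sets: "sets \<sigma> = sets borel" using \<sigma> by (simp add: is_surface_measure_def)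
  have "\<exists>r>0. emeasure \<sigma> (S \<inter> cball s r) < \<infinity>" if s: "s \<in> S" for s
  proof -
    have "s \<in> M" using s S(2) by blast
    then have nz: "G s \<noteq> 0" using M by (simp add: C1_level_surface_def)
    obtain b c where bc: "G s \<bullet> line_field b c s \<noteq> 0" by (rule ex_transversal_line_field[OF nz])
    define \<tau> where "\<tau> = min \<bar>G s \<bullet> line_field b c s\<bar> (norm (G s)) / 2"
    have \<tau>: "0 < \<tau>" "\<tau> < \<bar>G s \<bullet> line_field b c s\<bar>" "\<tau> < norm (G s)"
      using nz bc by (auto simp: \<tau>_def min_def)
    show ?thesis
    proof (rule level_surface_chart[OF Q M \<sigma> \<open>s \<in> M\<close> open_UNIV UNIV_I refl refl \<tau>])
      fix B r assume r: "r > 0" "ball s r \<subseteq> B" and fin: "\<forall>K. compact K \<longrightarrow> K \<subseteq> M \<inter> B \<longrightarrow> emeasure \<sigma> K < \<infinity> \<and>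
        (norm (G s) - \<tau>) / (\<bar>G s \<bullet> line_field b c s\<bar> + \<tau>) * measure lebesgue (line_proj b c ` K) \<le> measure \<sigma> K \<and>
        measure \<sigma> K \<le> (norm (G s) + \<tau>) / (\<bar>G s \<bullet> line_field b c s\<bar> - \<tau>) * measure lebesgue (line_proj b c ` K)"
      have "cball s (r / 2) \<subseteq> ball s r" using r(1) by auto
      then have "compact (S \<inter> cball s (r / 2))" "S \<inter> cball s (r / 2) \<subseteq> M \<inter> B"
        using S r(2) by (auto intro: compact_Int_closed)
      then have "emeasure \<sigma> (S \<inter> cball s (r / 2)) < \<infinity>" using fin by blast
      then show ?thesis using r(1) by (intro exI[of _ "r / 2"]) simp
    qed
  qed
  then obtain r where r: "\<And>s. s \<in> S \<Longrightarrow> r s > 0 \<and> emeasure \<sigma> (S \<inter> cball s (r s)) < \<infinity>" by metis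
  obtain J where J: "J \<subseteq> S" "finite J" "S \<subseteq> (\<Union>s\<in>J. ball s (r s))"
  proof (rule compactE_image[OF S(1), of S "\<lambda>s. ball s (r s)"])
    show "S \<subseteq> (\<Union>s\<in>S. ball s (r s))" using r by force
  qed auto
  have cb: "S \<inter> cball s (r s) \<in> sets \<sigma>" for s
    unfolding sets using S(1) by (intro borel_compact compact_Int_closed) auto
  have "S \<subseteq> (\<Union>s\<in>J. S \<inter> cball s (r s))" using J(3) by force
  then have "emeasure \<sigma> S \<le> emeasure \<sigma> (\<Union>s\<in>J. S \<inter> cball s (r s))"
    using cb J(2) by (intro emeasure_mono sets.finite_UN) auto
  also have "\<dots> \<le> (\<Sum>s\<in>J. emeasure \<sigma> (S \<inter> cball s (r s)))"
    using cb J(2) by (intro emeasure_subadditive_finite) auto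
  also have "\<dots> < \<infinity>" using J r by (auto simp: ennreal_sum_less_top)
  finally show ?thesis .
qed

text \<open>On a small piece around \<open>s\<close> the density is close to its value at \<open>s\<close>, so \<open>local_content\<close> compares the
  volume with the flux measure \<open>\<iota>\<close>, the surface measure weighted by the density. The error is \<open>\<delta>\<close> times the
  surface measure \<open>\<rho>\<close> of the piece; these errors add up to \<open>\<delta>\<close> times the area of \<open>S\<close>, and \<open>\<delta>\<close> is arbitrary.\<close>

lemma one_sided_content:
  assumes Q: "planar_unit_ball Q" and M: "C1_level_surface U F G M" and \<sigma>: "is_surface_measure M \<sigma>"
    and S: "compact S" "S \<subseteq> M" and W: "W \<in> sets lebesgue" "\<And>s. s \<in> S \<Longrightarrow> one_sided F W s"
  shows "((\<lambda>e. measure lebesgue (cc_nbhd Q e S \<inter> W) / e) \<longlongrightarrow> (LINT p:S|\<sigma>. horizontal_density Q G p)) (at_right 0)"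
proof -
  have sets: "sets \<sigma> = sets borel" using \<sigma> by (simp add: is_surface_measure_def)
  define k where "k = horizontal_density Q G"
  define m where "m e K = measure lebesgue (cc_nbhd Q e K \<inter> W)" for e K
  have Sb: "S \<in> sets borel" using S(1) by (rule borel_compact)
  have finS: "emeasure \<sigma> S < \<infinity>" by (rule surface_measure_compact_finite[OF Q M \<sigma> S])
  have k_cont: "continuous_on S k"
    unfolding k_def using M S(2) unfolding C1_level_surface_def
    by (intro continuous_on_horizontal_density[OF Q]) (auto intro: continuous_on_subset)
  have k_nn: "0 \<le> k p" for p by (simp add: k_def horizontal_density_nonneg[OF Q])
  obtain C where C: "\<And>p. p \<in> S \<Longrightarrow> k p \<le> C"
  proof -
    have "bounded (k ` S)" using compact_continuous_image[OF k_cont S(1)] by (rule compact_imp_bounded)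
    then obtain C where "\<And>x. x \<in> k ` S \<Longrightarrow> norm x \<le> C" by (auto simp: bounded_iff)
    then show ?thesis using that[of C] by force
  qed
  have km: "(\<lambda>p. indicator S p *\<^sub>R k p) \<in> borel_measurable \<sigma>"
    unfolding measurable_cong_sets[OF sets refl] by (rule borel_measurable_continuous_on_indicator[OF Sb k_cont])
  define \<rho> where "\<rho> = density \<sigma> (indicator S)"
  define \<iota> where "\<iota> = density \<sigma> (\<lambda>p. ennreal (indicator S p *\<^sub>R k p))"
  have sets\<rho>: "sets \<rho> = sets borel" and sets\<iota>: "sets \<iota> = sets borel" by (simp_all add: \<rho>_def \<iota>_def sets)
  have em\<rho>: "emeasure \<rho> A = emeasure \<sigma> (S \<inter> A)" if "A \<in> sets borel" for A
    unfolding \<rho>_def using that Sb sets by (subst emeasure_density) (auto simp: nn_integral_indicator[symmetric] indicator_inter_arith simp del: nn_integral_indicator)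
  have em\<iota>: "emeasure \<iota> A = (\<integral>\<^sup>+p. ennreal (indicator S p *\<^sub>R k p) * indicator A p \<partial>\<sigma>)" if "A \<in> sets borel" for A
    unfolding \<iota>_def using that km sets by (subst emeasure_density) auto
  have \<iota>_le: "emeasure \<iota> A \<le> ennreal u * emeasure \<rho> A"
    if A: "A \<in> sets borel" and u: "\<And>p. p \<in> S \<inter> A \<Longrightarrow> k p \<le> u" for A u
  proof -
    have "emeasure \<iota> A \<le> (\<integral>\<^sup>+p. ennreal u * indicator (S \<inter> A) p \<partial>\<sigma>)"
      unfolding em\<iota>[OF A] using u by (intro nn_integral_mono) (auto simp: indicator_def intro!: ennreal_leI)
    also have "\<dots> = ennreal u * emeasure \<rho> A"
      unfolding em\<rho>[OF A] using A Sb sets by (intro nn_integral_cmult_indicator) auto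
    finally show ?thesis .
  qed
  have \<iota>_ge: "ennreal l * emeasure \<rho> A \<le> emeasure \<iota> A"
    if A: "A \<in> sets borel" and l: "\<And>p. p \<in> S \<inter> A \<Longrightarrow> l \<le> k p" for A l
  proof -
    have "ennreal l * emeasure \<rho> A = (\<integral>\<^sup>+p. ennreal l * indicator (S \<inter> A) p \<partial>\<sigma>)"
      unfolding em\<rho>[OF A] using A Sb sets by (intro nn_integral_cmult_indicator[symmetric]) auto
    also have "\<dots> \<le> emeasure \<iota> A"
      unfolding em\<iota>[OF A] using l by (intro nn_integral_mono) (auto simp: indicator_def intro!: ennreal_leI)
    finally show ?thesis .
  qed
  have fin\<rho>: "finite_measure \<rho>"
    by (rule finite_measureI) (use em\<rho>[of UNIV] finS sets_eq_imp_space_eq[OF sets\<rho>] in auto)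
  have fin\<iota>: "finite_measure \<iota>"
  proof (rule finite_measureI)
    have "emeasure \<iota> UNIV \<le> ennreal C * emeasure \<rho> UNIV" using C by (intro \<iota>_le) auto
    also have "\<dots> < \<infinity>" using em\<rho>[of UNIV] finS by (simp add: ennreal_mult_less_top)
    finally show "emeasure \<iota> (space \<iota>) \<noteq> \<infinity>" using sets_eq_imp_space_eq[OF sets\<iota>] by simp
  qed
  interpret \<rho>: finite_measure \<rho> by fact
  interpret \<iota>: finite_measure \<iota> by fact
  have m\<rho>: "measure \<rho> K = measure \<sigma> K" if "K \<in> sets borel" "K \<subseteq> S" for K
    using em\<rho>[OF that(1)] that(2) by (simp add: measure_def Int_absorb1)
  have m\<iota>_le: "measure \<iota> A \<le> u * measure \<rho> A" if "A \<in> sets borel" "\<And>p. p \<in> S \<inter> A \<Longrightarrow> k p \<le> u" "0 \<le> u" for A u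
    using \<iota>_le[OF that(1,2)] that(3) by (simp add: \<iota>.emeasure_eq_measure \<rho>.emeasure_eq_measure flip: ennreal_mult)
  have m\<iota>_ge: "l * measure \<rho> A \<le> measure \<iota> A" if "A \<in> sets borel" "\<And>p. p \<in> S \<inter> A \<Longrightarrow> l \<le> k p" for A l
  proof (cases "l \<ge> 0")
    case True
    then show ?thesis
      using \<iota>_ge[OF that] by (simp add: \<iota>.emeasure_eq_measure \<rho>.emeasure_eq_measure flip: ennreal_mult)
  next
    case False
    then have "l * measure \<rho> A \<le> 0" by (intro mult_nonpos_nonneg) auto
    then show ?thesis using measure_nonneg[of \<iota> A] by linarith
  qed
  have \<iota>S: "measure \<iota> S = (LINT p:S|\<sigma>. k p)"
  proof -
    have "(LINT p:S|\<sigma>. k p) = enn2real (\<integral>\<^sup>+p. ennreal (indicator S p *\<^sub>R k p) \<partial>\<sigma>)"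
      unfolding set_lebesgue_integral_def using km k_nn by (intro integral_eq_nn_integral) auto
    also have "(\<integral>\<^sup>+p. ennreal (indicator S p *\<^sub>R k p) \<partial>\<sigma>) = emeasure \<iota> S"
      unfolding em\<iota>[OF Sb] by (intro nn_integral_cong) (auto simp: indicator_def)
    finally show ?thesis by (simp add: measure_def)
  qed
  have ev_pos: "\<forall>\<^sub>F e in at_right 0. (0::real) < e" by (simp add: eventually_at_right_less)
  have good: "\<forall>\<eta>>0. \<forall>\<^sub>F e in at_right 0.
      e * (measure \<iota> S - \<delta> * measure \<rho> S - \<eta>) \<le> m e S \<and> m e S \<le> e * (measure \<iota> S + \<delta> * measure \<rho> S + \<eta>)"
    if \<delta>: "\<delta> > 0" for \<delta>
  proof (rule content_estimate_globalise[OF fin\<rho> sets\<rho> fin\<iota> sets\<iota> less_imp_le[OF \<delta>] S(1)])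
    show "\<forall>\<eta>>0. \<forall>\<^sub>F e in at_right 0. e * (measure \<iota> {} - \<delta> * measure \<rho> {} - \<eta>) \<le> m e {} \<and>
        m e {} \<le> e * (measure \<iota> {} + \<delta> * measure \<rho> {} + \<eta>)"
    proof (intro allI impI)
      fix \<eta> :: real assume "\<eta> > 0"
      show "\<forall>\<^sub>F e in at_right 0. e * (measure \<iota> {} - \<delta> * measure \<rho> {} - \<eta>) \<le> m e {} \<and>
        m e {} \<le> e * (measure \<iota> {} + \<delta> * measure \<rho> {} + \<eta>)"
        using ev_pos by eventually_elim (use \<open>\<eta> > 0\<close> in \<open>simp add: m_def cc_nbhd_def\<close>)
    qed
    show "\<forall>\<^sub>F e in at_right 0. m e (K1 \<union> K2) \<le> m e K1 + m e K2" if "compact K1" "compact K2" for K1 K2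
      using eventually_lmeasurable_cc_nbhd[OF Q that(1) W(1)] eventually_lmeasurable_cc_nbhd[OF Q that(2) W(1)]
    proof eventually_elim
      case (elim e)
      have "cc_nbhd Q e (K1 \<union> K2) \<inter> W = (cc_nbhd Q e K1 \<inter> W) \<union> (cc_nbhd Q e K2 \<inter> W)"
        by (auto simp: cc_nbhd_Un)
      then show ?case unfolding m_def using elim by (simp add: measure_Un_le)
    qed
    show "\<forall>\<^sub>F e in at_right 0. m e K1 + m e K2 \<le> m e K"
      if K: "compact K1" "compact K2" "compact K" "K1 \<union> K2 \<subseteq> K" "K1 \<inter> K2 = {}" for K1 K2 K
    proof -
      obtain V1 V2 where V: "open V1" "open V2" "K1 \<subseteq> V1" "K2 \<subseteq> V2" "V1 \<inter> V2 = {}"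
        using separation_normal[of K1 K2] K(1,2,5) by (metis compact_imp_closed)
      from cc_nbhd_subset_open[OF Q K(1) V(1,3)] cc_nbhd_subset_open[OF Q K(2) V(2,4)]
        eventually_lmeasurable_cc_nbhd[OF Q K(1) W(1)] eventually_lmeasurable_cc_nbhd[OF Q K(2) W(1)]
        eventually_lmeasurable_cc_nbhd[OF Q K(3) W(1)]
      show ?thesis
      proof eventually_elim
        case (elim e)
        have "m e K1 + m e K2 = measure lebesgue ((cc_nbhd Q e K1 \<inter> W) \<union> (cc_nbhd Q e K2 \<inter> W))"
          unfolding m_def using elim V(5)
          by (intro measure_Un_disjoint_fmeasurable[symmetric]) auto
        also have "\<dots> \<le> m e K"
          unfolding m_def using elim cc_nbhd_mono[of K1 K Q e] cc_nbhd_mono[of K2 K Q e] K(4)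
          by (intro measure_mono_fmeasurable) auto
        finally show ?case .
      qed
    qed
    fix s assume s: "s \<in> S"
    then have sM: "s \<in> M" using S(2) by blast
    have \<delta>2: "\<delta> / 2 > 0" using \<delta> by simp
    obtain r1 where r1: "r1 > 0" and r1K: "\<forall>K. compact K \<longrightarrow> K \<subseteq> M \<inter> ball s r1 \<longrightarrow>
      (\<forall>\<eta>>0. \<forall>\<^sub>F e in at_right 0.
         e * ((k s - \<delta> / 2) * measure \<sigma> K) \<le> m e K \<and> m e K \<le> e * ((k s + \<delta> / 2) * measure \<sigma> K + \<eta>))"
      using local_content[OF Q M \<sigma> sM \<delta>2 W(1) W(2)[OF s]] unfolding m_def k_def by blast
    obtain r2 where r2: "r2 > 0" "\<And>p. p \<in> S \<Longrightarrow> dist p s < r2 \<Longrightarrow> dist (k p) (k s) < \<delta> / 2"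
      using k_cont s \<delta>2 unfolding continuous_on_iff by blast
    show "\<exists>r>0. \<forall>K. compact K \<longrightarrow> K \<subseteq> S \<inter> ball s r \<longrightarrow>
      (\<forall>\<eta>>0. \<forall>\<^sub>F e in at_right 0. e * (measure \<iota> K - \<delta> * measure \<rho> K - \<eta>) \<le> m e K \<and>
        m e K \<le> e * (measure \<iota> K + \<delta> * measure \<rho> K + \<eta>))"
    proof (intro exI[of _ "min r1 r2"] conjI allI impI)
      show "0 < min r1 r2" using r1 r2(1) by simp
      fix K and \<eta> :: real assume K: "compact K" "K \<subseteq> S \<inter> ball s (min r1 r2)" and \<eta>: "\<eta> > 0"
      have Kb: "K \<in> sets borel" using K(1) by (rule borel_compact)
      have eq: "measure \<rho> K = measure \<sigma> K" using K(2) by (intro m\<rho>[OF Kb]) auto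
      have near: "k s - \<delta> / 2 \<le> k p \<and> k p \<le> k s + \<delta> / 2" if "p \<in> S \<inter> K" for p
      proof -
        have "p \<in> ball s (min r1 r2)" using that K(2) by blast
        then have "dist p s < r2" by (simp add: dist_commute)
        then have "dist (k p) (k s) < \<delta> / 2" using r2(2)[of p] that by blast
        then show ?thesis unfolding dist_real_def by linarith
      qed
      have \<iota>1: "(k s - \<delta> / 2) * measure \<sigma> K \<le> measure \<iota> K"
        using m\<iota>_ge[OF Kb, of "k s - \<delta> / 2"] near eq by simp
      have \<iota>2: "measure \<iota> K \<le> (k s + \<delta> / 2) * measure \<sigma> K"
        using m\<iota>_le[OF Kb, of "k s + \<delta> / 2"] near eq k_nn[of s] \<delta> by simp
      have "K \<subseteq> M \<inter> ball s r1" using K(2) S(2) by auto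
      with r1K K(1) \<eta> have "\<forall>\<^sub>F e in at_right 0.
         e * ((k s - \<delta> / 2) * measure \<sigma> K) \<le> m e K \<and> m e K \<le> e * ((k s + \<delta> / 2) * measure \<sigma> K + \<eta>)"
        by blast
      with ev_pos show "\<forall>\<^sub>F e in at_right 0. e * (measure \<iota> K - \<delta> * measure \<rho> K - \<eta>) \<le> m e K \<and>
        m e K \<le> e * (measure \<iota> K + \<delta> * measure \<rho> K + \<eta>)"
        unfolding eq
      proof eventually_elim
        case (elim e)
        have "e * (measure \<iota> K - \<delta> * measure \<sigma> K - \<eta>) \<le> e * ((k s - \<delta> / 2) * measure \<sigma> K)"
          using elim(1) \<iota>2 \<eta> by (intro mult_left_mono) (auto simp: algebra_simps)
        moreover have "e * ((k s + \<delta> / 2) * measure \<sigma> K + \<eta>) \<le> e * (measure \<iota> K + \<delta> * measure \<sigma> K + \<eta>)"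
          using elim(1) \<iota>1 by (intro mult_left_mono) (auto simp: algebra_simps)
        ultimately show ?case using elim(2) by linarith
      qed
    qed
  qed
  have "((\<lambda>e. m e S / e) \<longlongrightarrow> measure \<iota> S) (at_right 0)"
  proof (rule tendstoI)
    fix \<gamma> :: real assume \<gamma>: "\<gamma> > 0"
    obtain x where x: "x = measure \<rho> S + 1" "x > 0" using measure_nonneg[of \<rho> S] by simp
    define \<delta> where "\<delta> = \<gamma> / 2 / x"
    have \<delta>: "\<delta> > 0" using \<gamma> x(2) by (simp add: \<delta>_def)
    have "\<delta> * x = \<gamma> / 2" using x(2) by (simp add: \<delta>_def)
    then have \<delta>\<rho>: "\<delta> * measure \<rho> S < \<gamma> / 2" using \<delta> unfolding x(1) by (simp add: distrib_left)
    have "\<forall>\<^sub>F e in at_right 0. e * (measure \<iota> S - \<delta> * measure \<rho> S - \<gamma> / 2) \<le> m e S \<and>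
        m e S \<le> e * (measure \<iota> S + \<delta> * measure \<rho> S + \<gamma> / 2)"
      using good[OF \<delta>] \<gamma> by simp
    with ev_pos show "\<forall>\<^sub>F e in at_right 0. dist (m e S / e) (measure \<iota> S) < \<gamma>"
    proof eventually_elim
      case (elim e)
      then have "measure \<iota> S - \<delta> * measure \<rho> S - \<gamma> / 2 \<le> m e S / e" "m e S / e \<le> measure \<iota> S + \<delta> * measure \<rho> S + \<gamma> / 2"
        by (simp_all add: le_divide_eq divide_le_eq mult.commute)
      then show ?case using \<delta>\<rho> by (simp add: dist_real_def abs_less_iff)
    qed
  qed
  then show ?thesis unfolding \<iota>S m_def k_def .
qed

section \<open>The Minkowski content\<close>

text \<open>Each of the two local sides of the surface is connected and does not meet the frontier of \<open>E\<close>, so it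
  lies inside or outside of \<open>E\<close>; both on the same side is impossible, because \<open>E\<close> is the closure of its
  interior and \<open>s\<close> a frontier point.\<close>

lemma one_sided_complement_of_region:
  assumes M: "C1_level_surface U F G M" and E: "bounds_region S E" and S: "S \<subseteq> M" and s: "s \<in> S"
  shows "one_sided F (- E) s"
proof -
  have U: "open U" "\<And>p. p \<in> U \<Longrightarrow> GDERIV F p :> G p" "continuous_on U G" "M = {p \<in> U. F p = 0}"
    "\<And>p. p \<in> M \<Longrightarrow> G p \<noteq> 0"
    using M by (auto simp: C1_level_surface_def)
  have E': "closed E" "E = closure (interior E)" "frontier E = S"
    using E by (auto simp: bounds_region_def compact_imp_closed)
  have sM: "s \<in> M" "s \<in> U" using S s U(4) by auto
  obtain b c where bc: "G s \<bullet> line_field b c s \<noteq> 0"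
    using ex_transversal_line_field[OF U(5)[OF sM(1)]] by blast
  let ?X = "line_chart b c F"
  obtain B g where B: "open B" "s \<in> B" "B \<subseteq> U" "open (?X ` B)" "homeomorphism B (?X ` B) ?X g"
    using line_chart_local_homeomorphism[OF U(1-3) sM(2) bc] by metis
  obtain e where e: "e > 0" "ball (?X s) e \<subseteq> ?X ` B"
    using B(2,4) by (meson imageI open_contains_ball)
  define N where "N = B \<inter> ?X -` ball (?X s) e"
  have contX: "continuous_on B ?X" and contg: "continuous_on (?X ` B) g"
    and gX: "\<And>p. p \<in> B \<Longrightarrow> g (?X p) = p" and Xg: "\<And>y. y \<in> ?X ` B \<Longrightarrow> ?X (g y) = y \<and> g y \<in> B"
    using B(5) unfolding homeomorphism_def by auto
  have N: "open N" "s \<in> N" "N \<subseteq> U"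
    unfolding N_def using B(1,2,3) contX e(1) by (auto intro!: continuous_open_preimage)
  have half: "connected {p \<in> N. P (F p)}" if "convex {y :: real^3. P (y$1)}" for P
  proof -
    have "{p \<in> N. P (F p)} = g ` (ball (?X s) e \<inter> {y. P (y$1)})"
    proof
      show "{p \<in> N. P (F p)} \<subseteq> g ` (ball (?X s) e \<inter> {y. P (y$1)})"
      proof
        fix p assume p: "p \<in> {p \<in> N. P (F p)}"
        then have "?X p \<in> ball (?X s) e \<inter> {y. P (y$1)}" "p = g (?X p)" using gX by (auto simp: N_def)
        then show "p \<in> g ` (ball (?X s) e \<inter> {y. P (y$1)})" by blast
      qed
      show "g ` (ball (?X s) e \<inter> {y. P (y$1)}) \<subseteq> {p \<in> N. P (F p)}"
      proof
        fix p assume "p \<in> g ` (ball (?X s) e \<inter> {y. P (y$1)})"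
        then obtain y where y: "y \<in> ball (?X s) e" "P (y$1)" "p = g y" by blast
        then have Xp: "?X p = y" and "p \<in> B" using Xg e(2) by auto
        moreover have "F p = y$1" using arg_cong[OF Xp, of "\<lambda>v. v$1"] by simp
        ultimately show "p \<in> {p \<in> N. P (F p)}" using y by (auto simp: N_def)
      qed
    qed
    moreover have "connected (ball (?X s) e \<inter> {y. P (y$1)})"
      using that by (intro convex_connected convex_Int convex_ball)
    ultimately show ?thesis
      using connected_continuous_image[OF continuous_on_subset[OF contg], of "ball (?X s) e \<inter> {y. P (y$1)}"] e(2)
      by (metis inf.coboundedI1)
  qed
  have convex_pos: "convex {y :: real^3. 0 < y$1}" and convex_neg: "convex {y :: real^3. y$1 < 0}"
    using convex_halfspace_gt[of 0 "axis 1 1 :: real^3"] convex_halfspace_lt[of "axis 1 1 :: real^3" 0]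
    by (simp_all add: inner_axis' )
  have pos: "connected {p \<in> N. 0 < F p}" and neg: "connected {p \<in> N. F p < 0}"
    using half[OF convex_pos] half[OF convex_neg] by auto
  have F0: "F p = 0" if "p \<in> frontier E" for p using that E'(3) S U(4) by blast
  have dich: "A \<subseteq> E \<or> A \<inter> E = {}" if A: "connected A" "A \<inter> frontier E = {}" for A
    using connected_Int_frontier[OF A(1), of E] A(2) by blast
  have dpos: "{p \<in> N. 0 < F p} \<subseteq> E \<or> {p \<in> N. 0 < F p} \<inter> E = {}" using F0 by (intro dich pos) force
  have dneg: "{p \<in> N. F p < 0} \<subseteq> E \<or> {p \<in> N. F p < 0} \<inter> E = {}" using F0 by (intro dich neg) force
  have hits: "\<exists>q\<in>A. 0 < F q" if "p \<in> N" "F p = 0" "open A" "p \<in> A" for p A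
    using positive_value_near_zero[OF U(2) U(5)] that N(3) U(4) by blast
  have sE: "s \<in> frontier E" using s E'(3) by simp
  have not_both: "\<not> ({p \<in> N. 0 < F p} \<subseteq> E \<and> {p \<in> N. F p < 0} \<subseteq> E)"
  proof
    assume *: "{p \<in> N. 0 < F p} \<subseteq> E \<and> {p \<in> N. F p < 0} \<subseteq> E"
    have "p \<in> E" if p: "p \<in> N" for p
    proof (rule ccontr)
      assume "p \<notin> E"
      then have "F p = 0" using * p by force
      from hits[OF p this, of "N \<inter> - E"] show False
        using N(1) E'(1) p \<open>p \<notin> E\<close> * by (auto simp: open_Int)
    qed
    then have "s \<in> interior E" using N(1,2) by (meson interiorI subsetI)
    then show False using sE by (simp add: frontier_def)
  qed
  have not_none: "\<not> ({p \<in> N. 0 < F p} \<inter> E = {} \<and> {p \<in> N. F p < 0} \<inter> E = {})"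
  proof
    assume *: "{p \<in> N. 0 < F p} \<inter> E = {} \<and> {p \<in> N. F p < 0} \<inter> E = {}"
    have "s \<in> closure (interior E)" using sE E'(1,2) frontier_subset_closed by blast
    then obtain q where q: "q \<in> interior E" "q \<in> N" 
      using N(1,2) by (metis IntI closure_iff_nhds_not_empty disjoint_iff open_Int subset_refl)
    then have qE: "q \<in> E" using interior_subset by blast
    then have "F q = 0" using * q by force
    from hits[OF q(2) this, of "N \<inter> interior E"] show False
      using N(1) q * interior_subset[of E] by (auto simp: open_Int)
  qed
  show ?thesis
  proof (cases "{p \<in> N. 0 < F p} \<subseteq> E")
    case True
    then have "{p \<in> N. F p < 0} \<inter> E = {}" using not_both dneg by blast
    then show ?thesis using True N unfolding one_sided_def by (intro exI[of _ N]) (auto simp: not_less[symmetric])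
  next
    case False
    then have "{p \<in> N. 0 < F p} \<inter> E = {}" using dpos by blast
    moreover have "{p \<in> N. F p < 0} \<subseteq> E" using calculation not_none dneg by blast
    ultimately show ?thesis using N unfolding one_sided_def by (intro exI[of _ N]) (auto simp: not_less[symmetric])
  qed
qed

lemma two_sided_content:
  assumes Q: "planar_unit_ball Q" and M: "C1_level_surface U F G M" and \<sigma>: "is_surface_measure M \<sigma>"
    and S: "compact S" "S \<subseteq> M"
  shows "((\<lambda>e. measure lebesgue (cc_nbhd Q e S) / (2 * e)) \<longlongrightarrow> (LINT p:S|\<sigma>. horizontal_density Q G p)) (at_right 0)"
proof -
  let ?c = "LINT p:S|\<sigma>. horizontal_density Q G p"
  have U: "open U" "\<And>p. p \<in> U \<Longrightarrow> GDERIV F p :> G p" "M = {p \<in> U. F p = 0}"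
    using M by (auto simp: C1_level_surface_def)
  have SU: "S \<subseteq> U" using S(2) U(3) by blast
  have contF: "continuous_on U F"
    using U(2) by (meson continuous_at_imp_continuous_on gderiv_def has_derivative_continuous)
  \<comment> \<open>The surface itself has to be given to one of the two sides, to make them a partition of \<open>U\<close>.\<close>
  define W1 where "W1 = U \<inter> F -` {0<..}"
  define W2 where "W2 = U \<inter> F -` {..0}"
  have W: "W1 \<in> sets borel" "W2 \<in> sets borel"
    unfolding W1_def W2_def using U(1) contF by (auto intro!: borel_vimage_continuous_on)
  then have Wl: "W1 \<in> sets lebesgue" "W2 \<in> sets lebesgue" by auto
  have "one_sided F W1 s" "one_sided F W2 s" if "s \<in> S" for s
    using that SU U(1) unfolding one_sided_def W1_def W2_def by (auto intro!: exI[of _ U])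
  then have lim: "((\<lambda>e. measure lebesgue (cc_nbhd Q e S \<inter> W1) / e) \<longlongrightarrow> ?c) (at_right 0)"
    "((\<lambda>e. measure lebesgue (cc_nbhd Q e S \<inter> W2) / e) \<longlongrightarrow> ?c) (at_right 0)"
    using one_sided_content[OF Q M \<sigma> S] Wl by auto
  have "((\<lambda>e. (measure lebesgue (cc_nbhd Q e S \<inter> W1) / e + measure lebesgue (cc_nbhd Q e S \<inter> W2) / e) / 2)
      \<longlongrightarrow> (?c + ?c) / 2) (at_right 0)"
    by (intro tendsto_intros lim) simp
  moreover have "\<forall>\<^sub>F e in at_right 0. (measure lebesgue (cc_nbhd Q e S \<inter> W1) / e + measure lebesgue (cc_nbhd Q e S \<inter> W2) / e) / 2 =
      measure lebesgue (cc_nbhd Q e S) / (2 * e)"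
    using cc_nbhd_subset_open[OF Q S(1) U(1) SU] eventually_lmeasurable_cc_nbhd[OF Q S(1) Wl(1)]
      eventually_lmeasurable_cc_nbhd[OF Q S(1) Wl(2)]
  proof eventually_elim
    case (elim e)
    have "cc_nbhd Q e S = (cc_nbhd Q e S \<inter> W1) \<union> (cc_nbhd Q e S \<inter> W2)"
      using elim(1) by (auto simp: W1_def W2_def)
    also have "measure lebesgue \<dots> = measure lebesgue (cc_nbhd Q e S \<inter> W1) + measure lebesgue (cc_nbhd Q e S \<inter> W2)"
      using elim(2,3) by (intro measure_Un_disjoint_fmeasurable) (auto simp: W1_def W2_def)
    finally show ?case by (simp add: add_divide_distrib)
  qed
  ultimately have "((\<lambda>e. measure lebesgue (cc_nbhd Q e S) / (2 * e)) \<longlongrightarrow> (?c + ?c) / 2) (at_right 0)"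
    by (rule Lim_transform_eventually)
  then show ?thesis by simp
qed

text \<open>The points that the neighbourhood of \<open>E\<close> adds to \<open>E\<close> are those of the neighbourhood of the frontier \<open>S\<close> in the
  complement of \<open>E\<close>, so this is a one-sided content.\<close>

lemma region_content:
  assumes Q: "planar_unit_ball Q" and M: "C1_level_surface U F G M" and \<sigma>: "is_surface_measure M \<sigma>"
    and S: "compact S" "S \<subseteq> M" and E: "bounds_region S E"
  shows "((\<lambda>e. (measure lebesgue (cc_nbhd Q e E) - measure lebesgue E) / e) \<longlongrightarrow>
           (LINT p:S|\<sigma>. horizontal_density Q G p)) (at_right 0)"
proof -
  have E': "compact E" "closed E" "frontier E = S"
    using E by (auto simp: bounds_region_def compact_imp_closed)
  have "- E \<in> sets lebesgue" using E'(2) by auto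
  then have "((\<lambda>e. measure lebesgue (cc_nbhd Q e S \<inter> - E) / e) \<longlongrightarrow> (LINT p:S|\<sigma>. horizontal_density Q G p)) (at_right 0)"
    by (rule one_sided_content[OF Q M \<sigma> S _ one_sided_complement_of_region[OF M E S(2)]])
  moreover have "\<forall>\<^sub>F e in at_right 0. measure lebesgue (cc_nbhd Q e S \<inter> - E) / e =
      (measure lebesgue (cc_nbhd Q e E) - measure lebesgue E) / e"
  proof -
    have "\<forall>\<^sub>F e in at_right 0. (0::real) < e" by (simp add: eventually_at_right_less)
    with eventually_lmeasurable_cc_nbhd[OF Q E'(1), of UNIV, simplified] show ?thesis
    proof eventually_elim
      case (elim e)
      have "cc_nbhd Q e S \<inter> - E = cc_nbhd Q e E - E"
        using cc_nbhd_diff_eq_frontier[OF Q E'(2)] E'(3) by auto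
      moreover have "measure lebesgue (cc_nbhd Q e E - E) = measure lebesgue (cc_nbhd Q e E) - measure lebesgue E"
        using elim cc_nbhd_superset[OF Q elim(2), of E] lmeasurable_compact[OF E'(1)]
        by (intro measurable_measure_Diff) auto
      ultimately show ?case by simp
    qed
  qed
  ultimately show ?thesis by (rule Lim_transform_eventually)
qed

theorem theorem1:
  fixes Q :: "(real^2) set"
    and U M S :: "(real^3) set"
    and F :: "real^3 \<Rightarrow> real"
    and gradF :: "real^3 \<Rightarrow> real^3"
  assumes "planar_unit_ball Q"
    and "C1_level_surface U F gradF M"
    and "compact_subsurface M S"
    and "regular_surface gradF M S"
  shows "has_minkowski_content Q S
    (LINT p:S|surface_measure M.
       dual_norm_of Q (horizontal_matrix p *v (gradF p /\<^sub>R norm (gradF p))))"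
proof -
  have S: "compact S" "S \<subseteq> M" using assms(3) by (auto simp: compact_subsurface_def)
  have \<sigma>: "is_surface_measure M (surface_measure M)"
    by (rule is_surface_measure_surface_measure[OF assms(2)])
  show ?thesis
    unfolding has_minkowski_content_def horizontal_density_def[symmetric]
    using two_sided_content[OF assms(1,2) \<sigma> S] region_content[OF assms(1,2) \<sigma> S] by blast
qed

end
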